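(* Let $\{S_\omega\}_{\omega\in\Omega}$ be a net of subnormal operators in a complex Hilbert space $\mathcal H$ and let $S$ be a densely defined operator in $\mathcal H$. Suppose that there is a subset $\mathcal X$ of $\mathcal H$ such that (i) $\mathcal X\subseteq \mathcal D^\infty(S)\cap\bigcap_{\omega\in\Omega}\mathcal D^\infty(S_\omega)$; (ii) $\mathcal F:=\mathrm{lin}\bigcup_{n=0}^\infty S^n(\mathcal X)$ is a core of $S$; (iii) $\langle S^mx,S^ny\rangle=\lim_{\omega\in\Omega}\langle S_\omega^mx,S_\omega^ny\rangle$ for all $x,y\in\mathcal X$ and all integers $m,n\ge0$. Then $S$ is subnormal.
   Context: Operators are linear and possibly unbounded; $\mathcal D(A)$ is the domain of $A$, and $\mathcal D^\infty(A)=\bigcap_{n=0}^\infty\mathcal D(A^n)$. $\mathrm{lin}$ denotes linear span. A linear subspace $\mathcal E\subseteq\mathcal D(A)$ is a core of $A$ if the graph of $A$ is contained in the closure of the graph of $A|_{\mathcal E}$. A densely defined operator $S$ in a complex Hilbert space $\mathcal H$ is subnormal if there are a complex Hilbert space $\mathcal K\supseteq\mathcal H$ (isometric embedding) and a normal (closed, densely defined, $N^*N=NN^*$) operator $N$ in $\mathcal K$ such that $Sh=Nh$ for all $h\in\mathcal D(S)$. *)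

theory Defs
  imports "HOL-Analysis.Analysis" "HOL-Library.Function_Algebras"
begin

section \<open>Complex vector spaces\<close>

class complex_vector = ab_group_add +
  fixes scaleC :: "complex \<Rightarrow> 'a \<Rightarrow> 'a"  (infixr \<open>*\<^sub>C\<close> 75)
  assumes scaleC_add_right: "a *\<^sub>C (x + y) = a *\<^sub>C x + a *\<^sub>C y"
    and scaleC_add_left: "(a + b) *\<^sub>C x = a *\<^sub>C x + b *\<^sub>C x"
    and scaleC_scaleC: "a *\<^sub>C (b *\<^sub>C x) = (a * b) *\<^sub>C x"
    and scaleC_one: "1 *\<^sub>C x = x"

global_interpretation complex_vector: vector_space "scaleC :: complex \<Rightarrow> 'a \<Rightarrow> 'a :: complex_vector"
  defines csubspace = complex_vector.subspace
    and cspan = complex_vector.span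
  by unfold_locales (simp_all add: scaleC_add_right scaleC_add_left scaleC_scaleC scaleC_one)

instantiation complex :: complex_vector
begin

definition scaleC_complex :: "complex \<Rightarrow> complex \<Rightarrow> complex" where
  "scaleC_complex a x = a * x"

instance
  by standard (simp_all add: scaleC_complex_def algebra_simps)

end

instantiation "fun" :: (type, complex_vector) complex_vector
begin

definition scaleC_fun :: "complex \<Rightarrow> ('a \<Rightarrow> 'b) \<Rightarrow> 'a \<Rightarrow> 'b" where
  "scaleC_fun a f = (\<lambda>x. a *\<^sub>C f x)"

instance
  by standard
    (simp_all add: scaleC_fun_def fun_eq_iff scaleC_add_right scaleC_add_left scaleC_scaleC scaleC_one)

end


section \<open>Complex Hilbert spaces\<close>

text \<open>
  A Hilbert space is a linear subspace of some ambient complex vector space together with an inner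
  product on it. Linear operations are those of the ambient type, while the inner product and the
  topology belong to the structure. With an explicit carrier one can quantify over Hilbert spaces
  inside a formula. The inner product is linear in its first argument.
\<close>

record 'a inner_product_structure =
  carrier :: "'a set"
  cinner :: "'a \<Rightarrow> 'a \<Rightarrow> complex"

definition hnorm :: "'a inner_product_structure \<Rightarrow> 'a \<Rightarrow> real" where
  "hnorm H x = sqrt (Re (cinner H x x))"

text \<open>The locale \<^locale>\<open>Metric_space\<close> asks for symmetry and nonnegativity off the carrier as well.\<close>

definition hdist :: "('a :: complex_vector) inner_product_structure \<Rightarrow> 'a \<Rightarrow> 'a \<Rightarrow> real" where
  "hdist H x y = (if x \<in> carrier H \<and> y \<in> carrier H then hnorm H (x - y) else 0)"

definition htopology :: "('a :: complex_vector) inner_product_structure \<Rightarrow> 'a topology" where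
  "htopology H = Metric_space.mtopology (carrier H) (hdist H)"

locale complex_inner_product_space =
  fixes H :: "('a :: complex_vector) inner_product_structure"
  assumes subspace_carrier: "csubspace (carrier H)"
    and cinner_add_left: "\<lbrakk>x \<in> carrier H; y \<in> carrier H; z \<in> carrier H\<rbrakk> \<Longrightarrow>
      cinner H (x + y) z = cinner H x z + cinner H y z"
    and cinner_scaleC_left: "\<lbrakk>x \<in> carrier H; z \<in> carrier H\<rbrakk> \<Longrightarrow>
      cinner H (a *\<^sub>C x) z = a * cinner H x z"
    and cinner_commute: "\<lbrakk>x \<in> carrier H; y \<in> carrier H\<rbrakk> \<Longrightarrow>
      cinner H y x = cnj (cinner H x y)"
    and cinner_ge_zero: "x \<in> carrier H \<Longrightarrow> 0 \<le> Re (cinner H x x)"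
    and cinner_eq_zero: "\<lbrakk>x \<in> carrier H; cinner H x x = 0\<rbrakk> \<Longrightarrow> x = 0"

context complex_inner_product_space
begin

lemma carrier_closed:
  "0 \<in> carrier H"
  "\<lbrakk>x \<in> carrier H; y \<in> carrier H\<rbrakk> \<Longrightarrow> x + y \<in> carrier H"
  "\<lbrakk>x \<in> carrier H; y \<in> carrier H\<rbrakk> \<Longrightarrow> x - y \<in> carrier H"
  "x \<in> carrier H \<Longrightarrow> a *\<^sub>C x \<in> carrier H"
  using subspace_carrier
  by (auto intro: complex_vector.subspace_0 complex_vector.subspace_add
      complex_vector.subspace_diff complex_vector.subspace_scale)

lemma cinner_add_right:
  "\<lbrakk>x \<in> carrier H; y \<in> carrier H; z \<in> carrier H\<rbrakk> \<Longrightarrow> cinner H z (x + y) = cinner H z x + cinner H z y"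
  by (metis carrier_closed(2) cinner_add_left cinner_commute complex_cnj_add)

lemma cinner_scaleC_right:
  "\<lbrakk>x \<in> carrier H; z \<in> carrier H\<rbrakk> \<Longrightarrow> cinner H z (a *\<^sub>C x) = cnj a * cinner H z x"
  by (metis carrier_closed(4) cinner_scaleC_left cinner_commute complex_cnj_mult)

lemma cinner_self: "x \<in> carrier H \<Longrightarrow> cinner H x x = complex_of_real ((hnorm H x)\<^sup>2)"
  using cinner_commute[of x x] cinner_ge_zero[of x] by (simp add: hnorm_def complex_eq_iff)

lemma hnorm_nonneg: "x \<in> carrier H \<Longrightarrow> 0 \<le> hnorm H x"
  by (simp add: hnorm_def cinner_ge_zero)

lemma hnorm_eq_zero: "x \<in> carrier H \<Longrightarrow> hnorm H x = 0 \<longleftrightarrow> x = 0"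
proof
  assume "x \<in> carrier H" "hnorm H x = 0"
  then show "x = 0" using cinner_self cinner_eq_zero by simp
next
  assume "x \<in> carrier H" "x = 0"
  then show "hnorm H x = 0"
    using cinner_scaleC_left[of x x 0] by (simp add: hnorm_def)
qed

lemma Cauchy_Schwarz:
  assumes "x \<in> carrier H" "y \<in> carrier H"
  shows "cmod (cinner H x y) \<le> hnorm H x * hnorm H y"
proof (cases "y = 0")
  case True
  then have "cinner H x y = 0"
    using cinner_scaleC_right[of y x 0] assms by simp
  then show ?thesis by (simp add: hnorm_nonneg assms)
next
  case False
  define r where "r = (hnorm H y)\<^sup>2"
  define b where "b = - (cinner H x y / complex_of_real r)"
  have r: "r > 0" using False hnorm_eq_zero assms by (simp add: r_def)
  have yx: "cinner H y x = cnj (cinner H x y)" using assms cinner_commute by blast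
  have "cinner H (x + b *\<^sub>C y) (x + b *\<^sub>C y) =
      cinner H x x + cnj b * cinner H x y + (b * cinner H y x + b * (cnj b * cinner H y y))"
    using assms by (simp add: carrier_closed cinner_add_left cinner_add_right
        cinner_scaleC_left cinner_scaleC_right distrib_left)
  also have "\<dots> = complex_of_real ((hnorm H x)\<^sup>2) - cinner H x y * cnj (cinner H x y) / complex_of_real r"
    using r unfolding yx cinner_self[OF assms(1)] cinner_self[OF assms(2)] r_def[symmetric] b_def
    by (simp add: field_simps)
  also have "\<dots> = complex_of_real ((hnorm H x)\<^sup>2 - (cmod (cinner H x y))\<^sup>2 / r)"
    by (simp add: complex_norm_square[symmetric] del: of_real_power flip: of_real_power)
  finally have "0 \<le> (hnorm H x)\<^sup>2 - (cmod (cinner H x y))\<^sup>2 / r"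
    using cinner_ge_zero[of "x + b *\<^sub>C y"] assms by (simp add: carrier_closed)
  then have "(cmod (cinner H x y))\<^sup>2 \<le> (hnorm H x * hnorm H y)\<^sup>2"
    using r by (simp add: field_simps r_def power_mult_distrib)
  then show ?thesis
    using assms by (meson hnorm_nonneg mult_nonneg_nonneg power2_le_imp_le)
qed

lemma hnorm_triangle:
  assumes "x \<in> carrier H" "y \<in> carrier H"
  shows "hnorm H (x + y) \<le> hnorm H x + hnorm H y"
proof -
  have "complex_of_real ((hnorm H (x + y))\<^sup>2) = cinner H (x + y) (x + y)"
    using assms by (simp add: carrier_closed cinner_self)
  also have "\<dots> = cinner H x x + cinner H y y + (cinner H x y + cnj (cinner H x y))"
    using assms cinner_commute[of x y]
    by (simp add: carrier_closed cinner_add_left cinner_add_right)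
  also have "\<dots> = complex_of_real ((hnorm H x)\<^sup>2 + (hnorm H y)\<^sup>2 + 2 * Re (cinner H x y))"
    using assms by (simp add: cinner_self complex_add_cnj)
  finally have "(hnorm H (x + y))\<^sup>2 = (hnorm H x)\<^sup>2 + (hnorm H y)\<^sup>2 + 2 * Re (cinner H x y)"
    by (simp only: of_real_eq_iff)
  also have "\<dots> \<le> (hnorm H x + hnorm H y)\<^sup>2"
    using Cauchy_Schwarz[OF assms] complex_Re_le_cmod[of "cinner H x y"]
    by (simp add: power2_sum)
  finally show ?thesis
    using assms by (meson add_nonneg_nonneg hnorm_nonneg power2_le_imp_le)
qed

lemma hnorm_diff_zero: "x \<in> carrier H \<Longrightarrow> y \<in> carrier H \<Longrightarrow> hnorm H (x - y) = 0 \<longleftrightarrow> x = y"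
  by (simp add: hnorm_eq_zero carrier_closed)

lemma hnorm_minus_commute:
  assumes "x \<in> carrier H" "y \<in> carrier H"
  shows "hnorm H (x - y) = hnorm H (y - x)"
proof -
  have "y - x = (- 1) *\<^sub>C (x - y)"
    by (simp add: complex_vector.scale_minus_left scaleC_one)
  then show ?thesis
    using assms by (simp add: hnorm_def carrier_closed cinner_scaleC_left cinner_scaleC_right
        del: complex_vector.scale_minus_left)
qed

end

sublocale complex_inner_product_space \<subseteq> Metric_space "carrier H" "hdist H"
proof
  fix x y z
  show "0 \<le> hdist H x y"
    by (simp add: hdist_def hnorm_nonneg carrier_closed)
  show "hdist H x y = hdist H y x"
    by (auto simp: hdist_def intro: hnorm_minus_commute)
  assume x: "x \<in> carrier H" and y: "y \<in> carrier H"
  show "hdist H x y = 0 \<longleftrightarrow> x = y"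
    using x y by (simp add: hdist_def hnorm_diff_zero)
  assume z: "z \<in> carrier H"
  show "hdist H x z \<le> hdist H x y + hdist H y z"
    using x y z hnorm_triangle[of "x - y" "y - z"] by (simp add: hdist_def carrier_closed)
qed

locale complex_hilbert_space = complex_inner_product_space +
  assumes complete: "Metric_space.mcomplete (carrier H) (hdist H)"


section \<open>Unbounded operators\<close>

text \<open>
  An operator is a partial function on the ambient type, so that equality of maps is equality of
  operators including their domains, and \<open>\<circ>\<^sub>m\<close> composes operators on the natural domain.
\<close>

type_synonym 'a operator = "'a \<rightharpoonup> 'a"

definition linear_operator :: "('a :: complex_vector) inner_product_structure \<Rightarrow> 'a operator \<Rightarrow> bool" where
  "linear_operator H A \<longleftrightarrow>
     csubspace (dom A) \<and> dom A \<subseteq> carrier H \<and> ran A \<subseteq> carrier H \<and>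
     (\<forall>x\<in>dom A. \<forall>y\<in>dom A. the (A (x + y)) = the (A x) + the (A y)) \<and>
     (\<forall>a. \<forall>x\<in>dom A. the (A (a *\<^sub>C x)) = a *\<^sub>C the (A x))"

definition densely_defined :: "('a :: complex_vector) inner_product_structure \<Rightarrow> 'a operator \<Rightarrow> bool" where
  "densely_defined H A \<longleftrightarrow> htopology H closure_of dom A = carrier H"

definition closed_operator :: "('a :: complex_vector) inner_product_structure \<Rightarrow> 'a operator \<Rightarrow> bool" where
  "closed_operator H A \<longleftrightarrow> closedin (prod_topology (htopology H) (htopology H)) (Map.graph A)"

primrec op_power :: "'a inner_product_structure \<Rightarrow> 'a operator \<Rightarrow> nat \<Rightarrow> 'a operator" where
  "op_power H A 0 = Some |` carrier H"
| "op_power H A (Suc n) = A \<circ>\<^sub>m op_power H A n"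

definition dom_infinity :: "'a inner_product_structure \<Rightarrow> 'a operator \<Rightarrow> 'a set" where
  "dom_infinity H A = (\<Inter>n. dom (op_power H A n))"

definition is_core :: "('a :: complex_vector) inner_product_structure \<Rightarrow> 'a operator \<Rightarrow> 'a set \<Rightarrow> bool" where
  "is_core H A E \<longleftrightarrow> csubspace E \<and> E \<subseteq> dom A \<and>
     Map.graph A \<subseteq> prod_topology (htopology H) (htopology H) closure_of Map.graph (A |` E)"

text \<open>For densely defined \<open>A\<close> the vector \<open>z\<close> below is unique, so \<open>THE\<close> denotes the value of the adjoint.\<close>

definition adjoint_op :: "('a :: complex_vector) inner_product_structure \<Rightarrow> 'a operator \<Rightarrow> 'a operator" where
  "adjoint_op H A = (\<lambda>y.
     if y \<in> carrier H \<and> (\<exists>z\<in>carrier H. \<forall>x\<in>dom A. cinner H (the (A x)) y = cinner H x z)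
     then Some (THE z. z \<in> carrier H \<and> (\<forall>x\<in>dom A. cinner H (the (A x)) y = cinner H x z))
     else None)"

definition normal_operator :: "('a :: complex_vector) inner_product_structure \<Rightarrow> 'a operator \<Rightarrow> bool" where
  "normal_operator K N \<longleftrightarrow>
     linear_operator K N \<and> densely_defined K N \<and> closed_operator K N \<and>
     adjoint_op K N \<circ>\<^sub>m N = N \<circ>\<^sub>m adjoint_op K N"


section \<open>Subnormal operators\<close>

definition isometric_embedding ::
  "('a :: complex_vector) inner_product_structure \<Rightarrow> ('b :: complex_vector) inner_product_structure \<Rightarrow> ('a \<Rightarrow> 'b) \<Rightarrow> bool"
where
  "isometric_embedding H K V \<longleftrightarrow>
     V ` carrier H \<subseteq> carrier K \<and>
     (\<forall>x\<in>carrier H. \<forall>y\<in>carrier H. V (x + y) = V x + V y) \<and>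
     (\<forall>a. \<forall>x\<in>carrier H. V (a *\<^sub>C x) = a *\<^sub>C V x) \<and>
     (\<forall>x\<in>carrier H. \<forall>y\<in>carrier H. cinner K (V x) (V y) = cinner H x y)"

text \<open>
  HOL has no quantification over types inside a formula, so the type in which the larger space lives
  is a parameter. This is a bound on the size of the larger space only, as every Hilbert space
  structure on every linear subspace of the type \<open>'k\<close> is admitted.

  The type \<open>'a \<times> nat \<Rightarrow> complex\<close> is always large enough for a space on \<open>'a\<close>. Let a normal \<open>N\<close> in
  \<open>K\<close> extend an operator in \<open>H\<close>, and put \<open>C = (1 + N\<^sup>*N)\<^sup>-\<^sup>1\<close> and \<open>B = N C\<close>, which are bounded. The
  smallest closed subspace containing \<open>H\<close> and invariant under \<open>C\<close>, \<open>B\<close>, \<open>B\<^sup>*\<close> reduces \<open>N\<close>, so it may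
  replace \<open>K\<close>. If \<open>w\<^sub>0, w\<^sub>1, \<dots>\<close> enumerates the words in \<open>C\<close>, \<open>B\<close>, \<open>B\<^sup>*\<close>, then mapping \<open>k\<close> to the
  function \<open>(h, i) \<mapsto> \<langle>k, w\<^sub>i h\<rangle>\<close> is linear and injective on it.
\<close>

definition subnormal_in ::
  "('k :: complex_vector) itself \<Rightarrow> ('a :: complex_vector) inner_product_structure \<Rightarrow> 'a operator \<Rightarrow> bool"
where
  "subnormal_in _ H S \<longleftrightarrow>
     linear_operator H S \<and> densely_defined H S \<and>
     (\<exists>(K :: 'k inner_product_structure) V N.
        complex_hilbert_space K \<and> isometric_embedding H K V \<and> normal_operator K N \<and>
        (\<forall>h\<in>dom S. N (V h) = Some (V (the (S h)))))"


section \<open>Nets\<close>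

definition directed_set :: "'i set \<Rightarrow> ('i \<Rightarrow> 'i \<Rightarrow> bool) \<Rightarrow> bool" where
  "directed_set \<Omega> le \<longleftrightarrow>
     \<Omega> \<noteq> {} \<and>
     (\<forall>a\<in>\<Omega>. le a a) \<and>
     (\<forall>a\<in>\<Omega>. \<forall>b\<in>\<Omega>. \<forall>c\<in>\<Omega>. le a b \<longrightarrow> le b c \<longrightarrow> le a c) \<and>
     (\<forall>a\<in>\<Omega>. \<forall>b\<in>\<Omega>. \<exists>c\<in>\<Omega>. le a c \<and> le b c)"

definition net_filter :: "'i set \<Rightarrow> ('i \<Rightarrow> 'i \<Rightarrow> bool) \<Rightarrow> 'i filter" where
  "net_filter \<Omega> le = (INF a\<in>\<Omega>. principal {b \<in> \<Omega>. le a b})"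

lemma eventually_net_filter:
  assumes "directed_set \<Omega> le"
  shows "eventually P (net_filter \<Omega> le) \<longleftrightarrow> (\<exists>a\<in>\<Omega>. \<forall>b\<in>\<Omega>. le a b \<longrightarrow> P b)"
  unfolding net_filter_def
proof (subst eventually_INF_base)
  show "\<Omega> \<noteq> {}" using assms by (simp add: directed_set_def)
next
  fix a b assume "a \<in> \<Omega>" "b \<in> \<Omega>"
  then obtain c where "c \<in> \<Omega>" "le a c" "le b c"
    using assms unfolding directed_set_def by blast
  then have "{d \<in> \<Omega>. le c d} \<subseteq> {d \<in> \<Omega>. le a d} \<inter> {d \<in> \<Omega>. le b d}"
    using assms \<open>a \<in> \<Omega>\<close> \<open>b \<in> \<Omega>\<close> unfolding directed_set_def by blast
  with \<open>c \<in> \<Omega>\<close> show "\<exists>x\<in>\<Omega>. principal {d \<in> \<Omega>. le x d} \<le>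
      inf (principal {d \<in> \<Omega>. le a d}) (principal {d \<in> \<Omega>. le b d})"
    by auto
qed (auto simp: eventually_principal)

end

theory Submission
  imports Defs
begin

text \<open>
  A normal operator \<open>N\<close> is described by three commuting contractions, \<open>C = (1 + N\<^sup>*N)\<^sup>-\<^sup>1\<close>,
  \<open>B = N C\<close> and \<open>B' = N\<^sup>*C\<close>, with \<open>C\<close> self-adjoint and injective, \<open>B'\<close> the adjoint of \<open>B\<close>, and
  \<open>B'B = BB' = C - C\<^sup>2\<close>. Conversely, every such triple on a Hilbert space comes from the
  normal operator with graph \<open>{(u, v). C v = B u}\<close>; both directions are elementary
  (\<open>normal_operator_bounded_transform\<close>, \<open>normal_operator_normal_op\<close>), the only analytic ingredient
  being the Riesz representation. The spectral theorem and moment problems are thereby avoided, and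
  the question becomes whether such triples have limits.

  For \<open>\<omega> \<in> \<Omega>\<close> let \<open>V \<omega>\<close> embed the given space into the space of a normal extension of \<open>S\<omega> \<omega>\<close>. The
  vectors obtained by applying words in \<open>C\<close>, \<open>B\<close>, \<open>B'\<close> to \<open>V \<omega> (S\<omega> \<omega>)\<^sup>n x\<close>, with \<open>x \<in> X\<close>, have
  eventually bounded norms, because the operators are contractions and
  \<open>\<parallel>(S\<omega> \<omega>)\<^sup>n x\<parallel>\<close> converges. By Tychonoff's theorem all their inner products converge along some finer
  filter. The limits form a positive definite kernel on pairs of a vector \<open>x\<close> and a code for \<open>n\<close>
  and a word, and its reproducing kernel Hilbert space consists of functions on these pairs. There the
  limit triple acts by shifting indices, and since all the relations pass to the limit, so
  does \<open>B'B = C - C\<^sup>2\<close>, from which boundedness follows.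

  Injectivity of \<open>C\<close> may be lost, because spectral mass may escape to infinity. Restricting to the
  orthogonal complement of the kernel of \<open>C\<close> restores it. The vectors \<open>b (x, n)\<close> that arise as limits of
  \<open>V \<omega> (S\<omega> \<omega>)\<^sup>n x\<close> lie in that complement, since \<open>u = C u + B'(N u)\<close> gives
  \<open>b (x, n) = C (b (x, n)) + B' (b (x, Suc n))\<close>. By the convergence of inner products the
  \<open>b (x, n)\<close> have the same Gram matrix as the vectors \<open>S\<^sup>n x\<close>, whose span is dense, so \<open>S\<^sup>n x \<mapsto> b (x, n)\<close>
  extends to an isometry. The limit operator maps \<open>b (x, n)\<close> to \<open>b (x, Suc n)\<close>; as it is closed and the span
  of the \<open>S\<^sup>n x\<close> is a core, it extends \<open>S\<close>.
\<close>


section \<open>Inner product spaces: norms, limits and completeness\<close>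

text \<open>
  Along \<open>a = - t z\<^sup>*\<close> with small \<open>t > 0\<close> the linear term \<open>- 2 t \<bar>z\<bar>\<^sup>2\<close> beats the quadratic one. This is the
  first-variation argument for orthogonality and for definiteness of a positive form.
\<close>

lemma complex_zero_if_quadratic_bound:
  fixes z :: complex and r :: real
  assumes bound: "\<And>a. 0 \<le> (cmod a)\<^sup>2 * r + 2 * Re (a * z)"
  shows "z = 0"
proof (rule ccontr)
  assume "z \<noteq> 0"
  define t where "t = 1 / (\<bar>r\<bar> + 1)"
  define a where "a = - complex_of_real t * cnj z"
  have t: "0 < t" "t * r < 1"
    by (auto simp: t_def field_simps)
  have "Re (a * z) = - t * (cmod z)\<^sup>2"
    by (simp add: a_def cmod_def power2_eq_square algebra_simps)
  moreover have "(cmod a)\<^sup>2 = t\<^sup>2 * (cmod z)\<^sup>2"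
    by (simp add: a_def norm_mult power_mult_distrib)
  ultimately have "0 \<le> (cmod z)\<^sup>2 * (t * (t * r - 2))"
    using bound[of a] by (simp add: power2_eq_square algebra_simps)
  moreover have "(cmod z)\<^sup>2 * (t * (t * r - 2)) < 0"
    using t \<open>z \<noteq> 0\<close> by (intro mult_pos_neg) auto
  ultimately show False
    by simp
qed

text \<open>
  The distance \<^const>\<open>hdist\<close> vanishes off the carrier. The notions below refer to \<^const>\<open>hnorm\<close> alone
  and record membership in the carrier explicitly, which makes them stable under passing to a subspace.
\<close>

definition hlim :: "('a :: complex_vector) inner_product_structure \<Rightarrow> (nat \<Rightarrow> 'a) \<Rightarrow> 'a \<Rightarrow> bool" where
  "hlim H \<sigma> l \<longleftrightarrow> range \<sigma> \<subseteq> carrier H \<and> l \<in> carrier H \<and> (\<lambda>n. hnorm H (\<sigma> n - l)) \<longlonglongrightarrow> 0"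

definition hcauchy :: "('a :: complex_vector) inner_product_structure \<Rightarrow> (nat \<Rightarrow> 'a) \<Rightarrow> bool" where
  "hcauchy H \<sigma> \<longleftrightarrow> range \<sigma> \<subseteq> carrier H \<and>
     (\<forall>\<epsilon>>0. \<exists>N. \<forall>m\<ge>N. \<forall>n\<ge>N. hnorm H (\<sigma> m - \<sigma> n) < \<epsilon>)"

definition hdense :: "('a :: complex_vector) inner_product_structure \<Rightarrow> 'a set \<Rightarrow> bool" where
  "hdense H E \<longleftrightarrow> E \<subseteq> carrier H \<and> (\<forall>x\<in>carrier H. \<forall>\<epsilon>>0. \<exists>y\<in>E. hnorm H (x - y) < \<epsilon>)"

context complex_inner_product_space
begin

lemma cinner_zero_left: "y \<in> carrier H \<Longrightarrow> cinner H 0 y = 0"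
  using cinner_add_left[of 0 0 y] carrier_closed by simp

lemma cinner_zero_right: "y \<in> carrier H \<Longrightarrow> cinner H y 0 = 0"
  using cinner_add_right[of 0 0 y] carrier_closed by simp

lemma cinner_diff_left:
  "\<lbrakk>x \<in> carrier H; y \<in> carrier H; z \<in> carrier H\<rbrakk> \<Longrightarrow> cinner H (x - y) z = cinner H x z - cinner H y z"
  using cinner_add_left[of "x - y" y z] carrier_closed by simp

lemma cinner_diff_right:
  "\<lbrakk>x \<in> carrier H; y \<in> carrier H; z \<in> carrier H\<rbrakk> \<Longrightarrow> cinner H z (x - y) = cinner H z x - cinner H z y"
  using cinner_add_right[of "x - y" y z] carrier_closed by simp

lemma cinner_uminus_left: "\<lbrakk>x \<in> carrier H; z \<in> carrier H\<rbrakk> \<Longrightarrow> cinner H (- x) z = - cinner H x z"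
  using cinner_diff_left[of 0 x z] carrier_closed cinner_zero_left by simp

lemma sum_carrier: "(\<And>i. i \<in> A \<Longrightarrow> f i \<in> carrier H) \<Longrightarrow> sum f A \<in> carrier H"
  by (induction A rule: infinite_finite_induct) (auto simp: carrier_closed)

lemma cinner_sum_left:
  "(\<And>i. i \<in> A \<Longrightarrow> f i \<in> carrier H) \<Longrightarrow> z \<in> carrier H \<Longrightarrow>
    cinner H (sum f A) z = (\<Sum>i\<in>A. cinner H (f i) z)"
  by (induction A rule: infinite_finite_induct)
    (auto simp: cinner_zero_left cinner_add_left sum_carrier)

lemma cinner_sum_right:
  "(\<And>i. i \<in> A \<Longrightarrow> f i \<in> carrier H) \<Longrightarrow> z \<in> carrier H \<Longrightarrow>
    cinner H z (sum f A) = (\<Sum>i\<in>A. cinner H z (f i))"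
  by (induction A rule: infinite_finite_induct)
    (auto simp: cinner_zero_right cinner_add_right sum_carrier)

lemma eq_if_cinner_eq:
  assumes "x \<in> carrier H" "y \<in> carrier H" "\<And>z. z \<in> carrier H \<Longrightarrow> cinner H x z = cinner H y z"
  shows "x = y"
  using assms cinner_eq_zero[of "x - y"] by (simp add: cinner_diff_left carrier_closed)

lemma hnorm_zero: "hnorm H 0 = 0"
  using hnorm_eq_zero[of 0] carrier_closed by simp

lemma hnorm_power2: "x \<in> carrier H \<Longrightarrow> (hnorm H x)\<^sup>2 = Re (cinner H x x)"
  by (simp add: cinner_self)

lemma hnorm_scaleC: "x \<in> carrier H \<Longrightarrow> hnorm H (a *\<^sub>C x) = cmod a * hnorm H x"
proof -
  assume x: "x \<in> carrier H"
  have "cinner H (a *\<^sub>C x) (a *\<^sub>C x) = (a * cnj a) * cinner H x x"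
    using x by (simp add: cinner_scaleC_left cinner_scaleC_right carrier_closed)
  then have "Re (cinner H (a *\<^sub>C x) (a *\<^sub>C x)) = (cmod a * hnorm H x)\<^sup>2"
    using x unfolding complex_norm_square[symmetric] cinner_self[OF x] power_mult_distrib
    by (metis Re_complex_of_real of_real_mult of_real_power)
  then have "hnorm H (a *\<^sub>C x) = sqrt ((cmod a * hnorm H x)\<^sup>2)"
    by (simp add: hnorm_def)
  then show ?thesis
    using hnorm_nonneg[OF x] by simp
qed

lemma hnorm_triangle_diff:
  "\<lbrakk>x \<in> carrier H; y \<in> carrier H; z \<in> carrier H\<rbrakk> \<Longrightarrow> hnorm H (x - z) \<le> hnorm H (x - y) + hnorm H (y - z)"
  using hnorm_triangle[of "x - y" "y - z"] by (simp add: carrier_closed)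

lemma hnorm_triangle_rev:
  assumes "x \<in> carrier H" "y \<in> carrier H"
  shows "\<bar>hnorm H x - hnorm H y\<bar> \<le> hnorm H (x - y)"
  using hnorm_triangle[of "x - y" y] hnorm_triangle[of "y - x" x] hnorm_minus_commute[of x y] assms
  by (simp add: carrier_closed)

lemma hnorm_add_square:
  assumes "x \<in> carrier H" "y \<in> carrier H"
  shows "(hnorm H (x + y))\<^sup>2 = (hnorm H x)\<^sup>2 + 2 * Re (cinner H x y) + (hnorm H y)\<^sup>2"
  using assms cinner_commute[of x y]
  by (simp add: hnorm_power2 cinner_add_left cinner_add_right carrier_closed)

lemma parallelogram:
  assumes "x \<in> carrier H" "y \<in> carrier H"
  shows "(hnorm H (x + y))\<^sup>2 + (hnorm H (x - y))\<^sup>2 = 2 * (hnorm H x)\<^sup>2 + 2 * (hnorm H y)\<^sup>2"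
  using assms
  by (simp add: hnorm_power2 cinner_add_left cinner_add_right cinner_diff_left cinner_diff_right
      carrier_closed)

lemma hlimD: "hlim H \<sigma> l \<Longrightarrow> \<sigma> n \<in> carrier H" "hlim H \<sigma> l \<Longrightarrow> l \<in> carrier H"
  by (auto simp: hlim_def)

lemma hlim_const: "x \<in> carrier H \<Longrightarrow> hlim H (\<lambda>n. x) x"
  by (auto simp: hlim_def hnorm_zero)

lemma hlim_if_bounded:
  assumes "range \<sigma> \<subseteq> carrier H" "l \<in> carrier H" "\<And>n. hnorm H (\<sigma> n - l) \<le> f n" "f \<longlonglongrightarrow> 0"
  shows "hlim H \<sigma> l"
  unfolding hlim_def using assms
  by (auto intro!: tendsto_sandwich[OF _ _ tendsto_const \<open>f \<longlonglongrightarrow> 0\<close>] simp: hnorm_nonneg carrier_closed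
      image_subset_iff)

lemma hlim_add:
  assumes "hlim H \<sigma> l" "hlim H \<tau> k"
  shows "hlim H (\<lambda>n. \<sigma> n + \<tau> n) (l + k)"
proof (rule hlim_if_bounded)
  show "hnorm H (\<sigma> n + \<tau> n - (l + k)) \<le> hnorm H (\<sigma> n - l) + hnorm H (\<tau> n - k)" for n
    using hnorm_triangle[of "\<sigma> n - l" "\<tau> n - k"] assms
    by (simp add: hlimD carrier_closed algebra_simps)
  show "(\<lambda>n. hnorm H (\<sigma> n - l) + hnorm H (\<tau> n - k)) \<longlonglongrightarrow> 0"
    using tendsto_add[of _ 0 _ _ 0] assms unfolding hlim_def by fastforce
qed (use assms in \<open>auto simp: hlim_def carrier_closed image_subset_iff\<close>)

lemma hlim_scaleC:
  assumes "hlim H \<sigma> l"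
  shows "hlim H (\<lambda>n. a *\<^sub>C \<sigma> n) (a *\<^sub>C l)"
proof (rule hlim_if_bounded)
  show "hnorm H (a *\<^sub>C \<sigma> n - a *\<^sub>C l) \<le> cmod a * hnorm H (\<sigma> n - l)" for n
    using assms hnorm_scaleC[of "\<sigma> n - l" a]
    by (simp add: hlimD carrier_closed complex_vector.scale_right_diff_distrib)
  show "(\<lambda>n. cmod a * hnorm H (\<sigma> n - l)) \<longlonglongrightarrow> 0"
    using tendsto_mult_left[of _ 0] assms unfolding hlim_def by fastforce
qed (use assms in \<open>auto simp: hlim_def carrier_closed image_subset_iff\<close>)

lemma hlim_diff:
  assumes "hlim H \<sigma> l" "hlim H \<tau> k"
  shows "hlim H (\<lambda>n. \<sigma> n - \<tau> n) (l - k)"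
  using hlim_add[OF assms(1) hlim_scaleC[OF assms(2), of "-1"]]
  by (simp add: scaleC_one)

lemma hlim_hnorm:
  assumes "hlim H \<sigma> l"
  shows "(\<lambda>n. hnorm H (\<sigma> n)) \<longlonglongrightarrow> hnorm H l"
proof -
  have "(\<lambda>n. hnorm H (\<sigma> n) - hnorm H l) \<longlonglongrightarrow> 0"
  proof (rule tendsto_rabs_zero_cancel, rule tendsto_sandwich[OF _ _ tendsto_const])
    show "(\<lambda>n. hnorm H (\<sigma> n - l)) \<longlonglongrightarrow> 0"
      using assms by (simp add: hlim_def)
    show "\<forall>\<^sub>F n in sequentially. \<bar>hnorm H (\<sigma> n) - hnorm H l\<bar> \<le> hnorm H (\<sigma> n - l)"
      using assms hnorm_triangle_rev by (auto simp: hlimD)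
  qed auto
  then show ?thesis
    by (simp add: LIM_zero_iff)
qed

lemma hlim_cinner:
  assumes "hlim H \<sigma> l" "hlim H \<tau> k"
  shows "(\<lambda>n. cinner H (\<sigma> n) (\<tau> n)) \<longlonglongrightarrow> cinner H l k"
proof -
  let ?b = "\<lambda>n. hnorm H (\<sigma> n - l) * hnorm H (\<tau> n) + hnorm H l * hnorm H (\<tau> n - k)"
  have "(\<lambda>n. cinner H (\<sigma> n) (\<tau> n) - cinner H l k) \<longlonglongrightarrow> 0"
  proof (rule Lim_null_comparison)
    have "cinner H (\<sigma> n) (\<tau> n) - cinner H l k = cinner H (\<sigma> n - l) (\<tau> n) + cinner H l (\<tau> n - k)" for n
      using assms by (simp add: hlimD cinner_diff_left cinner_diff_right)
    then have "cmod (cinner H (\<sigma> n) (\<tau> n) - cinner H l k) \<le> ?b n" for n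
      using Cauchy_Schwarz[of "\<sigma> n - l" "\<tau> n"] Cauchy_Schwarz[of l "\<tau> n - k"] assms
        norm_triangle_ineq[of "cinner H (\<sigma> n - l) (\<tau> n)" "cinner H l (\<tau> n - k)"]
      by (simp add: hlimD carrier_closed)
    then show "\<forall>\<^sub>F n in sequentially. cmod (cinner H (\<sigma> n) (\<tau> n) - cinner H l k) \<le> ?b n"
      by simp
    have "?b \<longlonglongrightarrow> 0 * hnorm H k + hnorm H l * 0"
      using assms unfolding hlim_def
      by (intro tendsto_intros hlim_hnorm[OF assms(2)]) auto
    then show "?b \<longlonglongrightarrow> 0"
      by simp
  qed
  then show ?thesis
    by (simp add: LIM_zero_iff)
qed

lemma hlim_imp_hcauchy:
  assumes "hlim H \<sigma> l"
  shows "hcauchy H \<sigma>"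
  unfolding hcauchy_def
proof (intro conjI allI impI)
  fix \<epsilon> :: real assume "0 < \<epsilon>"
  then obtain N where N: "\<And>n. n \<ge> N \<Longrightarrow> hnorm H (\<sigma> n - l) < \<epsilon> / 2"
    using assms hnorm_nonneg unfolding hlim_def LIMSEQ_iff
    by (metis abs_le_D1 diff_zero half_gt_zero le_less_trans order_refl real_norm_def)
  have "hnorm H (\<sigma> m - \<sigma> n) < \<epsilon>" if "m \<ge> N" "n \<ge> N" for m n
    using hnorm_triangle_diff[of "\<sigma> m" l "\<sigma> n"] hnorm_minus_commute[of "\<sigma> n" l] N that assms
    by (smt (verit) field_sum_of_halves hlimD)
  then show "\<exists>N. \<forall>m\<ge>N. \<forall>n\<ge>N. hnorm H (\<sigma> m - \<sigma> n) < \<epsilon>"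
    by blast
qed (use assms in \<open>auto simp: hlim_def\<close>)

lemma hdense_imp_hlim:
  assumes "hdense H E" "x \<in> carrier H"
  obtains \<sigma> where "range \<sigma> \<subseteq> E" "hlim H \<sigma> x"
proof -
  have "\<exists>y\<in>E. hnorm H (x - y) < inverse (real (Suc n))" for n
    using assms by (auto simp: hdense_def)
  then obtain \<sigma> where \<sigma>: "\<And>n. \<sigma> n \<in> E" "\<And>n. hnorm H (x - \<sigma> n) < inverse (real (Suc n))"
    by metis
  moreover have "\<sigma> n \<in> carrier H" for n
    using \<sigma> assms by (auto simp: hdense_def)
  ultimately have "hlim H \<sigma> x"
    using assms hnorm_minus_commute
    by (intro hlim_if_bounded[OF _ _ _ LIMSEQ_inverse_real_of_nat]) (auto simp: less_imp_le)
  with \<sigma> show ?thesis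
    using that by blast
qed

lemma MCauchy_iff_hcauchy: "MCauchy \<sigma> \<longleftrightarrow> hcauchy H \<sigma>"
proof -
  have "hdist H (\<sigma> m) (\<sigma> n) = hnorm H (\<sigma> m - \<sigma> n)" if "range \<sigma> \<subseteq> carrier H" for m n
    using that by (auto simp: hdist_def)
  then show ?thesis
    unfolding MCauchy_def hcauchy_def by (auto simp: Ball_def)
qed

lemma limitin_iff_hlim:
  assumes "range \<sigma> \<subseteq> carrier H"
  shows "limitin mtopology \<sigma> l sequentially \<longleftrightarrow> hlim H \<sigma> l"
proof -
  have "\<sigma> n \<in> carrier H" for n
    using assms by auto
  then show ?thesis
    unfolding limit_metric_sequentially hlim_def LIMSEQ_iff
    by (auto simp: hdist_def hnorm_nonneg carrier_closed assms image_subset_iff)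
qed

lemma complex_hilbert_spaceI:
  assumes "\<And>\<sigma>. hcauchy H \<sigma> \<Longrightarrow> \<exists>l. hlim H \<sigma> l"
  shows "complex_hilbert_space H"
proof
  show "mcomplete"
    unfolding mcomplete_def using assms
    by (metis MCauchy_def MCauchy_iff_hcauchy limitin_iff_hlim)
qed

lemma densely_defined_iff: "densely_defined H A \<longleftrightarrow> carrier H \<subseteq> htopology H closure_of dom A"
  unfolding densely_defined_def htopology_def
  by (metis closure_of_subset_topspace subset_antisym subset_refl topspace_mtopology)

lemma closure_of_iff:
  "x \<in> htopology H closure_of E \<longleftrightarrow>
     x \<in> carrier H \<and> (\<forall>\<epsilon>>0. \<exists>y\<in>E. y \<in> carrier H \<and> hnorm H (x - y) < \<epsilon>)"
  unfolding htopology_def metric_closure_of by (auto simp: in_mball hdist_def; metis)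

lemma densely_defined_iff_hdense:
  "dom A \<subseteq> carrier H \<Longrightarrow> densely_defined H A \<longleftrightarrow> hdense H (dom A)"
  unfolding densely_defined_iff hdense_def subset_iff closure_of_iff by blast

lemma openin_htopology_ball:
  assumes "x \<in> carrier H"
  shows "openin (htopology H) {y \<in> carrier H. hnorm H (x - y) < \<epsilon>}"
proof -
  have "{y \<in> carrier H. hnorm H (x - y) < \<epsilon>} = mball x \<epsilon>"
    using assms by (auto simp: hdist_def)
  then show ?thesis
    by (simp add: htopology_def)
qed

lemma prod_closure_of_iff:
  "(x, y) \<in> prod_topology (htopology H) (htopology H) closure_of G \<longleftrightarrow>
     x \<in> carrier H \<and> y \<in> carrier H \<and>
     (\<forall>\<epsilon>>0. \<exists>(a, b)\<in>G. a \<in> carrier H \<and> b \<in> carrier H \<and> hnorm H (x - a) < \<epsilon> \<and> hnorm H (y - b) < \<epsilon>)"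
  (is "?l \<longleftrightarrow> ?r")
proof
  assume l: ?l
  then have xy: "x \<in> carrier H" "y \<in> carrier H"
    by (auto simp: in_closure_of htopology_def)
  have "\<exists>(a, b)\<in>G. a \<in> carrier H \<and> b \<in> carrier H \<and> hnorm H (x - a) < \<epsilon> \<and> hnorm H (y - b) < \<epsilon>"
    if "0 < \<epsilon>" for \<epsilon>
  proof -
    let ?T = "{a \<in> carrier H. hnorm H (x - a) < \<epsilon>} \<times> {b \<in> carrier H. hnorm H (y - b) < \<epsilon>}"
    have "openin (prod_topology (htopology H) (htopology H)) ?T"
      using xy by (simp add: openin_prod_Times_iff openin_htopology_ball)
    moreover have "(x, y) \<in> ?T"
      using xy that by (simp add: hnorm_zero)
    ultimately obtain z where "z \<in> G" "z \<in> ?T"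
      using l unfolding in_closure_of by meson
    then show ?thesis
      by (intro bexI[of _ z]) auto
  qed
  then show ?r
    using xy by blast
next
  assume r: ?r
  show ?l
    unfolding in_closure_of
  proof (intro conjI allI impI)
    show "(x, y) \<in> topspace (prod_topology (htopology H) (htopology H))"
      using r by (simp add: htopology_def)
    fix T assume T: "(x, y) \<in> T \<and> openin (prod_topology (htopology H) (htopology H)) T"
    then obtain U W where UW: "openin (htopology H) U" "openin (htopology H) W" "x \<in> U" "y \<in> W" "U \<times> W \<subseteq> T"
      unfolding openin_prod_topology_alt by meson
    obtain r1 where r1: "r1 > 0" "mball x r1 \<subseteq> U"
      using UW unfolding htopology_def openin_mtopology by blast
    obtain r2 where r2: "r2 > 0" "mball y r2 \<subseteq> W"
      using UW unfolding htopology_def openin_mtopology by blast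
    obtain a b where ab: "(a, b) \<in> G" "a \<in> carrier H" "b \<in> carrier H"
      "hnorm H (x - a) < min r1 r2" "hnorm H (y - b) < min r1 r2"
      using r r1(1) r2(1) by (metis (no_types, lifting) case_prodE min_less_iff_conj)
    then have "a \<in> mball x r1" "b \<in> mball y r2"
      using r by (auto simp: hdist_def)
    then show "\<exists>z. z \<in> G \<and> z \<in> T"
      using r1 r2 UW ab by blast
  qed
qed

lemma closed_operator_iff:
  assumes "Map.graph A \<subseteq> carrier H \<times> carrier H"
  shows "closed_operator H A \<longleftrightarrow>
    (\<forall>x\<in>carrier H. \<forall>y\<in>carrier H.
      (\<forall>\<epsilon>>0. \<exists>(a, b)\<in>Map.graph A. hnorm H (x - a) < \<epsilon> \<and> hnorm H (y - b) < \<epsilon>) \<longrightarrow> A x = Some y)"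
proof -
  let ?T = "prod_topology (htopology H) (htopology H)"
  have top: "Map.graph A \<subseteq> topspace ?T"
    using assms by (simp add: htopology_def)
  have "closed_operator H A \<longleftrightarrow> ?T closure_of Map.graph A \<subseteq> Map.graph A"
    unfolding closed_operator_def using closure_of_subset_eq[of "Map.graph A" ?T] top by auto
  also have "\<dots> \<longleftrightarrow> (\<forall>x y. (x, y) \<in> ?T closure_of Map.graph A \<longrightarrow> A x = Some y)"
    by (auto simp: Map.graph_def)
  also have "\<dots> \<longleftrightarrow> (\<forall>x\<in>carrier H. \<forall>y\<in>carrier H.
      (\<forall>\<epsilon>>0. \<exists>(a, b)\<in>Map.graph A. hnorm H (x - a) < \<epsilon> \<and> hnorm H (y - b) < \<epsilon>) \<longrightarrow> A x = Some y)"
  proof -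
    have "(\<exists>(a, b)\<in>Map.graph A. a \<in> carrier H \<and> b \<in> carrier H \<and> hnorm H (x - a) < \<epsilon> \<and> hnorm H (y - b) < \<epsilon>)
      \<longleftrightarrow> (\<exists>(a, b)\<in>Map.graph A. hnorm H (x - a) < \<epsilon> \<and> hnorm H (y - b) < \<epsilon>)" for x y \<epsilon>
      using assms by (intro bex_cong) auto
    then show ?thesis
      unfolding prod_closure_of_iff Ball_def by auto
  qed
  finally show ?thesis .
qed

end

lemma (in complex_hilbert_space) hcauchy_imp_hlim:
  assumes "hcauchy H \<sigma>"
  obtains l where "hlim H \<sigma> l"
  using assms complete unfolding mcomplete_def
  by (metis MCauchy_def MCauchy_iff_hcauchy limitin_iff_hlim)

lemma complex_inner_product_space_subspace:
  assumes "complex_inner_product_space H" "csubspace M" "M \<subseteq> carrier H"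
  shows "complex_inner_product_space (H\<lparr>carrier := M\<rparr>)"
proof -
  interpret complex_inner_product_space H by fact
  show ?thesis
    using assms(2,3)
    by unfold_locales
      (auto simp: cinner_add_left cinner_scaleC_left cinner_eq_zero cinner_ge_zero subset_iff
        intro: cinner_commute)
qed

lemma subspace_structure: "carrier (H\<lparr>carrier := M\<rparr>) = M" "cinner (H\<lparr>carrier := M\<rparr>) = cinner H"
  by simp_all

lemma hnorm_subspace [simp]: "hnorm (H\<lparr>carrier := M\<rparr>) = hnorm H"
  by (simp add: fun_eq_iff hnorm_def)

lemma complex_hilbert_space_subspace:
  assumes "complex_hilbert_space H" "csubspace M" "M \<subseteq> carrier H"
    and closed: "\<And>\<sigma> l. range \<sigma> \<subseteq> M \<Longrightarrow> hlim H \<sigma> l \<Longrightarrow> l \<in> M"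
  shows "complex_hilbert_space (H\<lparr>carrier := M\<rparr>)"
proof -
  interpret complex_hilbert_space H by fact
  interpret M: complex_inner_product_space "H\<lparr>carrier := M\<rparr>"
    using assms complex_inner_product_space_axioms by (intro complex_inner_product_space_subspace)
  show ?thesis
  proof (rule M.complex_hilbert_spaceI)
    fix \<sigma> assume "hcauchy (H\<lparr>carrier := M\<rparr>) \<sigma>"
    then have \<sigma>: "hcauchy H \<sigma>" "range \<sigma> \<subseteq> M"
      using assms by (auto simp: hcauchy_def)
    obtain l where "hlim H \<sigma> l"
      using hcauchy_imp_hlim[OF \<sigma>(1)] .
    with \<sigma> have "hlim (H\<lparr>carrier := M\<rparr>) \<sigma> l"
      using closed by (auto simp: hlim_def)
    then show "\<exists>l. hlim (H\<lparr>carrier := M\<rparr>) \<sigma> l" ..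
  qed
qed


section \<open>Riesz representation and orthogonality\<close>

context complex_hilbert_space
begin

text \<open>
  The functional \<open>J x = \<parallel>x\<parallel>\<^sup>2 - 2 Re (\<phi> x)\<close> is bounded below, and by the parallelogram law every
  minimising sequence is Cauchy. At the minimum the first variation \<open>\<langle>x, y\<rangle> - \<phi> x\<close> vanishes.
\<close>

lemma riesz_representation:
  assumes add: "\<And>x y. x \<in> carrier H \<Longrightarrow> y \<in> carrier H \<Longrightarrow> \<phi> (x + y) = \<phi> x + \<phi> y"
    and scale: "\<And>a x. x \<in> carrier H \<Longrightarrow> \<phi> (a *\<^sub>C x) = a * \<phi> x"
    and bound: "\<And>x. x \<in> carrier H \<Longrightarrow> cmod (\<phi> x) \<le> M * hnorm H x"
  obtains y where "y \<in> carrier H" "\<And>x. x \<in> carrier H \<Longrightarrow> cinner H x y = \<phi> x"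
proof -
  define J where "J x = (hnorm H x)\<^sup>2 - 2 * Re (\<phi> x)" for x
  define m where "m = Inf (J ` carrier H)"
  have J_ge: "J x \<ge> - M\<^sup>2" if "x \<in> carrier H" for x
  proof -
    have "0 \<le> (hnorm H x - M)\<^sup>2"
      by simp
    then show ?thesis
      using bound[OF that] complex_Re_le_cmod[of "\<phi> x"]
      by (simp add: J_def power2_diff algebra_simps)
  qed
  have bdd: "bdd_below (J ` carrier H)"
    using J_ge by (rule bdd_belowI2)
  have m_le: "m \<le> J x" if "x \<in> carrier H" for x
    unfolding m_def using bdd that by (auto intro: cInf_lower)
  have "\<exists>x\<in>carrier H. J x < m + inverse (real (Suc n))" for n
    using cInf_lessD[of "J ` carrier H" "m + inverse (real (Suc n))"] carrier_closed(1)
    unfolding m_def by fastforce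
  then obtain \<sigma> where \<sigma>: "\<And>n. \<sigma> n \<in> carrier H" "\<And>n. J (\<sigma> n) < m + inverse (real (Suc n))"
    by metis
  have J_mid: "(hnorm H (x - y))\<^sup>2 \<le> 2 * (J x - m) + 2 * (J y - m)"
    if xy: "x \<in> carrier H" "y \<in> carrier H" for x y
  proof -
    define z where "z = (1/2) *\<^sub>C (x + y)"
    have z: "z \<in> carrier H"
      by (simp add: z_def carrier_closed xy)
    have "hnorm H (x + y) = 2 * hnorm H z" "2 * Re (\<phi> z) = Re (\<phi> x) + Re (\<phi> y)"
      using xy by (simp_all add: z_def hnorm_scaleC scale add carrier_closed)
    then have "(hnorm H (x + y))\<^sup>2 = 4 * J z + 4 * Re (\<phi> x) + 4 * Re (\<phi> y)"
      by (simp add: J_def power2_eq_square)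
    then show ?thesis
      using parallelogram[OF xy] m_le[OF z] by (simp add: J_def)
  qed
  have "hcauchy H \<sigma>"
    unfolding hcauchy_def
  proof (intro conjI allI impI)
    fix \<epsilon> :: real assume \<epsilon>: "0 < \<epsilon>"
    obtain N where N: "inverse (real (Suc N)) < \<epsilon>\<^sup>2 / 4"
      using \<epsilon> reals_Archimedean[of "\<epsilon>\<^sup>2 / 4"] by auto
    have "hnorm H (\<sigma> i - \<sigma> j) < \<epsilon>" if "i \<ge> N" "j \<ge> N" for i j
    proof -
      have J_less: "J (\<sigma> k) - m < \<epsilon>\<^sup>2 / 4" if "k \<ge> N" for k
      proof -
        have "inverse (real (Suc k)) \<le> inverse (real (Suc N))"
          using that by (simp add: le_imp_inverse_le)
        then have "inverse (real (Suc k)) < \<epsilon>\<^sup>2 / 4"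
          using N by (rule le_less_trans)
        then show ?thesis
          using \<sigma>(2)[of k] by simp
      qed
      have "(hnorm H (\<sigma> i - \<sigma> j))\<^sup>2 < \<epsilon>\<^sup>2"
        using J_mid[OF \<sigma>(1)[of i] \<sigma>(1)[of j]] J_less[OF \<open>i \<ge> N\<close>] J_less[OF \<open>j \<ge> N\<close>] by simp
      then show ?thesis
        using \<epsilon> by (simp add: power_less_imp_less_base)
    qed
    then show "\<exists>N. \<forall>m\<ge>N. \<forall>n\<ge>N. hnorm H (\<sigma> m - \<sigma> n) < \<epsilon>"
      by blast
  qed (use \<sigma> in auto)
  then obtain y where y: "hlim H \<sigma> y"
    by (rule hcauchy_imp_hlim)
  have yc: "y \<in> carrier H"
    using y by (rule hlimD)
  have diff: "\<phi> (u - v) = \<phi> u - \<phi> v" if "u \<in> carrier H" "v \<in> carrier H" for u v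
    using add[of "u - v" v] that by (simp add: carrier_closed)
  have "(\<lambda>n. \<phi> (\<sigma> n) - \<phi> y) \<longlonglongrightarrow> 0"
  proof (rule Lim_null_comparison)
    show "\<forall>\<^sub>F n in sequentially. cmod (\<phi> (\<sigma> n) - \<phi> y) \<le> M * hnorm H (\<sigma> n - y)"
      using bound \<sigma>(1) yc by (simp flip: diff add: carrier_closed)
    show "(\<lambda>n. M * hnorm H (\<sigma> n - y)) \<longlonglongrightarrow> 0"
      using y tendsto_mult_left[of _ 0] unfolding hlim_def by fastforce
  qed
  then have "(\<lambda>n. \<phi> (\<sigma> n)) \<longlonglongrightarrow> \<phi> y"
    by (simp add: LIM_zero_iff)
  then have "(\<lambda>n. J (\<sigma> n)) \<longlonglongrightarrow> J y"
    unfolding J_def by (intro tendsto_intros hlim_hnorm[OF y])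
  moreover have "(\<lambda>n. m + inverse (real (Suc n))) \<longlonglongrightarrow> m + 0"
    by (intro tendsto_intros LIMSEQ_inverse_real_of_nat)
  ultimately have "J y \<le> m"
    using \<sigma>(2) by (intro LIMSEQ_le) (auto intro: less_imp_le)
  then have min: "J y \<le> J x" if "x \<in> carrier H" for x
    using m_le[OF that] by simp
  have "cinner H x y - \<phi> x = 0" if x: "x \<in> carrier H" for x
  proof (rule complex_zero_if_quadratic_bound[of "(hnorm H x)\<^sup>2"])
    fix a
    have "J (a *\<^sub>C x + y) = J y + (cmod a)\<^sup>2 * (hnorm H x)\<^sup>2 + 2 * Re (a * cinner H x y) - 2 * Re (a * \<phi> x)"
      using x yc cinner_scaleC_left[of x y a] unfolding J_def
      by (simp only: hnorm_add_square carrier_closed add scale hnorm_scaleC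
          power_mult_distrib) (simp add: algebra_simps)
    then show "0 \<le> (cmod a)\<^sup>2 * (hnorm H x)\<^sup>2 + 2 * Re (a * (cinner H x y - \<phi> x))"
      using min[of "a *\<^sub>C x + y"] x yc by (simp add: carrier_closed algebra_simps)
  qed
  with yc show ?thesis
    using that by simp
qed

text \<open>
  A vector is compared with its orthogonal projection to the closure of \<open>E\<close>, which the Riesz
  representation in that closure provides.
\<close>

lemma hdense_if_orthogonal_zero:
  assumes E: "csubspace E" "E \<subseteq> carrier H"
    and orth: "\<And>y. y \<in> carrier H \<Longrightarrow> (\<And>x. x \<in> E \<Longrightarrow> cinner H x y = 0) \<Longrightarrow> y = 0"
  shows "hdense H E"
proof -
  define M where "M = {l. \<exists>\<sigma>. range \<sigma> \<subseteq> E \<and> hlim H \<sigma> l}"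
  have M_sub: "M \<subseteq> carrier H"
    by (auto simp: M_def hlim_def)
  have E_sub: "E \<subseteq> M"
  proof
    fix x assume "x \<in> E"
    then show "x \<in> M"
      using E hlim_const[of x] by (auto simp: M_def intro!: exI[of _ "\<lambda>_. x"])
  qed
  have "csubspace M"
  proof (rule complex_vector.subspaceI)
    show "0 \<in> M"
      using E_sub E complex_vector.subspace_0 by blast
  next
    fix x y assume "x \<in> M" "y \<in> M"
    then obtain \<sigma> \<tau> where "range \<sigma> \<subseteq> E" "hlim H \<sigma> x" "range \<tau> \<subseteq> E" "hlim H \<tau> y"
      by (auto simp: M_def)
    then show "x + y \<in> M"
      using hlim_add[of \<sigma> x \<tau> y] E(1) unfolding M_def
      by (auto intro!: exI[of _ "\<lambda>n. \<sigma> n + \<tau> n"] complex_vector.subspace_add simp: image_subset_iff)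
  next
    fix a x assume "x \<in> M"
    then obtain \<sigma> where "range \<sigma> \<subseteq> E" "hlim H \<sigma> x"
      by (auto simp: M_def)
    then show "a *\<^sub>C x \<in> M"
      using hlim_scaleC[of \<sigma> x a] E(1) unfolding M_def
      by (auto intro!: exI[of _ "\<lambda>n. a *\<^sub>C \<sigma> n"] complex_vector.subspace_scale simp: image_subset_iff)
  qed
  have approx: "\<exists>y\<in>E. hnorm H (x - y) < \<epsilon>" if "x \<in> M" "0 < \<epsilon>" for x \<epsilon>
  proof -
    obtain \<sigma> where \<sigma>: "range \<sigma> \<subseteq> E" "hlim H \<sigma> x"
      using \<open>x \<in> M\<close> by (auto simp: M_def)
    then have "\<forall>\<^sub>F n in sequentially. hnorm H (\<sigma> n - x) < \<epsilon>"
      using \<open>0 < \<epsilon>\<close> by (auto simp: hlim_def intro: order_tendstoD)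
    then obtain n where "hnorm H (\<sigma> n - x) < \<epsilon>"
      by (auto dest: eventually_happens)
    then show ?thesis
      using \<sigma> hnorm_minus_commute[of x "\<sigma> n"] by (intro bexI[of _ "\<sigma> n"]) (auto simp: hlimD)
  qed
  interpret M: complex_hilbert_space "H\<lparr>carrier := M\<rparr>"
  proof (rule complex_hilbert_space_subspace[OF complex_hilbert_space_axioms \<open>csubspace M\<close> M_sub])
    fix \<sigma> l assume \<sigma>: "range \<sigma> \<subseteq> M" "hlim H \<sigma> l"
    have "\<exists>y\<in>E. hnorm H (\<sigma> n - y) < inverse (real (Suc n))" for n
      using \<sigma> approx[of "\<sigma> n"] by (simp add: image_subset_iff)
    then obtain \<tau> where \<tau>: "\<And>n. \<tau> n \<in> E" "\<And>n. hnorm H (\<sigma> n - \<tau> n) < inverse (real (Suc n))"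
      by metis
    have "hlim H \<tau> l"
    proof (rule hlim_if_bounded)
      show "hnorm H (\<tau> n - l) \<le> inverse (real (Suc n)) + hnorm H (\<sigma> n - l)" for n
        using hnorm_triangle_diff[of "\<tau> n" "\<sigma> n" l] hnorm_minus_commute[of "\<tau> n" "\<sigma> n"] \<tau>[of n] \<sigma>(2) E
        by (auto simp: hlimD subset_iff intro: order_trans)
      show "(\<lambda>n. inverse (real (Suc n)) + hnorm H (\<sigma> n - l)) \<longlonglongrightarrow> 0"
        using tendsto_add[OF LIMSEQ_inverse_real_of_nat, of _ 0] \<sigma>(2) by (auto simp: hlim_def)
    qed (use \<tau> \<sigma> E in \<open>auto simp: hlimD\<close>)
    then show "l \<in> M"
      using \<tau> by (auto simp: M_def)
  qed
  have "carrier H \<subseteq> M"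
  proof
    fix x assume x: "x \<in> carrier H"
    obtain y where y: "y \<in> M" "\<And>u. u \<in> M \<Longrightarrow> cinner H u y = cinner H u x"
    proof (rule M.riesz_representation[of "\<lambda>u. cinner H u x" "hnorm H x"])
      show "cmod (cinner H u x) \<le> hnorm H x * hnorm (H\<lparr>carrier := M\<rparr>) u"
        if "u \<in> carrier (H\<lparr>carrier := M\<rparr>)" for u
        using Cauchy_Schwarz[of u x] that x M_sub by (auto simp: mult.commute)
    qed (use M_sub x in \<open>auto simp: cinner_add_left cinner_scaleC_left subset_iff\<close>)
    have "x - y = 0"
      using x y M_sub E_sub by (intro orth) (auto simp: carrier_closed cinner_diff_right subset_iff)
    then show "x \<in> M"
      using y by simp
  qed
  then show ?thesis
    unfolding hdense_def using approx E by blast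
qed

end


section \<open>Normal operators and their bounded transforms\<close>

text \<open>
  For a normal operator \<open>N\<close> the three bounded operators below are \<open>C = (1 + N\<^sup>*N)\<^sup>-\<^sup>1\<close>, \<open>B = N C\<close>
  and \<open>B' = N\<^sup>* C\<close>.
  Each condition can be tested by inner products, which is why such triples survive a passage to a
  limit along a net. Boundedness is a consequence of \<open>B'B = C - C\<^sup>2\<close>.
\<close>

locale bounded_transform = complex_inner_product_space K
  for K :: "('k :: complex_vector) inner_product_structure" +
  fixes C B B' :: "'k \<Rightarrow> 'k"
  assumes closed: "x \<in> carrier K \<Longrightarrow> C x \<in> carrier K"
      "x \<in> carrier K \<Longrightarrow> B x \<in> carrier K"
      "x \<in> carrier K \<Longrightarrow> B' x \<in> carrier K"
    and C_self_adjoint: "x \<in> carrier K \<Longrightarrow> y \<in> carrier K \<Longrightarrow> cinner K (C x) y = cinner K x (C y)"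
    and B_adjoint: "x \<in> carrier K \<Longrightarrow> y \<in> carrier K \<Longrightarrow> cinner K (B x) y = cinner K x (B' y)"
    and BC: "x \<in> carrier K \<Longrightarrow> B (C x) = C (B x)"
    and B'C: "x \<in> carrier K \<Longrightarrow> B' (C x) = C (B' x)"
    and B'B: "x \<in> carrier K \<Longrightarrow> B' (B x) = C x - C (C x)"
    and BB': "x \<in> carrier K \<Longrightarrow> B (B' x) = C x - C (C x)"
begin

lemma B'_adjoint: "x \<in> carrier K \<Longrightarrow> y \<in> carrier K \<Longrightarrow> cinner K (B' x) y = cinner K x (B y)"
  using B_adjoint[of y x] cinner_commute closed by metis

lemma bounded_transform_swap: "bounded_transform K C B' B"
  using closed C_self_adjoint B'_adjoint BC B'C BB' B'B
  by unfold_locales auto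

lemma C_linear:
  "x \<in> carrier K \<Longrightarrow> y \<in> carrier K \<Longrightarrow> C (x + y) = C x + C y"
  "x \<in> carrier K \<Longrightarrow> y \<in> carrier K \<Longrightarrow> C (x - y) = C x - C y"
  "x \<in> carrier K \<Longrightarrow> C (a *\<^sub>C x) = a *\<^sub>C C x"
  by (rule eq_if_cinner_eq; simp add: closed carrier_closed cinner_add_left cinner_diff_left
      cinner_scaleC_left C_self_adjoint)+

lemma B_linear:
  "x \<in> carrier K \<Longrightarrow> y \<in> carrier K \<Longrightarrow> B (x + y) = B x + B y"
  "x \<in> carrier K \<Longrightarrow> y \<in> carrier K \<Longrightarrow> B (x - y) = B x - B y"
  "x \<in> carrier K \<Longrightarrow> B (a *\<^sub>C x) = a *\<^sub>C B x"
  by (rule eq_if_cinner_eq; simp add: closed carrier_closed cinner_add_left cinner_diff_left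
      cinner_scaleC_left B_adjoint)+

lemmas B'_linear = bounded_transform.B_linear[OF bounded_transform_swap]

lemma C_zero: "C 0 = 0" and B_zero: "B 0 = 0" and B'_zero: "B' 0 = 0"
  using C_linear(2)[of 0 0] B_linear(2)[of 0 0] B'_linear(2)[of 0 0] by (simp_all add: carrier_closed)

lemma hnorm_C_B_square:
  assumes "x \<in> carrier K"
  shows "(hnorm K (C x))\<^sup>2 + (hnorm K (B x))\<^sup>2 = Re (cinner K x (C x))"
  using assms
  by (simp add: hnorm_power2 closed C_self_adjoint B_adjoint B'B cinner_diff_right)

text \<open>
  Contractivity is a consequence of \<open>\<parallel>C x\<parallel>\<^sup>2 + \<parallel>B x\<parallel>\<^sup>2 = \<langle>x, C x\<rangle> \<le> \<parallel>x\<parallel> \<parallel>C x\<parallel>\<close>.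
\<close>

lemma C_contractive:
  assumes "x \<in> carrier K"
  shows "hnorm K (C x) \<le> hnorm K x"
proof (cases "hnorm K (C x) = 0")
  case False
  have "(hnorm K (C x))\<^sup>2 \<le> Re (cinner K x (C x))"
    using hnorm_C_B_square[OF assms] zero_le_power2[of "hnorm K (B x)"] by linarith
  also have "\<dots> \<le> hnorm K x * hnorm K (C x)"
    using Cauchy_Schwarz[of x "C x"] complex_Re_le_cmod[of "cinner K x (C x)"] assms closed by simp
  finally show ?thesis
    using False hnorm_nonneg[of "C x"] assms closed
    by (simp add: power2_eq_square)
qed (simp add: hnorm_nonneg assms)

lemma B_contractive:
  assumes "x \<in> carrier K"
  shows "hnorm K (B x) \<le> hnorm K x"
proof -
  have "(hnorm K (B x))\<^sup>2 \<le> Re (cinner K x (C x))"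
    using hnorm_C_B_square[OF assms] zero_le_power2[of "hnorm K (C x)"] by linarith
  also have "\<dots> \<le> hnorm K x * hnorm K (C x)"
    using Cauchy_Schwarz[of x "C x"] complex_Re_le_cmod[of "cinner K x (C x)"] assms closed by simp
  also have "\<dots> \<le> (hnorm K x)\<^sup>2"
    using C_contractive assms hnorm_nonneg by (simp add: power2_eq_square mult_left_mono)
  finally show ?thesis
    using assms hnorm_nonneg power2_le_imp_le by blast
qed

lemmas B'_contractive = bounded_transform.B_contractive[OF bounded_transform_swap]

lemma B_zero_if_C_zero:
  assumes "x \<in> carrier K" "C x = 0"
  shows "B x = 0"
  using hnorm_C_B_square[of x] assms cinner_zero_right[of x] hnorm_zero hnorm_eq_zero[of "B x"] closed
  by simp

lemmas B'_zero_if_C_zero = bounded_transform.B_zero_if_C_zero[OF bounded_transform_swap]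

end

text \<open>
  If \<open>C\<close> is injective, the triple determines an operator \<open>N\<close> with graph \<open>{(u, v). C v = B u}\<close>.
\<close>

locale injective_bounded_transform = bounded_transform +
  assumes C_injective: "x \<in> carrier K \<Longrightarrow> C x = 0 \<Longrightarrow> x = 0"
begin

lemma swap: "injective_bounded_transform K C B' B"
  using bounded_transform_swap C_injective
  by (simp add: injective_bounded_transform_def injective_bounded_transform_axioms_def)

lemma C_eq_iff: "x \<in> carrier K \<Longrightarrow> y \<in> carrier K \<Longrightarrow> C x = C y \<longleftrightarrow> x = y"
  using C_injective[of "x - y"] by (auto simp: C_linear carrier_closed)

text \<open>Formally \<open>u = C (1 + N\<^sup>*N) u = C u + (N\<^sup>*C) (N u)\<close>.\<close>

lemma graph_decomposition:
  assumes "u \<in> carrier K" "v \<in> carrier K" "C v = B u"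
  shows "u = C u + B' v"
proof -
  have "C (C u + B' v) = C (C u) + B' (C v)"
    using assms by (simp add: C_linear closed flip: B'C)
  also have "\<dots> = C u"
    using assms by (simp add: B'B)
  finally show ?thesis
    using assms C_eq_iff[of "C u + B' v" u] by (simp add: closed carrier_closed)
qed

text \<open>
  With both decompositions at hand, \<open>\<langle>v, y\<rangle> = \<langle>v, C y + B z\<rangle> = \<langle>B u, y\<rangle> + \<langle>u - C u, z\<rangle> = \<langle>u, z\<rangle>\<close>.
\<close>

lemma graph_adjoint:
  assumes u: "u \<in> carrier K" "v \<in> carrier K" "C v = B u"
    and y: "y \<in> carrier K" "z \<in> carrier K" "C z = B' y"
  shows "cinner K v y = cinner K u z"
proof -
  have y_eq: "y = C y + B z"
    using injective_bounded_transform.graph_decomposition[OF swap y] .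
  have "cinner K v y = cinner K v (C y) + cinner K v (B z)"
    using u y by (subst y_eq) (simp add: closed cinner_add_right)
  also have "\<dots> = cinner K (C v) y + cinner K (B' v) z"
    using u(1,2) y by (simp add: C_self_adjoint B'_adjoint)
  also have "\<dots> = cinner K u (B' y) + cinner K (u - C u) z"
    using u y graph_decomposition[OF u] B_adjoint[of u y]
    by (metis add_diff_cancel_left')
  also have "\<dots> = cinner K u z"
    using u y by (simp add: cinner_diff_left closed C_self_adjoint)
  finally show ?thesis .
qed

definition normal_op :: "'a operator" where
  "normal_op u =
     (if u \<in> carrier K \<and> (\<exists>v\<in>carrier K. C v = B u)
      then Some (THE v. v \<in> carrier K \<and> C v = B u) else None)"

lemma normal_op_iff: "normal_op u = Some v \<longleftrightarrow> u \<in> carrier K \<and> v \<in> carrier K \<and> C v = B u"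
proof
  assume eq: "normal_op u = Some v"
  then obtain v' where v': "u \<in> carrier K" "v' \<in> carrier K" "C v' = B u"
    by (auto simp: normal_op_def split: if_splits)
  then have "(THE v. v \<in> carrier K \<and> C v = B u) = v'"
    by (intro the_equality) (auto simp flip: C_eq_iff)
  with eq v' show "u \<in> carrier K \<and> v \<in> carrier K \<and> C v = B u"
    by (auto simp: normal_op_def split: if_splits)
next
  assume v: "u \<in> carrier K \<and> v \<in> carrier K \<and> C v = B u"
  then have "(THE v. v \<in> carrier K \<and> C v = B u) = v"
    by (intro the_equality) (auto simp flip: C_eq_iff)
  with v show "normal_op u = Some v"
    by (auto simp: normal_op_def)
qed

lemma C_in_dom: "w \<in> carrier K \<Longrightarrow> normal_op (C w) = Some (B w)"
  by (simp add: normal_op_iff closed BC)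

lemma linear_normal_op: "linear_operator K normal_op"
proof -
  have add: "normal_op (x + y) = Some (v + w)" if "normal_op x = Some v" "normal_op y = Some w" for x y v w
    using that by (simp add: normal_op_iff carrier_closed C_linear B_linear)
  have scale: "normal_op (a *\<^sub>C x) = Some (a *\<^sub>C v)" if "normal_op x = Some v" for a x v
    using that by (simp add: normal_op_iff carrier_closed C_linear B_linear)
  have "normal_op 0 = Some 0"
    by (simp add: normal_op_iff carrier_closed C_zero B_zero)
  then have "csubspace (dom normal_op)"
    using add scale by (intro complex_vector.subspaceI) (auto simp: dom_def; blast)+
  moreover have "dom normal_op \<subseteq> carrier K" "ran normal_op \<subseteq> carrier K"
    by (auto simp: dom_def ran_def normal_op_iff)
  ultimately show ?thesis
    unfolding linear_operator_def using add scale by auto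
qed

text \<open>The graph is the zero set of the continuous map \<open>(u, v) \<mapsto> C v - B u\<close>.\<close>

lemma closed_normal_op: "closed_operator K normal_op"
proof (subst closed_operator_iff)
  show "Map.graph normal_op \<subseteq> carrier K \<times> carrier K"
    by (auto simp: Map.graph_def normal_op_iff)
  show "\<forall>x\<in>carrier K. \<forall>y\<in>carrier K.
      (\<forall>\<epsilon>>0. \<exists>(a, b)\<in>Map.graph normal_op. hnorm K (x - a) < \<epsilon> \<and> hnorm K (y - b) < \<epsilon>) \<longrightarrow>
      normal_op x = Some y"
  proof (intro ballI impI)
    fix x y
    assume xy: "x \<in> carrier K" "y \<in> carrier K"
      and approx: "\<forall>\<epsilon>>0. \<exists>(a, b)\<in>Map.graph normal_op. hnorm K (x - a) < \<epsilon> \<and> hnorm K (y - b) < \<epsilon>"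
    have "hnorm K (C y - B x) \<le> 0"
    proof (rule field_le_epsilon)
      fix \<epsilon> :: real assume "0 < \<epsilon>"
      then obtain a b where ab: "normal_op a = Some b" "hnorm K (x - a) < \<epsilon> / 2" "hnorm K (y - b) < \<epsilon> / 2"
        using approx[rule_format, of "\<epsilon> / 2"] by (auto simp: Map.graph_def)
      then have ab': "a \<in> carrier K" "b \<in> carrier K" "C b = B a"
        by (auto simp: normal_op_iff)
      then have "C y - B x = C (y - b) - B (x - a)"
        using xy by (simp add: C_linear B_linear)
      then have "hnorm K (C y - B x) \<le> hnorm K (y - b) + hnorm K (x - a)"
        using hnorm_triangle_diff[of "C (y - b)" 0 "B (x - a)"] hnorm_minus_commute[of 0 "B (x - a)"]
          C_contractive[of "y - b"] B_contractive[of "x - a"] ab' xy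
        by (simp add: closed carrier_closed)
      then show "hnorm K (C y - B x) \<le> 0 + \<epsilon>"
        using ab by simp
    qed
    then show "normal_op x = Some y"
      using xy hnorm_nonneg[of "C y - B x"] hnorm_diff_zero[of "C y" "B x"]
      by (simp add: normal_op_iff closed carrier_closed)
  qed
qed

text \<open>
  Testing the defining relation of the adjoint against the vectors \<open>C w\<close> gives \<open>C z = B' y\<close>, and
  \<open>graph_adjoint\<close> is the converse. So exchanging \<open>B\<close> and \<open>B'\<close> exchanges the operator and its adjoint.
\<close>

lemma adjoint_normal_op:
  "adjoint_op K normal_op = injective_bounded_transform.normal_op K C B'"
proof -
  interpret adj: injective_bounded_transform K C B' B
    by (rule swap)
  have rel: "(\<forall>x\<in>dom normal_op. cinner K (the (normal_op x)) y = cinner K x z) \<longleftrightarrow> C z = B' y"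
    if "y \<in> carrier K" "z \<in> carrier K" for y z
  proof
    assume h: "\<forall>x\<in>dom normal_op. cinner K (the (normal_op x)) y = cinner K x z"
    have "cinner K w (C z) = cinner K w (B' y)" if "w \<in> carrier K" for w
      using bspec[OF h, of "C w"] C_in_dom[OF that] that \<open>y \<in> carrier K\<close> \<open>z \<in> carrier K\<close>
      by (simp add: domI C_self_adjoint B_adjoint)
    then show "C z = B' y"
      using that by (intro eq_if_cinner_eq) (auto simp: closed, metis C_self_adjoint B'_adjoint closed cinner_commute)
  next
    assume "C z = B' y"
    then have "cinner K v y = cinner K x z" if "normal_op x = Some v" for x v
      using graph_adjoint[of x v y z] that \<open>y \<in> carrier K\<close> \<open>z \<in> carrier K\<close> by (simp add: normal_op_iff)
    then show "\<forall>x\<in>dom normal_op. cinner K (the (normal_op x)) y = cinner K x z"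
      by auto
  qed
  have ex: "(\<exists>z\<in>carrier K. \<forall>x\<in>dom normal_op. cinner K (the (normal_op x)) y = cinner K x z) \<longleftrightarrow>
      (\<exists>z\<in>carrier K. C z = B' y)" if "y \<in> carrier K" for y
    using rel[OF that] by blast
  have the: "(THE z. z \<in> carrier K \<and> (\<forall>x\<in>dom normal_op. cinner K (the (normal_op x)) y = cinner K x z)) =
      (THE z. z \<in> carrier K \<and> C z = B' y)" if "y \<in> carrier K" for y
    using rel[OF that] by (intro arg_cong[where f = The] ext) blast
  show ?thesis
  proof
    fix y
    show "adjoint_op K normal_op y = adj.normal_op y"
      unfolding adjoint_op_def adj.normal_op_def by (cases "y \<in> carrier K") (simp_all only: ex the simp_thms if_False)
  qed
qed

text \<open>
  Here \<open>N\<^sup>*N u = t\<close> forces \<open>u = C (u + t)\<close>, so that \<open>B' (u + t)\<close> serves as \<open>N\<^sup>* u\<close>.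
\<close>

lemma comp_adjoint_imp:
  assumes "u \<in> carrier K" "v \<in> carrier K" "t \<in> carrier K" "C v = B u" "C t = B' v"
  shows "\<exists>w\<in>carrier K. C w = B' u \<and> C t = B w"
proof
  have u: "u = C (u + t)"
    using graph_decomposition[OF assms(1,2,4)] assms by (simp add: C_linear)
  show "B' (u + t) \<in> carrier K"
    by (simp add: closed carrier_closed assms)
  have "C (u + t) - C (C (u + t)) = C t"
    using u assms by (simp add: C_linear) (metis add_diff_cancel_left')
  then show "C (B' (u + t)) = B' u \<and> C t = B (B' (u + t))"
    using u assms by (simp flip: B'C add: BB' carrier_closed)
qed

end

text \<open>
  The domain contains the range of \<open>C\<close>, which is dense because \<open>C\<close> is self-adjoint and injective.
  Both products of the operator with its adjoint agree because \<open>comp_adjoint_imp\<close> applies to the triple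
  and to the triple with \<open>B\<close> and \<open>B'\<close> exchanged.
\<close>

lemma (in complex_hilbert_space) normal_operator_normal_op:
  assumes "injective_bounded_transform H C B B'"
  shows "normal_operator H (injective_bounded_transform.normal_op H C B)"
proof -
  interpret injective_bounded_transform H C B B'
    by fact
  interpret adj: injective_bounded_transform H C B' B
    by (rule swap)
  have "hdense H (dom normal_op)"
  proof (rule hdense_if_orthogonal_zero)
    show "csubspace (dom normal_op)" "dom normal_op \<subseteq> carrier H"
      using linear_normal_op by (auto simp: linear_operator_def)
    fix y assume y: "y \<in> carrier H" and orth: "\<And>x. x \<in> dom normal_op \<Longrightarrow> cinner H x y = 0"
    have "cinner H (C y) (C y) = cinner H (C (C y)) y"
      using y by (simp add: C_self_adjoint closed)
    also have "\<dots> = 0"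
      using y C_in_dom[of "C y"] by (intro orth) (auto simp: closed)
    finally show "y = 0"
      using y C_injective[of y] cinner_eq_zero[of "C y"] by (simp add: closed)
  qed
  then have "densely_defined H normal_op"
    using linear_normal_op densely_defined_iff_hdense[of normal_op] by (simp add: linear_operator_def)
  moreover have "adj.normal_op \<circ>\<^sub>m normal_op = normal_op \<circ>\<^sub>m adj.normal_op"
  proof (rule ext)
    fix u
    have "(adj.normal_op \<circ>\<^sub>m normal_op) u = Some t \<longleftrightarrow> (normal_op \<circ>\<^sub>m adj.normal_op) u = Some t" for t
      unfolding map_comp_Some_iff normal_op_iff adj.normal_op_iff
      using comp_adjoint_imp[of u _ t] adj.comp_adjoint_imp[of u _ t] by blast
    then show "(adj.normal_op \<circ>\<^sub>m normal_op) u = (normal_op \<circ>\<^sub>m adj.normal_op) u"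
      by (metis option.exhaust)
  qed
  ultimately show ?thesis
    unfolding normal_operator_def adjoint_normal_op using linear_normal_op closed_normal_op by blast
qed


section \<open>The bounded transform of a normal operator\<close>

text \<open>The domain with the graph norm, which is complete exactly when the operator is closed.\<close>

definition graph_space :: "('a :: complex_vector) inner_product_structure \<Rightarrow> 'a operator \<Rightarrow> 'a inner_product_structure" where
  "graph_space H N =
     \<lparr>carrier = dom N, cinner = (\<lambda>u v. cinner H u v + cinner H (the (N u)) (the (N v)))\<rparr>"

lemma (in complex_inner_product_space) linear_operatorD:
  assumes "linear_operator H N"
  shows "N x = Some y \<Longrightarrow> x \<in> carrier H" "N x = Some y \<Longrightarrow> y \<in> carrier H"
    and "N x = Some y \<Longrightarrow> N x' = Some y' \<Longrightarrow> N (x + x') = Some (y + y')"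
    and "N x = Some y \<Longrightarrow> N (a *\<^sub>C x) = Some (a *\<^sub>C y)"
    and "N x = Some y \<Longrightarrow> N x' = Some y' \<Longrightarrow> N (x - x') = Some (y - y')"
    and "N 0 = Some 0"
proof -
  have sub: "csubspace (dom N)"
    using assms by (simp add: linear_operator_def)
  show "N x = Some y \<Longrightarrow> x \<in> carrier H" "N x = Some y \<Longrightarrow> y \<in> carrier H" for x y
    using assms by (auto simp: linear_operator_def ran_def)
  show add: "N (x + x') = Some (y + y')" if "N x = Some y" "N x' = Some y'" for x x' y y'
  proof -
    have "x + x' \<in> dom N"
      using that sub by (intro complex_vector.subspace_add) auto
    moreover have "the (N (x + x')) = y + y'"
      using assms that unfolding linear_operator_def by (metis domI option.sel)
    ultimately show ?thesis
      by auto
  qed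
  show scale: "N (a *\<^sub>C x) = Some (a *\<^sub>C y)" if "N x = Some y" for x y a
  proof -
    have "a *\<^sub>C x \<in> dom N"
      using that sub by (intro complex_vector.subspace_scale) auto
    moreover have "the (N (a *\<^sub>C x)) = a *\<^sub>C y"
      using assms that unfolding linear_operator_def by (metis domI option.sel)
    ultimately show ?thesis
      by auto
  qed
  show "N (x - x') = Some (y - y')" if "N x = Some y" "N x' = Some y'" for x x' y y'
    using add[OF that(1) scale[OF that(2), of "- 1"]] by (simp add: scaleC_one)
  have "0 \<in> dom N"
    using sub by (rule complex_vector.subspace_0)
  then obtain y where "N 0 = Some y"
    by auto
  then show "N 0 = Some 0"
    using scale[of 0 y 0] by simp
qed

lemma (in complex_hilbert_space) graph_space_hilbert:
  assumes lin: "linear_operator H N" and closed: "closed_operator H N"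
  shows "complex_hilbert_space (graph_space H N)"
proof -
  define G where "G = graph_space H N"
  note N = linear_operatorD[OF lin]
  have [simp]: "carrier G = dom N"
    by (simp add: G_def graph_space_def)
  have inner: "cinner G u v = cinner H u v + cinner H u' v'"
    if "N u = Some u'" "N v = Some v'" for u v u' v'
    using that by (simp add: G_def graph_space_def)
  have norm: "(hnorm G u)\<^sup>2 = (hnorm H u)\<^sup>2 + (hnorm H u')\<^sup>2" if "N u = Some u'" for u u'
    using that N(1,2)[OF that] by (simp add: hnorm_def[of G] inner hnorm_power2 cinner_ge_zero)
  interpret G: complex_inner_product_space G
  proof
    show "csubspace (carrier G)"
      using lin by (simp add: linear_operator_def)
    show "cinner G (x + y) z = cinner G x z + cinner G y z"
      if "x \<in> carrier G" "y \<in> carrier G" "z \<in> carrier G" for x y z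
      using that N(1,2,3) by (auto simp: inner cinner_add_left)
    show "cinner G (a *\<^sub>C x) z = a * cinner G x z" if "x \<in> carrier G" "z \<in> carrier G" for a x z
      using that N(1,2,4) by (auto simp: inner cinner_scaleC_left algebra_simps)
    show "cinner G y x = cnj (cinner G x y)" if xy: "x \<in> carrier G" "y \<in> carrier G" for x y
    proof -
      obtain x' y' where x': "N x = Some x'" and y': "N y = Some y'"
        using xy by auto
      show ?thesis
        using x' y' N(1,2) cinner_commute[of x y] cinner_commute[of x' y'] by (simp add: inner)
    qed
    show "0 \<le> Re (cinner G x x)" if "x \<in> carrier G" for x
      using that N(1,2) cinner_ge_zero by (auto simp: inner)
    show "x = 0" if x: "x \<in> carrier G" "cinner G x x = 0" for x
    proof -
      obtain y where y: "N x = Some y"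
        using x by auto
      then have "(hnorm H x)\<^sup>2 + (hnorm H y)\<^sup>2 = 0"
        using x norm[OF y] by (simp add: hnorm_def[of G])
      then show ?thesis
        using N(1)[OF y] hnorm_eq_zero by (simp add: sum_power2_eq_zero_iff)
    qed
  qed
  have le: "hnorm H u \<le> hnorm G u" "hnorm H u' \<le> hnorm G u" "hnorm G u \<le> hnorm H u + hnorm H u'"
    if u: "N u = Some u'" for u u'
  proof -
    have nn: "0 \<le> hnorm G u" "0 \<le> hnorm H u" "0 \<le> hnorm H u'"
      using u N(1,2)[OF u] G.hnorm_nonneg[of u] by (auto intro: hnorm_nonneg)
    have "(hnorm H u)\<^sup>2 \<le> (hnorm G u)\<^sup>2" "(hnorm H u')\<^sup>2 \<le> (hnorm G u)\<^sup>2"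
      by (simp_all add: norm[OF u])
    then show "hnorm H u \<le> hnorm G u" "hnorm H u' \<le> hnorm G u"
      using nn power2_le_imp_le by blast+
    have "(hnorm G u)\<^sup>2 \<le> (hnorm H u + hnorm H u')\<^sup>2"
      using nn by (simp add: norm[OF u] power2_sum)
    then show "hnorm G u \<le> hnorm H u + hnorm H u'"
      using nn by (auto dest: power2_le_imp_le)
  qed
  have "complex_hilbert_space G"
  proof (rule G.complex_hilbert_spaceI)
    fix \<sigma> assume \<sigma>: "hcauchy G \<sigma>"
    then have "\<forall>n. \<exists>y. N (\<sigma> n) = Some y"
      by (auto simp: hcauchy_def image_subset_iff)
    then obtain \<tau> where \<tau>: "\<And>n. N (\<sigma> n) = Some (\<tau> n)"
      by metis
    have diff: "N (\<sigma> m - \<sigma> n) = Some (\<tau> m - \<tau> n)" for m n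
      using \<tau> N(5) by blast
    have "hcauchy H \<sigma>" "hcauchy H \<tau>"
      using \<sigma> N(1,2)[OF \<tau>] le(1,2)[OF diff] unfolding hcauchy_def by (auto; meson le_less_trans)+
    then obtain x y where x: "hlim H \<sigma> x" and y: "hlim H \<tau> y"
      by (metis hcauchy_imp_hlim)
    have "\<exists>(a, b)\<in>Map.graph N. hnorm H (x - a) < \<epsilon> \<and> hnorm H (y - b) < \<epsilon>" if "\<epsilon> > 0" for \<epsilon>
    proof -
      have "\<forall>\<^sub>F n in sequentially. hnorm H (\<sigma> n - x) < \<epsilon> \<and> hnorm H (\<tau> n - y) < \<epsilon>"
        using x y that by (auto simp: hlim_def intro!: eventually_conj order_tendstoD)
      then obtain n where "hnorm H (\<sigma> n - x) < \<epsilon>" "hnorm H (\<tau> n - y) < \<epsilon>"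
        by (auto dest: eventually_happens)
      then show ?thesis
        using \<tau>[of n] x y hnorm_minus_commute
        by (intro bexI[of _ "(\<sigma> n, \<tau> n)"]) (auto simp: hlimD Map.graph_def)
    qed
    moreover have "Map.graph N \<subseteq> carrier H \<times> carrier H"
      using N(1,2) by (auto simp: Map.graph_def)
    ultimately have xy: "N x = Some y"
      using closed x y by (auto simp: closed_operator_iff hlimD)
    have "hlim G \<sigma> x"
    proof (rule G.hlim_if_bounded)
      show "hnorm G (\<sigma> n - x) \<le> hnorm H (\<sigma> n - x) + hnorm H (\<tau> n - y)" for n
        using le(3)[OF N(5)[OF \<tau> xy]] .
      show "(\<lambda>n. hnorm H (\<sigma> n - x) + hnorm H (\<tau> n - y)) \<longlonglongrightarrow> 0"
        using tendsto_add[of _ 0 _ _ 0] x y unfolding hlim_def by fastforce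
    qed (use \<tau> xy in auto)
    then show "\<exists>l. hlim G \<sigma> l" ..
  qed
  then show ?thesis
    by (simp add: G_def)
qed

lemma (in complex_inner_product_space) adjoint_op_iff:
  assumes "linear_operator H N" "densely_defined H N"
  shows "adjoint_op H N y = Some z \<longleftrightarrow>
    y \<in> carrier H \<and> z \<in> carrier H \<and> (\<forall>x v. N x = Some v \<longrightarrow> cinner H v y = cinner H x z)"
proof -
  let ?P = "\<lambda>z. z \<in> carrier H \<and> (\<forall>x\<in>dom N. cinner H (the (N x)) y = cinner H x z)"
  have dense: "hdense H (dom N)"
    using assms densely_defined_iff_hdense by (simp add: linear_operator_def)
  have unique: "z = z'" if z: "?P z" "?P z'" for z z'
  proof -
    obtain \<sigma> where \<sigma>: "range \<sigma> \<subseteq> dom N" "hlim H \<sigma> (z - z')"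
      using hdense_imp_hlim[OF dense] z carrier_closed(3) by metis
    have "cinner H (\<sigma> n) (z - z') = 0" for n
    proof -
      have "\<sigma> n \<in> dom N" "\<sigma> n \<in> carrier H"
        using \<sigma> by (auto simp: hlimD)
      then show ?thesis
        using z by (simp add: cinner_diff_right)
    qed
    then have "cinner H (z - z') (z - z') = 0"
      using hlim_cinner[OF \<sigma>(2) hlim_const[of "z - z'"]] z
      by (simp add: LIMSEQ_const_iff carrier_closed)
    then show ?thesis
      using z cinner_eq_zero[of "z - z'"] by (simp add: carrier_closed)
  qed
  have the: "?P z \<Longrightarrow> (THE z. ?P z) = z" for z
    by (intro the_equality) (use unique in blast)+
  have "adjoint_op H N y = (if y \<in> carrier H \<and> (\<exists>z. ?P z) then Some (THE z. ?P z) else None)"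
    unfolding adjoint_op_def by (simp only: Bex_def)
  then have "adjoint_op H N y = Some z \<longleftrightarrow> y \<in> carrier H \<and> ?P z"
    by (metis (mono_tags, lifting) the option.inject option.distinct(1))
  also have "(\<forall>x\<in>dom N. cinner H (the (N x)) y = cinner H x z) \<longleftrightarrow>
      (\<forall>x v. N x = Some v \<longrightarrow> cinner H v y = cinner H x z)"
    by (metis domD domI option.sel)
  finally show ?thesis .
qed

text \<open>
  The vector \<open>c = C x\<close> represents the functional \<open>u \<mapsto> \<langle>u, x\<rangle>\<close> in the graph space of \<open>N\<close>. That
  \<open>C\<close> commutes with \<open>N\<close> and \<open>N\<^sup>*\<close> is where normality enters: both \<open>N\<^sup>*N\<close> and \<open>N N\<^sup>*\<close> map \<open>c\<close> to
  \<open>x - c\<close>.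
\<close>

theorem (in complex_hilbert_space) normal_operator_bounded_transform:
  assumes "normal_operator H N"
  obtains C B B' where "injective_bounded_transform H C B B'"
    and "\<And>u v. N u = Some v \<Longrightarrow> C v = B u"
proof -
  define A where "A = adjoint_op H N"
  have lin: "linear_operator H N" and dense: "densely_defined H N" and cl: "closed_operator H N"
    and normal: "A \<circ>\<^sub>m N = N \<circ>\<^sub>m A"
    using assms by (auto simp: normal_operator_def A_def)
  note N = linear_operatorD[OF lin]
  note A_iff = adjoint_op_iff[OF lin dense, folded A_def]
  have A_diff: "A (x - x') = Some (y - y')" if "A x = Some y" "A x' = Some y'" for x x' y y'
    using that by (simp add: A_iff carrier_closed cinner_diff_right N(1,2))
  have adj: "cinner H v y = cinner H x z" if "N x = Some v" "A y = Some z" for x v y z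
    using that by (simp add: A_iff)
  have adj': "cinner H y v = cinner H z x" if "N x = Some v" "A y = Some z" for x v y z
    using adj[OF that] that N(1,2)[OF that(1)] cinner_commute[of v y] cinner_commute[of x z] by (simp add: A_iff)
  \<comment> \<open>\<open>R x c\<close> means \<open>c = (1 + N\<^sup>*N)\<^sup>-\<^sup>1 x\<close>. Commutation of \<open>C\<close> with \<open>N\<close> and with \<open>N\<^sup>*\<close> comes from
      proving \<open>R\<close> with one of its two readings after having used the other.\<close>
  define R where "R x c \<longleftrightarrow> (A \<circ>\<^sub>m N) c = Some (x - c)" for x c
  have R_iff: "R x c \<longleftrightarrow> (\<exists>b. N c = Some b \<and> A b = Some (x - c))" for x c
    by (auto simp: R_def map_comp_Some_iff)
  have R_iff': "R x c \<longleftrightarrow> (\<exists>d. A c = Some d \<and> N d = Some (x - c))" for x c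
    by (auto simp: R_def normal map_comp_Some_iff)
  have R_ex: "\<exists>c. R x c" if x: "x \<in> carrier H" for x
  proof -
    interpret G: complex_hilbert_space "graph_space H N"
      by (rule graph_space_hilbert[OF lin cl])
    have [simp]: "carrier (graph_space H N) = dom N"
      by (simp add: graph_space_def)
    have le: "hnorm H u \<le> hnorm (graph_space H N) u" if u: "u \<in> dom N" for u
      using that N(1,2) cinner_ge_zero unfolding hnorm_def graph_space_def by auto
    obtain c where c: "c \<in> dom N" "\<And>u. u \<in> dom N \<Longrightarrow> cinner (graph_space H N) u c = cinner H u x"
    proof (rule G.riesz_representation[of "\<lambda>u. cinner H u x" "hnorm H x"])
      show "cmod (cinner H u x) \<le> hnorm H x * hnorm (graph_space H N) u"
        if "u \<in> carrier (graph_space H N)" for u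
      proof -
        have "u \<in> carrier H"
          using that N(1) by auto
        then have "cmod (cinner H u x) \<le> hnorm H x * hnorm H u"
          using Cauchy_Schwarz[of u x] x by (simp add: mult.commute)
        also have "\<dots> \<le> hnorm H x * hnorm (graph_space H N) u"
          using le that x hnorm_nonneg by (intro mult_left_mono) auto
        finally show ?thesis .
      qed
    qed (use x N(1) in \<open>auto simp: cinner_add_left cinner_scaleC_left\<close>)
    then obtain b where b: "N c = Some b"
      by auto
    have "A b = Some (x - c)"
      unfolding A_iff
    proof (intro conjI allI impI)
      fix u v assume u: "N u = Some v"
      then show "cinner H v b = cinner H u (x - c)"
        using c(2)[of u] b x N(1,2) by (auto simp: graph_space_def cinner_diff_right algebra_simps)
    qed (use b x N(1,2) in \<open>auto simp: carrier_closed\<close>)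
    with b show ?thesis
      by (auto simp: R_iff)
  qed
  have R_unique: "c = c'" if R: "R x c" "R x c'" for x c c'
  proof -
    obtain b b' where b: "N c = Some b" "A b = Some (x - c)" "N c' = Some b'" "A b' = Some (x - c')"
      using R unfolding R_iff by blast
    have car: "c \<in> carrier H" "c' \<in> carrier H" "b \<in> carrier H" "b' \<in> carrier H"
      using b N(1,2) by auto
    have "cinner H (b - b') (b - b') = cinner H (c - c') ((x - c) - (x - c'))"
      using b by (intro adj N(5) A_diff)
    also have "\<dots> = - cinner H (c - c') (c - c')"
      using cinner_uminus_left[of "c - c'" "c - c'"] cinner_diff_right[of 0 "c - c'" "c - c'"] car
      by (simp add: carrier_closed cinner_zero_right)
    finally have "Re (cinner H (b - b') (b - b')) = - Re (cinner H (c - c') (c - c'))"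
      by simp
    then have "Re (cinner H (c - c') (c - c')) = 0"
      using cinner_ge_zero[of "b - b'"] cinner_ge_zero[of "c - c'"] car by (simp add: carrier_closed)
    then show ?thesis
      using car hnorm_diff_zero by (simp add: hnorm_def)
  qed
  define C where "C x = (THE c. R x c)" for x
  have R_C: "R x (C x)" if "x \<in> carrier H" for x
    unfolding C_def using R_ex[OF that] R_unique by (metis theI)
  have C_eq: "C x = c" if "R x c" for x c
    using that R_unique unfolding C_def by blast
  define B B' where "B x = the (N (C x))" and "B' x = the (A (C x))" for x
  have NC: "N (C x) = Some (B x)" "A (B x) = Some (x - C x)"
    and AC: "A (C x) = Some (B' x)" "N (B' x) = Some (x - C x)" if "x \<in> carrier H" for x
  proof -
    show "N (C x) = Some (B x)" "A (B x) = Some (x - C x)"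
      using R_C[OF that] by (auto simp: R_iff B_def)
    show "A (C x) = Some (B' x)" "N (B' x) = Some (x - C x)"
      using R_C[OF that] by (auto simp: R_iff' B'_def)
  qed
  have car: "C x \<in> carrier H" "B x \<in> carrier H" "B' x \<in> carrier H" if "x \<in> carrier H" for x
    using NC[OF that] AC[OF that] N(1,2) by auto
  have CN: "N (C u) = Some (C v)" if "N u = Some v" for u v
  proof -
    have u: "u \<in> carrier H"
      using that N(1) by auto
    have "N (u - C u) = Some (v - B u)"
      using that NC[OF u] N(5) by blast
    then have "R v (B u)"
      using NC[OF u] by (auto simp: R_iff')
    then show ?thesis
      using NC[OF u] C_eq by simp
  qed
  have CA: "A (C u) = Some (C v)" if "A u = Some v" for u v
  proof -
    have u: "u \<in> carrier H"
      using that A_iff by auto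
    have "A (u - C u) = Some (v - B' u)"
      using that AC[OF u] A_diff by blast
    then have "R v (B' u)"
      using AC[OF u] by (auto simp: R_iff)
    then show ?thesis
      using AC[OF u] C_eq by simp
  qed
  have "injective_bounded_transform H C B B'"
  proof
    fix x assume x: "x \<in> carrier H"
    show "C x \<in> carrier H" "B x \<in> carrier H" "B' x \<in> carrier H"
      using car[OF x] .
    show BC: "B (C x) = C (B x)" and B'C: "B' (C x) = C (B' x)"
      using CN[OF NC(1)[OF x]] CA[OF AC(1)[OF x]] NC(1)[of "C x"] AC(1)[of "C x"] car[OF x] by auto
    \<comment> \<open>Both \<open>B' (B x)\<close> and \<open>B (B' x)\<close> turn out to be \<open>C (x - C x)\<close>.\<close>
    have "C (x - C x) = C x - C (C x)"
    proof (rule C_eq)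
      show "R (x - C x) (C x - C (C x))"
        unfolding R_iff
      proof (intro exI conjI)
        show "N (C x - C (C x)) = Some (B x - B (C x))"
          using NC x car by (intro N(5)) auto
        show "A (B x - B (C x)) = Some (x - C x - (C x - C (C x)))"
          using NC x car by (intro A_diff) auto
      qed
    qed
    moreover have "C (x - C x) = B' (B x)" "C (x - C x) = B (B' x)"
      using CA[OF NC(2)[OF x]] AC(1)[of "B x"] CN[OF AC(2)[OF x]] NC(1)[of "B' x"] car[OF x] by auto
    ultimately show "B' (B x) = C x - C (C x)" "B (B' x) = C x - C (C x)"
      by simp_all
    show "x = 0" if "C x = 0"
    proof -
      have "B x = 0"
        using NC(1)[OF x] that N(6) by simp
      then have "A (B x - B x) = Some 0"
        using A_diff[OF NC(2)[OF x] NC(2)[OF x]] by simp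
      then show ?thesis
        using NC(2)[OF x] \<open>B x = 0\<close> that by simp
    qed
    fix y assume y: "y \<in> carrier H"
    have "cinner H (C x) y = cinner H (C x) (C y) + cinner H (C x) (y - C y)"
      using x y car by (simp add: cinner_diff_right)
    also have "\<dots> = cinner H (C x) (C y) + cinner H (B x) (B y)"
      using adj[OF NC(1)[OF x] NC(2)[OF y]] by simp
    also have "\<dots> = cinner H (C x) (C y) + cinner H (x - C x) (C y)"
      using adj'[OF NC(1)[OF y] NC(2)[OF x]] by simp
    also have "\<dots> = cinner H x (C y)"
      using x y car by (simp add: cinner_diff_left)
    finally show "cinner H (C x) y = cinner H x (C y)" .
    have "cinner H (B x) y = cinner H (B x) (C y) + cinner H (B x) (y - C y)"
      using x y car by (simp add: cinner_diff_right)
    also have "\<dots> = cinner H (C x) (B' y) + cinner H (x - C x) (B' y)"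
      using adj[OF NC(1)[OF x] AC(1)[OF y]] adj'[OF AC(2)[OF y] NC(2)[OF x]] by simp
    also have "\<dots> = cinner H x (B' y)"
      using x y car by (simp add: cinner_diff_left)
    finally show "cinner H (B x) y = cinner H x (B' y)" .
  qed
  moreover have "C v = B u" if "N u = Some v" for u v
    using CN[OF that] NC(1)[of u] N(1)[OF that] by simp
  ultimately show ?thesis
    using that by blast
qed


section \<open>Reproducing kernel Hilbert spaces\<close>

definition positive_kernel :: "('e \<Rightarrow> 'e \<Rightarrow> complex) \<Rightarrow> bool" where
  "positive_kernel \<kappa> \<longleftrightarrow>
     (\<forall>p q. \<kappa> q p = cnj (\<kappa> p q)) \<and>
     (\<forall>A c. finite A \<longrightarrow> 0 \<le> Re (\<Sum>p\<in>A. \<Sum>q\<in>A. c p * cnj (c q) * \<kappa> p q))"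

lemma sum_scaleC_apply: "(\<Sum>p\<in>A. c p *\<^sub>C f p) x = (\<Sum>p\<in>A. c p *\<^sub>C f p x)"
  by (induction A rule: infinite_finite_induct) (simp_all add: scaleC_fun_def)

lemma cspan_range_iff:
  fixes k :: "'e \<Rightarrow> 'b :: complex_vector"
  shows "f \<in> cspan (range k) \<longleftrightarrow> (\<exists>A c. finite A \<and> f = (\<Sum>p\<in>A. c p *\<^sub>C k p))"
proof
  assume "f \<in> cspan (range k)"
  then show "\<exists>A c. finite A \<and> f = (\<Sum>p\<in>A. c p *\<^sub>C k p)"
  proof (induction rule: complex_vector.span_induct_alt)
    case base
    show ?case
      by (auto intro!: exI[of _ "{}"])
  next
    case (step a x y)
    then obtain p A c where p: "x = k p" "finite A" "y = (\<Sum>p\<in>A. c p *\<^sub>C k p)"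
      by auto
    let ?a = "\<lambda>q. if q = p then a else 0" and ?c = "\<lambda>q. if q \<in> A then c q else 0"
    have "(\<Sum>q\<in>insert p A. ?a q *\<^sub>C k q) = (\<Sum>q\<in>{p}. a *\<^sub>C k q)"
      using p(2) by (intro sum.mono_neutral_cong_right) auto
    moreover have "(\<Sum>q\<in>insert p A. ?c q *\<^sub>C k q) = (\<Sum>q\<in>A. c q *\<^sub>C k q)"
      using p(2) by (intro sum.mono_neutral_cong_right) auto
    ultimately have "a *\<^sub>C x + y = (\<Sum>q\<in>insert p A. (?a q + ?c q) *\<^sub>C k q)"
      unfolding scaleC_add_left sum.distrib using p by simp
    then show ?case
      using p(2) by (meson finite_insert)
  qed
next
  assume "\<exists>A c. finite A \<and> f = (\<Sum>p\<in>A. c p *\<^sub>C k p)"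
  then show "f \<in> cspan (range k)"
    by (auto intro!: complex_vector.span_sum complex_vector.span_scale intro: complex_vector.span_base)
qed

text \<open>
  The inner product of \<open>f\<close> with \<open>\<kappa> q\<close> has to be \<open>f q\<close>, and conjugate linearity determines it on the
  span. The formula is linear in \<open>f\<close> by construction; only the choice of coefficients for \<open>g\<close> is an
  issue.
\<close>

definition kernel_inner :: "('e \<Rightarrow> 'e \<Rightarrow> complex) \<Rightarrow> ('e \<Rightarrow> complex) \<Rightarrow> ('e \<Rightarrow> complex) \<Rightarrow> complex" where
  "kernel_inner \<kappa> f g =
     (case SOME (A, d). finite A \<and> g = (\<Sum>q\<in>A. d q *\<^sub>C \<kappa> q) of (A, d) \<Rightarrow> \<Sum>q\<in>A. cnj (d q) * f q)"

text \<open>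
  For \<open>f = \<Sum>p. c p *\<^sub>C \<kappa> p\<close> the sum below equals \<open>\<Sum>p. c p * cnj (g p)\<close>, which does not mention the
  coefficients \<open>d\<close> of \<open>g\<close>.
\<close>

lemma kernel_inner_eq:
  assumes \<kappa>: "positive_kernel \<kappa>" and f: "f \<in> cspan (range \<kappa>)"
    and A: "finite A" "g = (\<Sum>q\<in>A. d q *\<^sub>C \<kappa> q)"
  shows "kernel_inner \<kappa> f g = (\<Sum>q\<in>A. cnj (d q) * f q)"
proof -
  obtain P c where P: "finite P" "f = (\<Sum>p\<in>P. c p *\<^sub>C \<kappa> p)"
    using f cspan_range_iff by blast
  have herm: "\<kappa> q p = cnj (\<kappa> p q)" for p q
    using \<kappa> unfolding positive_kernel_def by blast
  have eq: "(\<Sum>q\<in>A. cnj (d q) * f q) = (\<Sum>p\<in>P. c p * cnj (g p))"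
    if A: "finite A" "g = (\<Sum>q\<in>A. d q *\<^sub>C \<kappa> q)" for A d
  proof -
    have "(\<Sum>q\<in>A. cnj (d q) * f q) = (\<Sum>q\<in>A. \<Sum>p\<in>P. cnj (d q) * (c p * \<kappa> p q))"
      by (simp add: P(2) sum_scaleC_apply scaleC_complex_def sum_distrib_left)
    also have "\<dots> = (\<Sum>p\<in>P. \<Sum>q\<in>A. cnj (d q) * (c p * \<kappa> p q))"
      by (rule sum.swap)
    also have "\<dots> = (\<Sum>p\<in>P. c p * cnj (g p))"
      unfolding A(2) sum_scaleC_apply scaleC_complex_def sum_distrib_left cnj_sum complex_cnj_mult
      by (intro sum.cong refl) (subst herm, simp add: algebra_simps)
    finally show ?thesis .
  qed
  obtain A' d' where A': "(SOME (A, d). finite A \<and> g = (\<Sum>q\<in>A. d q *\<^sub>C \<kappa> q)) = (A', d')"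
    by (rule prod.exhaust)
  have "finite A' \<and> g = (\<Sum>q\<in>A'. d' q *\<^sub>C \<kappa> q)"
    using someI[of "\<lambda>(A, d). finite A \<and> g = (\<Sum>q\<in>A. d q *\<^sub>C \<kappa> q)" "(A, d)"] A
    unfolding A' by blast
  then show ?thesis
    unfolding kernel_inner_def A' using eq[of A' d'] eq[OF A] by simp
qed

lemma kernel_inner_space:
  assumes \<kappa>: "positive_kernel \<kappa>"
  shows "complex_inner_product_space \<lparr>carrier = cspan (range \<kappa>), cinner = kernel_inner \<kappa>\<rparr>"
    and "f \<in> cspan (range \<kappa>) \<Longrightarrow> kernel_inner \<kappa> f (\<kappa> p) = f p"
proof -
  note eq = kernel_inner_eq[OF \<kappa>]
  have herm: "\<kappa> q p = cnj (\<kappa> p q)" for p q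
    using \<kappa> unfolding positive_kernel_def by blast
  let ?P = "cspan (range \<kappa>)"
  have sub: "csubspace ?P"
    by (rule complex_vector.subspace_span)
  have base: "\<kappa> p \<in> ?P" for p
    by (simp add: complex_vector.span_base)
  show repr: "kernel_inner \<kappa> f (\<kappa> p) = f p" if "f \<in> ?P" for f p
    using eq[OF that, of "{p}" "\<kappa> p" "\<lambda>_. 1"] by (simp add: scaleC_one)
  have add: "kernel_inner \<kappa> (x + y) z = kernel_inner \<kappa> x z + kernel_inner \<kappa> y z"
    and scale: "kernel_inner \<kappa> (a *\<^sub>C x) z = a * kernel_inner \<kappa> x z"
    if xyz: "x \<in> ?P" "y \<in> ?P" "z \<in> ?P" for x y z a
  proof -
    obtain A d where A: "finite A" "z = (\<Sum>q\<in>A. d q *\<^sub>C \<kappa> q)"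
      using xyz cspan_range_iff by blast
    have "x + y \<in> ?P" "a *\<^sub>C x \<in> ?P"
      using xyz by (simp_all add: complex_vector.span_add complex_vector.span_scale)
    note eqs = this[THEN eq, OF A] xyz(1,2)[THEN eq, OF A]
    show "kernel_inner \<kappa> (x + y) z = kernel_inner \<kappa> x z + kernel_inner \<kappa> y z"
      unfolding eqs by (simp add: sum.distrib distrib_left)
    show "kernel_inner \<kappa> (a *\<^sub>C x) z = a * kernel_inner \<kappa> x z"
      unfolding eqs by (simp add: scaleC_fun_def scaleC_complex_def sum_distrib_left mult.left_commute)
  qed
  have sums: "kernel_inner \<kappa> f g = (\<Sum>p\<in>A. \<Sum>q\<in>B. c p * cnj (d q) * \<kappa> p q)"
    if "finite A" "f = (\<Sum>p\<in>A. c p *\<^sub>C \<kappa> p)" "finite B" "g = (\<Sum>q\<in>B. d q *\<^sub>C \<kappa> q)" for f g A B c d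
  proof -
    have "f \<in> ?P"
      using that cspan_range_iff by blast
    then have "kernel_inner \<kappa> f g = (\<Sum>q\<in>B. cnj (d q) * f q)"
      using eq that by blast
    also have "\<dots> = (\<Sum>q\<in>B. \<Sum>p\<in>A. c p * cnj (d q) * \<kappa> p q)"
      by (simp add: that(2) sum_scaleC_apply scaleC_complex_def sum_distrib_left algebra_simps)
    also have "\<dots> = (\<Sum>p\<in>A. \<Sum>q\<in>B. c p * cnj (d q) * \<kappa> p q)"
      by (rule sum.swap)
    finally show ?thesis .
  qed
  have commute: "kernel_inner \<kappa> y x = cnj (kernel_inner \<kappa> x y)" if xy: "x \<in> ?P" "y \<in> ?P" for x y
  proof -
    obtain A c where A: "finite A" "x = (\<Sum>q\<in>A. c q *\<^sub>C \<kappa> q)"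
      using xy cspan_range_iff by blast
    obtain B d where B: "finite B" "y = (\<Sum>q\<in>B. d q *\<^sub>C \<kappa> q)"
      using xy cspan_range_iff by blast
    have "kernel_inner \<kappa> y x = (\<Sum>q\<in>B. \<Sum>p\<in>A. d q * cnj (c p) * \<kappa> q p)"
      by (rule sums[OF B A])
    also have "\<dots> = (\<Sum>p\<in>A. \<Sum>q\<in>B. d q * cnj (c p) * \<kappa> q p)"
      by (rule sum.swap)
    also have "\<dots> = cnj (\<Sum>p\<in>A. \<Sum>q\<in>B. c p * cnj (d q) * \<kappa> p q)"
      unfolding cnj_sum by (intro sum.cong refl) (subst herm, simp add: algebra_simps)
    finally show ?thesis
      using sums[OF A B] by simp
  qed
  have pos: "0 \<le> Re (kernel_inner \<kappa> x x)" if x: "x \<in> ?P" for x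
  proof -
    obtain A c where A: "finite A" "x = (\<Sum>q\<in>A. c q *\<^sub>C \<kappa> q)"
      using x cspan_range_iff by blast
    have "0 \<le> Re (\<Sum>p\<in>A. \<Sum>q\<in>A. c p * cnj (c q) * \<kappa> p q)"
      using \<kappa> A(1) unfolding positive_kernel_def by blast
    then show ?thesis
      unfolding sums[OF A A] .
  qed
  have zero: "x = 0" if x: "x \<in> ?P" "kernel_inner \<kappa> x x = 0" for x
  proof
    fix p
    have "kernel_inner \<kappa> (\<kappa> p) x = 0"
    proof (rule complex_zero_if_quadratic_bound[of "Re (kernel_inner \<kappa> (\<kappa> p) (\<kappa> p))"])
      fix a
      let ?k = "a *\<^sub>C \<kappa> p"
      have k: "?k \<in> ?P"
        by (simp add: complex_vector.span_scale base)
      have "kernel_inner \<kappa> ?k ?k = a * cnj (kernel_inner \<kappa> ?k (\<kappa> p))"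
        using scale[OF base base k] commute[OF k base, of p] by simp
      also have "\<dots> = (a * cnj a) * kernel_inner \<kappa> (\<kappa> p) (\<kappa> p)"
        using scale[OF base base base] commute[OF base base, of p p] by simp
      also have "\<dots> = complex_of_real ((cmod a)\<^sup>2) * kernel_inner \<kappa> (\<kappa> p) (\<kappa> p)"
        by (simp add: complex_norm_square[symmetric])
      finally have kk: "Re (kernel_inner \<kappa> ?k ?k) = (cmod a)\<^sup>2 * Re (kernel_inner \<kappa> (\<kappa> p) (\<kappa> p))"
        by simp
      have kx: "?k + x \<in> ?P"
        using k x by (simp add: complex_vector.span_add)
      have "kernel_inner \<kappa> (?k + x) (?k + x) = kernel_inner \<kappa> ?k (?k + x) + kernel_inner \<kappa> x (?k + x)"
        by (rule add[OF k x(1) kx])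
      also have "\<dots> = cnj (kernel_inner \<kappa> (?k + x) ?k) + cnj (kernel_inner \<kappa> (?k + x) x)"
        using commute[OF kx k] commute[OF kx x(1)] by simp
      also have "\<dots> = cnj (kernel_inner \<kappa> ?k ?k) + kernel_inner \<kappa> ?k x + cnj (kernel_inner \<kappa> ?k x)"
        using add[OF k x(1) k] add[OF k x(1) x(1)] x(2) commute[OF x(1) k] by simp
      finally have "Re (kernel_inner \<kappa> (?k + x) (?k + x)) =
          (cmod a)\<^sup>2 * Re (kernel_inner \<kappa> (\<kappa> p) (\<kappa> p)) + 2 * Re (a * kernel_inner \<kappa> (\<kappa> p) x)"
        using kk scale[OF base base x(1)] by simp
      then show "0 \<le> (cmod a)\<^sup>2 * Re (kernel_inner \<kappa> (\<kappa> p) (\<kappa> p)) + 2 * Re (a * kernel_inner \<kappa> (\<kappa> p) x)"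
        using pos[OF kx] by simp
    qed
    then show "x p = 0 p"
      using repr[OF x(1), of p] commute[OF base x(1), of p] by simp
  qed
  show "complex_inner_product_space \<lparr>carrier = ?P, cinner = kernel_inner \<kappa>\<rparr>"
  proof (unfold_locales, simp_all only: inner_product_structure.simps)
    show "kernel_inner \<kappa> (a *\<^sub>C x) z = a * kernel_inner \<kappa> x z" if "x \<in> ?P" "z \<in> ?P" for a x z
      by (rule scale[OF that(1,1,2)])
  qed (fact sub add commute pos zero)+
qed

text \<open>
  The span of the kernel functions is completed inside the space of all functions: because evaluation at
  \<open>p\<close> is the inner product with \<open>\<kappa> p\<close>, a Cauchy sequence converges pointwise, and its pointwise limit
  serves as its limit.
\<close>

locale kernel_span = complex_inner_product_space P
  for P :: "('e \<Rightarrow> complex) inner_product_structure" +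
  fixes \<kappa> :: "'e \<Rightarrow> 'e \<Rightarrow> complex"
  assumes carrier_eq: "carrier P = cspan (range \<kappa>)"
    and repr: "f \<in> carrier P \<Longrightarrow> cinner P f (\<kappa> p) = f p"
begin

lemma kernel_carrier: "\<kappa> p \<in> carrier P"
  by (simp add: carrier_eq complex_vector.span_base)

definition represents :: "(nat \<Rightarrow> 'e \<Rightarrow> complex) \<Rightarrow> ('e \<Rightarrow> complex) \<Rightarrow> bool" where
  "represents \<sigma> f \<longleftrightarrow> hcauchy P \<sigma> \<and> (\<forall>p. (\<lambda>n. \<sigma> n p) \<longlonglongrightarrow> f p)"

lemma hcauchyD: "hcauchy P \<sigma> \<Longrightarrow> \<sigma> n \<in> carrier P"
  by (auto simp: hcauchy_def)

lemma hcauchy_bounded: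
  assumes "hcauchy P \<sigma>"
  obtains M where "0 < M" "\<And>n. hnorm P (\<sigma> n) \<le> M"
proof -
  have "Cauchy (\<lambda>n. hnorm P (\<sigma> n))"
  proof (rule CauchyI)
    fix e :: real assume "0 < e"
    then obtain N where "\<forall>m\<ge>N. \<forall>n\<ge>N. hnorm P (\<sigma> m - \<sigma> n) < e"
      using assms unfolding hcauchy_def by blast
    moreover have "norm (hnorm P (\<sigma> m) - hnorm P (\<sigma> n)) \<le> hnorm P (\<sigma> m - \<sigma> n)" for m n
      using hnorm_triangle_rev hcauchyD[OF assms] by simp
    ultimately show "\<exists>N. \<forall>m\<ge>N. \<forall>n\<ge>N. norm (hnorm P (\<sigma> m) - hnorm P (\<sigma> n)) < e"
      by (meson le_less_trans)
  qed
  then have "Bseq (\<lambda>n. hnorm P (\<sigma> n))"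
    by (rule Cauchy_Bseq)
  then obtain M where "0 < M" "\<And>n. norm (hnorm P (\<sigma> n)) \<le> M"
    by (auto simp: Bseq_def)
  then show ?thesis
    using that by (metis abs_le_D1 real_norm_def)
qed

lemma hcauchy_linear:
  assumes \<sigma>: "hcauchy P \<sigma>" and \<tau>: "hcauchy P \<tau>"
  shows "hcauchy P (\<lambda>n. \<sigma> n + \<tau> n)" "hcauchy P (\<lambda>n. a *\<^sub>C \<sigma> n)"
proof -
  note car = hcauchyD[OF \<sigma>] hcauchyD[OF \<tau>]
  show "hcauchy P (\<lambda>n. \<sigma> n + \<tau> n)"
    unfolding hcauchy_def
  proof (intro conjI allI impI)
    fix e :: real assume "0 < e"
    then obtain N1 N2 where N: "\<forall>m\<ge>N1. \<forall>n\<ge>N1. hnorm P (\<sigma> m - \<sigma> n) < e / 2"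
      "\<forall>m\<ge>N2. \<forall>n\<ge>N2. hnorm P (\<tau> m - \<tau> n) < e / 2"
      using \<sigma> \<tau> unfolding hcauchy_def by (meson half_gt_zero)
    have "hnorm P (\<sigma> m + \<tau> m - (\<sigma> n + \<tau> n)) < e" if "m \<ge> max N1 N2" "n \<ge> max N1 N2" for m n
    proof -
      have "hnorm P (\<sigma> m - \<sigma> n) < e / 2" "hnorm P (\<tau> m - \<tau> n) < e / 2"
        using N that by auto
      moreover have "hnorm P (\<sigma> m + \<tau> m - (\<sigma> n + \<tau> n)) = hnorm P ((\<sigma> m - \<sigma> n) + (\<tau> m - \<tau> n))"
        by (rule arg_cong[where f = "hnorm P"]) simp
      moreover have "hnorm P ((\<sigma> m - \<sigma> n) + (\<tau> m - \<tau> n)) \<le> hnorm P (\<sigma> m - \<sigma> n) + hnorm P (\<tau> m - \<tau> n)"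
        using car by (intro hnorm_triangle carrier_closed)
      ultimately show ?thesis
        by linarith
    qed
    then show "\<exists>N. \<forall>m\<ge>N. \<forall>n\<ge>N. hnorm P (\<sigma> m + \<tau> m - (\<sigma> n + \<tau> n)) < e"
      by blast
  qed (use car in \<open>auto simp: carrier_closed\<close>)
  show "hcauchy P (\<lambda>n. a *\<^sub>C \<sigma> n)"
    unfolding hcauchy_def
  proof (intro conjI allI impI)
    fix e :: real assume "0 < e"
    then have "0 < e / (cmod a + 1)"
      by (simp add: add_nonneg_pos)
    then obtain N where N: "\<forall>m\<ge>N. \<forall>n\<ge>N. hnorm P (\<sigma> m - \<sigma> n) < e / (cmod a + 1)"
      using \<sigma> unfolding hcauchy_def by meson
    have "hnorm P (a *\<^sub>C \<sigma> m - a *\<^sub>C \<sigma> n) < e" if "m \<ge> N" "n \<ge> N" for m n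
    proof -
      have "hnorm P (a *\<^sub>C \<sigma> m - a *\<^sub>C \<sigma> n) = cmod a * hnorm P (\<sigma> m - \<sigma> n)"
        using hnorm_scaleC[of "\<sigma> m - \<sigma> n" a] car
        by (simp add: carrier_closed complex_vector.scale_right_diff_distrib)
      also have "\<dots> \<le> (cmod a + 1) * hnorm P (\<sigma> m - \<sigma> n)"
        using car hnorm_nonneg by (intro mult_right_mono) (auto simp: carrier_closed)
      also have "\<dots> < (cmod a + 1) * (e / (cmod a + 1))"
        using N that by (intro mult_strict_left_mono) (auto simp: add_nonneg_pos)
      also have "\<dots> = e"
        using norm_ge_zero[of a] by (simp add: add_nonneg_pos less_imp_neq[THEN not_sym])
      finally show ?thesis .
    qed
    then show "\<exists>N. \<forall>m\<ge>N. \<forall>n\<ge>N. hnorm P (a *\<^sub>C \<sigma> m - a *\<^sub>C \<sigma> n) < e"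
      by blast
  qed (use car in \<open>auto simp: carrier_closed\<close>)
qed

lemma hcauchy_const: "f \<in> carrier P \<Longrightarrow> hcauchy P (\<lambda>n. f)"
  by (auto simp: hcauchy_def hnorm_zero)

lemma hcauchy_diff: "hcauchy P \<sigma> \<Longrightarrow> hcauchy P \<tau> \<Longrightarrow> hcauchy P (\<lambda>n. \<sigma> n - \<tau> n)"
  using hcauchy_linear(1)[OF _ hcauchy_linear(2)[of \<tau> \<tau> "- 1"], of \<sigma>] by (simp add: scaleC_one)

text \<open>
  Against a fixed \<open>f\<close> in the span of the kernel functions \<open>\<langle>\<sigma> n, f\<rangle>\<close> tends to zero, and \<open>\<sigma> n\<close> is
  close to one such \<open>f = \<sigma> N\<close>.
\<close>

lemma hnorm_null:
  assumes \<sigma>: "hcauchy P \<sigma>" and null: "\<And>p. (\<lambda>n. \<sigma> n p) \<longlonglongrightarrow> 0"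
  shows "(\<lambda>n. hnorm P (\<sigma> n)) \<longlonglongrightarrow> 0"
proof -
  note car = hcauchyD[OF \<sigma>]
  have weak: "(\<lambda>n. cinner P (\<sigma> n) f) \<longlonglongrightarrow> 0" if f: "f \<in> carrier P" for f
  proof -
    obtain A c where A: "f = (\<Sum>p\<in>A. c p *\<^sub>C \<kappa> p)"
      using f cspan_range_iff[of f \<kappa>] by (auto simp: carrier_eq)
    have "cinner P (\<sigma> n) f = (\<Sum>p\<in>A. cnj (c p) * \<sigma> n p)" for n
      unfolding A using car[of n]
      by (simp add: cinner_sum_right kernel_carrier carrier_closed cinner_scaleC_right repr)
    moreover have "(\<lambda>n. \<Sum>p\<in>A. cnj (c p) * \<sigma> n p) \<longlonglongrightarrow> (\<Sum>p\<in>A. cnj (c p) * 0)"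
      by (intro tendsto_intros null)
    ultimately show ?thesis
      by simp
  qed
  obtain M where M: "0 < M" "\<And>n. hnorm P (\<sigma> n) \<le> M"
    using hcauchy_bounded[OF \<sigma>] by blast
  have "(\<lambda>n. (hnorm P (\<sigma> n))\<^sup>2) \<longlonglongrightarrow> 0"
  proof (rule LIMSEQ_I)
    fix r :: real assume "0 < r"
    then have "0 < r / (2 * M)"
      using M by simp
    then obtain N where N: "\<And>m n. m \<ge> N \<Longrightarrow> n \<ge> N \<Longrightarrow> hnorm P (\<sigma> m - \<sigma> n) < r / (2 * M)"
      using \<sigma> unfolding hcauchy_def by meson
    obtain N' where N': "\<And>n. n \<ge> N' \<Longrightarrow> cmod (cinner P (\<sigma> n) (\<sigma> N)) < r / 2"
      using LIMSEQ_D[OF weak[OF car], of "r / 2" N] \<open>0 < r\<close> by auto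
    have "norm ((hnorm P (\<sigma> n))\<^sup>2 - 0) < r" if n: "n \<ge> max N N'" for n
    proof -
      have "(hnorm P (\<sigma> n))\<^sup>2 = Re (cinner P (\<sigma> n) (\<sigma> n - \<sigma> N)) + Re (cinner P (\<sigma> n) (\<sigma> N))"
        using car by (simp add: hnorm_power2 cinner_diff_right)
      also have "\<dots> \<le> hnorm P (\<sigma> n) * hnorm P (\<sigma> n - \<sigma> N) + cmod (cinner P (\<sigma> n) (\<sigma> N))"
        using Cauchy_Schwarz[of "\<sigma> n" "\<sigma> n - \<sigma> N"] car complex_Re_le_cmod
        by (meson add_mono carrier_closed(3) order_trans)
      also have "\<dots> \<le> M * hnorm P (\<sigma> n - \<sigma> N) + cmod (cinner P (\<sigma> n) (\<sigma> N))"
        using M(2)[of n] hnorm_nonneg car by (simp add: mult_right_mono carrier_closed)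
      also have "\<dots> < M * (r / (2 * M)) + r / 2"
        using N[of n N] N'[of n] n M(1) by (intro add_strict_mono mult_strict_left_mono) auto
      also have "\<dots> = r"
        using M(1) by simp
      finally show ?thesis
        by simp
    qed
    then show "\<exists>n0. \<forall>n\<ge>n0. norm ((hnorm P (\<sigma> n))\<^sup>2 - 0) < r"
      by blast
  qed
  then show ?thesis
    using tendsto_real_sqrt[of _ 0] hnorm_nonneg[OF car] by fastforce
qed

lemma tendsto_cinner_zero:
  assumes "hcauchy P \<sigma>" "hcauchy P \<tau>" "(\<lambda>n. hnorm P (\<sigma> n)) \<longlonglongrightarrow> 0"
  shows "(\<lambda>n. cinner P (\<sigma> n) (\<tau> n)) \<longlonglongrightarrow> 0" "(\<lambda>n. cinner P (\<tau> n) (\<sigma> n)) \<longlonglongrightarrow> 0"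
proof -
  obtain M where M: "0 < M" "\<And>n. hnorm P (\<tau> n) \<le> M"
    using hcauchy_bounded[OF assms(2)] by blast
  note car = hcauchyD[OF assms(1)] hcauchyD[OF assms(2)]
  have lim: "(\<lambda>n. hnorm P (\<sigma> n) * M) \<longlonglongrightarrow> 0"
    using tendsto_mult_right[OF assms(3), of M] by simp
  have le: "hnorm P (\<sigma> n) * hnorm P (\<tau> n) \<le> hnorm P (\<sigma> n) * M" for n
    using M(2) hnorm_nonneg[OF car(1)] by (simp add: mult_left_mono)
  show "(\<lambda>n. cinner P (\<sigma> n) (\<tau> n)) \<longlonglongrightarrow> 0"
    using order_trans[OF Cauchy_Schwarz[OF car] le]
    by (intro Lim_null_comparison[OF _ lim] always_eventually) blast
  show "(\<lambda>n. cinner P (\<tau> n) (\<sigma> n)) \<longlonglongrightarrow> 0"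
    using order_trans[OF Cauchy_Schwarz[OF car(2,1), unfolded mult.commute[of "hnorm P (\<tau> _)"]] le]
    by (intro Lim_null_comparison[OF _ lim] always_eventually) blast
qed

lemma convergent_cinner:
  assumes \<sigma>: "hcauchy P \<sigma>" and \<tau>: "hcauchy P \<tau>"
  shows "convergent (\<lambda>n. cinner P (\<sigma> n) (\<tau> n))"
proof -
  note car = hcauchyD[OF \<sigma>] hcauchyD[OF \<tau>]
  obtain M where M: "0 < M" "\<And>n. hnorm P (\<sigma> n) \<le> M"
    using hcauchy_bounded[OF \<sigma>] by blast
  obtain M' where M': "0 < M'" "\<And>n. hnorm P (\<tau> n) \<le> M'"
    using hcauchy_bounded[OF \<tau>] by blast
  have "Cauchy (\<lambda>n. cinner P (\<sigma> n) (\<tau> n))"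
  proof (rule CauchyI)
    fix e :: real assume "0 < e"
    then have "0 < e / (2 * M)" "0 < e / (2 * M')"
      using M(1) M'(1) by simp_all
    then obtain N1 N2 where N: "\<forall>m\<ge>N1. \<forall>n\<ge>N1. hnorm P (\<tau> m - \<tau> n) < e / (2 * M)"
      "\<forall>m\<ge>N2. \<forall>n\<ge>N2. hnorm P (\<sigma> m - \<sigma> n) < e / (2 * M')"
      using \<sigma> \<tau> unfolding hcauchy_def by meson
    have "norm (cinner P (\<sigma> m) (\<tau> m) - cinner P (\<sigma> n) (\<tau> n)) < e"
      if mn: "m \<ge> max N1 N2" "n \<ge> max N1 N2" for m n
    proof -
      have "cinner P (\<sigma> m) (\<tau> m) - cinner P (\<sigma> n) (\<tau> n) =
          cinner P (\<sigma> m) (\<tau> m - \<tau> n) + cinner P (\<sigma> m - \<sigma> n) (\<tau> n)"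
        using car by (simp add: cinner_diff_left cinner_diff_right)
      then have "cmod (cinner P (\<sigma> m) (\<tau> m) - cinner P (\<sigma> n) (\<tau> n)) \<le>
          cmod (cinner P (\<sigma> m) (\<tau> m - \<tau> n)) + cmod (cinner P (\<sigma> m - \<sigma> n) (\<tau> n))"
        by (simp add: norm_triangle_ineq)
      also have "\<dots> \<le> hnorm P (\<sigma> m) * hnorm P (\<tau> m - \<tau> n) + hnorm P (\<sigma> m - \<sigma> n) * hnorm P (\<tau> n)"
        using car by (intro add_mono Cauchy_Schwarz carrier_closed)
      also have "\<dots> \<le> M * hnorm P (\<tau> m - \<tau> n) + hnorm P (\<sigma> m - \<sigma> n) * M'"
        using M M' car by (intro add_mono mult_mono) (auto simp: hnorm_nonneg carrier_closed)
      also have "\<dots> < M * (e / (2 * M)) + (e / (2 * M')) * M'"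
        using N mn M(1) M'(1) by (intro add_strict_mono mult_strict_left_mono mult_strict_right_mono) auto
      also have "\<dots> = e"
        using M(1) M'(1) by simp
      finally show ?thesis .
    qed
    then show "\<exists>N. \<forall>m\<ge>N. \<forall>n\<ge>N. norm (cinner P (\<sigma> m) (\<tau> m) - cinner P (\<sigma> n) (\<tau> n)) < e"
      by blast
  qed
  then show ?thesis
    by (rule Cauchy_convergent)
qed

definition completion :: "('e \<Rightarrow> complex) inner_product_structure" where
  "completion =
     \<lparr>carrier = {f. \<exists>\<sigma>. represents \<sigma> f},
      cinner = (\<lambda>f g. lim (\<lambda>n. cinner P ((SOME \<sigma>. represents \<sigma> f) n) ((SOME \<sigma>. represents \<sigma> g) n)))\<rparr>"

lemma completion_carrier: "f \<in> carrier completion \<longleftrightarrow> (\<exists>\<sigma>. represents \<sigma> f)"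
  by (simp add: completion_def)

text \<open>
  Two representing sequences of the same function differ by a Cauchy sequence that tends to zero pointwise,
  hence in norm by \<open>hnorm_null\<close>. So the limit does not depend on the sequences chosen.
\<close>

lemma completion_cinner:
  assumes "represents \<sigma> f" "represents \<tau> g"
  shows "(\<lambda>n. cinner P (\<sigma> n) (\<tau> n)) \<longlonglongrightarrow> cinner completion f g"
proof -
  define \<sigma>' where "\<sigma>' = (SOME \<sigma>. represents \<sigma> f)"
  define \<tau>' where "\<tau>' = (SOME \<sigma>. represents \<sigma> g)"
  have rep: "represents \<sigma>' f" "represents \<tau>' g"
    using assms unfolding \<sigma>'_def \<tau>'_def by (metis someI)+
  note c = assms[unfolded represents_def] rep[unfolded represents_def]
  have "convergent (\<lambda>n. cinner P (\<sigma>' n) (\<tau>' n))"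
    using convergent_cinner c by blast
  then have lim: "(\<lambda>n. cinner P (\<sigma>' n) (\<tau>' n)) \<longlonglongrightarrow> cinner completion f g"
    unfolding completion_def \<sigma>'_def \<tau>'_def by (simp add: convergent_LIMSEQ_iff)
  have null: "(\<lambda>n. hnorm P (\<sigma> n - \<sigma>' n)) \<longlonglongrightarrow> 0" if "represents \<sigma> f" "represents \<sigma>' f" for \<sigma> \<sigma>' f
  proof (rule hnorm_null)
    show "hcauchy P (\<lambda>n. \<sigma> n - \<sigma>' n)"
      using that by (intro hcauchy_diff) (simp_all add: represents_def)
    show "(\<lambda>n. (\<sigma> n - \<sigma>' n) p) \<longlonglongrightarrow> 0" for p
      using that tendsto_diff[of "\<lambda>n. \<sigma> n p" "f p" _ "\<lambda>n. \<sigma>' n p" "f p"] by (simp add: represents_def)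
  qed
  have "(\<lambda>n. cinner P (\<sigma> n - \<sigma>' n) (\<tau> n)) \<longlonglongrightarrow> 0"
    using tendsto_cinner_zero(1)[OF _ _ null[OF assms(1) rep(1)]] hcauchy_diff c by blast
  moreover have "(\<lambda>n. cinner P (\<sigma>' n) (\<tau> n - \<tau>' n)) \<longlonglongrightarrow> 0"
    using tendsto_cinner_zero(2)[OF _ _ null[OF assms(2) rep(2)]] hcauchy_diff c by blast
  ultimately have "(\<lambda>n. cinner P (\<sigma> n - \<sigma>' n) (\<tau> n) + cinner P (\<sigma>' n) (\<tau> n - \<tau>' n) + cinner P (\<sigma>' n) (\<tau>' n))
      \<longlonglongrightarrow> 0 + 0 + cinner completion f g"
    by (intro tendsto_add lim)
  moreover have "cinner P (\<sigma> n - \<sigma>' n) (\<tau> n) + cinner P (\<sigma>' n) (\<tau> n - \<tau>' n) + cinner P (\<sigma>' n) (\<tau>' n) =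
      cinner P (\<sigma> n) (\<tau> n)" for n
    using c by (simp add: cinner_diff_left cinner_diff_right hcauchyD)
  ultimately show ?thesis
    by simp
qed

lemma completion_hnorm: "represents \<sigma> f \<Longrightarrow> (\<lambda>n. hnorm P (\<sigma> n)) \<longlonglongrightarrow> hnorm completion f"
  unfolding hnorm_def by (intro tendsto_intros completion_cinner)

lemma represents_const: "f \<in> carrier P \<Longrightarrow> represents (\<lambda>n. f) f"
  by (simp add: represents_def hcauchy_const)

lemma represents_scaleC: "represents \<sigma> f \<Longrightarrow> represents (\<lambda>n. a *\<^sub>C \<sigma> n) (a *\<^sub>C f)"
  unfolding represents_def using hcauchy_linear(2)[of \<sigma> \<sigma> a]
  by (auto simp: scaleC_fun_def scaleC_complex_def intro!: tendsto_intros)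

lemma represents_linear:
  assumes "represents \<sigma> f" "represents \<tau> g"
  shows "represents (\<lambda>n. \<sigma> n + \<tau> n) (f + g)" "represents (\<lambda>n. \<sigma> n - \<tau> n) (f - g)"
  using assms unfolding represents_def by (auto intro!: hcauchy_linear hcauchy_diff tendsto_intros)

lemma completion_repr: "f \<in> carrier completion \<Longrightarrow> cinner completion f (\<kappa> p) = f p"
proof -
  assume "f \<in> carrier completion"
  then obtain \<sigma> where \<sigma>: "represents \<sigma> f"
    by (auto simp: completion_carrier)
  have "(\<lambda>n. cinner P (\<sigma> n) (\<kappa> p)) \<longlonglongrightarrow> cinner completion f (\<kappa> p)"
    by (rule completion_cinner[OF \<sigma> represents_const[OF kernel_carrier]])
  moreover have "cinner P (\<sigma> n) (\<kappa> p) = \<sigma> n p" for n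
    using \<sigma> by (simp add: repr hcauchyD represents_def)
  ultimately have "(\<lambda>n. \<sigma> n p) \<longlonglongrightarrow> cinner completion f (\<kappa> p)"
    by simp
  then show ?thesis
    using \<sigma> LIMSEQ_unique unfolding represents_def by blast
qed

lemma completion_inner_product_space: "complex_inner_product_space completion"
proof
  show "csubspace (carrier completion)"
    using represents_const[OF carrier_closed(1)] represents_linear(1) represents_scaleC
    by (intro complex_vector.subspaceI) (auto simp: completion_carrier; blast)+
  fix x y z a
  show "cinner completion (x + y) z = cinner completion x z + cinner completion y z"
    if "x \<in> carrier completion" "y \<in> carrier completion" "z \<in> carrier completion"
  proof -
    obtain \<sigma> \<tau> \<rho> where r: "represents \<sigma> x" "represents \<tau> y" "represents \<rho> z"
      using \<open>x \<in> _\<close> \<open>y \<in> _\<close> \<open>z \<in> _\<close> by (auto simp: completion_carrier)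
    have "(\<lambda>n. cinner P (\<sigma> n + \<tau> n) (\<rho> n)) \<longlonglongrightarrow> cinner completion (x + y) z"
      by (intro completion_cinner represents_linear r)
    moreover have "cinner P (\<sigma> n + \<tau> n) (\<rho> n) = cinner P (\<sigma> n) (\<rho> n) + cinner P (\<tau> n) (\<rho> n)" for n
      using r by (simp add: cinner_add_left represents_def hcauchyD)
    ultimately show ?thesis
      using LIMSEQ_unique tendsto_add[OF completion_cinner[OF r(1,3)] completion_cinner[OF r(2,3)]] by simp
  qed
  show "cinner completion (a *\<^sub>C x) z = a * cinner completion x z"
    if "x \<in> carrier completion" "z \<in> carrier completion"
  proof -
    obtain \<sigma> \<rho> where r: "represents \<sigma> x" "represents \<rho> z"
      using \<open>x \<in> _\<close> \<open>z \<in> _\<close> by (auto simp: completion_carrier)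
    have "(\<lambda>n. cinner P (a *\<^sub>C \<sigma> n) (\<rho> n)) \<longlonglongrightarrow> cinner completion (a *\<^sub>C x) z"
      by (intro completion_cinner represents_scaleC r)
    moreover have "cinner P (a *\<^sub>C \<sigma> n) (\<rho> n) = a * cinner P (\<sigma> n) (\<rho> n)" for n
      using r by (simp add: cinner_scaleC_left represents_def hcauchyD)
    ultimately show ?thesis
      using LIMSEQ_unique tendsto_mult_left[OF completion_cinner[OF r], of a] by simp
  qed
  show "cinner completion y x = cnj (cinner completion x y)"
    if "x \<in> carrier completion" "y \<in> carrier completion"
  proof -
    obtain \<sigma> \<tau> where r: "represents \<sigma> x" "represents \<tau> y"
      using \<open>x \<in> _\<close> \<open>y \<in> _\<close> by (auto simp: completion_carrier)
    have "(\<lambda>n. cnj (cinner P (\<sigma> n) (\<tau> n))) \<longlonglongrightarrow> cnj (cinner completion x y)"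
      by (intro tendsto_cnj completion_cinner r)
    moreover have "cnj (cinner P (\<sigma> n) (\<tau> n)) = cinner P (\<tau> n) (\<sigma> n)" for n
      using r cinner_commute[of "\<sigma> n" "\<tau> n"] by (simp add: represents_def hcauchyD)
    ultimately show ?thesis
      using LIMSEQ_unique completion_cinner[OF r(2,1)] by simp
  qed
  assume "x \<in> carrier completion"
  then obtain \<sigma> where r: "represents \<sigma> x"
    by (auto simp: completion_carrier)
  then have car: "\<sigma> n \<in> carrier P" for n
    by (simp add: represents_def hcauchyD)
  show "0 \<le> Re (cinner completion x x)"
    using tendsto_Re[OF completion_cinner[OF r r]] cinner_ge_zero[OF car]
    by (intro LIMSEQ_le_const) auto
  assume "cinner completion x x = 0"
  then have "hnorm completion x = 0"
    by (simp add: hnorm_def)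
  then have null: "(\<lambda>n. hnorm P (\<sigma> n)) \<longlonglongrightarrow> 0"
    using completion_hnorm[OF r] by simp
  show "x = 0"
  proof
    fix p
    have "(\<lambda>n. cinner P (\<sigma> n) (\<kappa> p)) \<longlonglongrightarrow> 0"
      using r null by (intro tendsto_cinner_zero hcauchy_const kernel_carrier) (auto simp: represents_def)
    then have "(\<lambda>n. \<sigma> n p) \<longlonglongrightarrow> 0"
      by (simp add: repr car)
    then show "x p = 0 p"
      using r LIMSEQ_unique unfolding represents_def by fastforce
  qed
qed

text \<open>
  A Cauchy sequence in the completion is replaced by elements of the span at distance less than
  \<open>1 / (n + 1)\<close>; these form a Cauchy sequence of the span and so represent the limit themselves.
\<close>

lemma completion_hilbert: "complex_hilbert_space completion"
proof -
  interpret K: complex_inner_product_space completion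
    by (rule completion_inner_product_space)
  have P_sub: "f \<in> carrier completion" if "f \<in> carrier P" for f
    using represents_const[OF that] by (auto simp: completion_carrier)
  have norm_eq: "hnorm completion f = hnorm P f" if "f \<in> carrier P" for f
    using completion_hnorm[OF represents_const[OF that]] by (simp add: LIMSEQ_const_iff)
  have tail: "hnorm completion (f - \<sigma> N) \<le> \<epsilon>"
    if "represents \<sigma> f" "\<And>n. n \<ge> N \<Longrightarrow> hnorm P (\<sigma> n - \<sigma> N) \<le> \<epsilon>" for f \<sigma> N \<epsilon>
  proof -
    have "represents (\<lambda>n. \<sigma> n - \<sigma> N) (f - \<sigma> N)"
      using that(1) by (intro represents_linear represents_const) (auto simp: represents_def hcauchyD)
    then show ?thesis
      using that(2) by (intro LIMSEQ_le_const2[OF completion_hnorm]) auto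
  qed
  have approx: "\<exists>g\<in>carrier P. hnorm completion (f - g) < \<epsilon>" if f: "f \<in> carrier completion" and "0 < \<epsilon>" for f \<epsilon>
  proof -
    obtain \<sigma> where \<sigma>: "represents \<sigma> f"
      using f by (auto simp: completion_carrier)
    obtain N where N: "\<forall>m\<ge>N. \<forall>n\<ge>N. hnorm P (\<sigma> m - \<sigma> n) < \<epsilon> / 2"
      using \<sigma> \<open>0 < \<epsilon>\<close> unfolding represents_def hcauchy_def by (meson half_gt_zero)
    then have "hnorm completion (f - \<sigma> N) \<le> \<epsilon> / 2"
      by (intro tail[OF \<sigma>]) (simp add: less_imp_le)
    then show ?thesis
      using \<sigma> \<open>0 < \<epsilon>\<close> by (intro bexI[of _ "\<sigma> N"]) (auto simp: represents_def hcauchyD)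
  qed
  show ?thesis
  proof (rule K.complex_hilbert_spaceI)
    fix f assume f: "hcauchy completion f"
    then have fc: "f n \<in> carrier completion" for n
      by (auto simp: hcauchy_def)
    have "\<exists>g\<in>carrier P. hnorm completion (f n - g) < inverse (real (Suc n))" for n
      using approx[OF fc] by simp
    then obtain g where g: "\<And>n. g n \<in> carrier P" "\<And>n. hnorm completion (f n - g n) < inverse (real (Suc n))"
      by metis
    have g_le: "hnorm P (g m - g n) \<le> inverse (real (Suc m)) + hnorm completion (f m - f n) + inverse (real (Suc n))" for m n
    proof -
      note c = P_sub[OF g(1)[of m]] P_sub[OF g(1)[of n]] fc[of m] fc[of n]
      have "hnorm P (g m - g n) = hnorm completion (g m - g n)"
        using norm_eq[OF carrier_closed(3)[OF g(1) g(1)]] by simp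
      moreover have "hnorm completion (g m - g n) \<le> hnorm completion (g m - f m) + hnorm completion (f m - g n)"
        using c by (intro K.hnorm_triangle_diff)
      moreover have "hnorm completion (f m - g n) \<le> hnorm completion (f m - f n) + hnorm completion (f n - g n)"
        using c by (intro K.hnorm_triangle_diff)
      moreover have "hnorm completion (g m - f m) = hnorm completion (f m - g m)"
        using c by (intro K.hnorm_minus_commute)
      ultimately show ?thesis
        using g(2)[of m] g(2)[of n] by linarith
    qed
    have gc: "hcauchy P g"
      unfolding hcauchy_def
    proof (intro conjI allI impI)
      fix \<epsilon> :: real assume \<epsilon>: "0 < \<epsilon>"
      obtain N where N: "\<forall>m\<ge>N. \<forall>n\<ge>N. hnorm completion (f m - f n) < \<epsilon> / 3"
        using f \<epsilon> unfolding hcauchy_def by (meson zero_less_divide_iff zero_less_numeral)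
      obtain N' where N': "\<And>n. n \<ge> N' \<Longrightarrow> inverse (real (Suc n)) < \<epsilon> / 3"
        using LIMSEQ_D[OF LIMSEQ_inverse_real_of_nat, of "\<epsilon> / 3"] \<epsilon> by auto
      have "hnorm P (g m - g n) < \<epsilon>" if "m \<ge> max N N'" "n \<ge> max N N'" for m n
      proof -
        have "inverse (real (Suc m)) < \<epsilon> / 3" "inverse (real (Suc n)) < \<epsilon> / 3"
          "hnorm completion (f m - f n) < \<epsilon> / 3"
          using N N' that by auto
        then show ?thesis
          using g_le[of m n] by simp
      qed
      then show "\<exists>N. \<forall>m\<ge>N. \<forall>n\<ge>N. hnorm P (g m - g n) < \<epsilon>"
        by blast
    qed (use g in auto)
    have "convergent (\<lambda>n. g n p)" for p
      using convergent_cinner[OF gc hcauchy_const[OF kernel_carrier[of p]]] g by (simp add: repr)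
    then obtain h where h: "\<And>p. (\<lambda>n. g n p) \<longlonglongrightarrow> h p"
      unfolding convergent_def by metis
    have rep: "represents g h"
      using gc h by (simp add: represents_def)
    have hc: "h \<in> carrier completion"
      using rep by (auto simp: completion_carrier)
    have g_lim: "(\<lambda>n. hnorm completion (h - g n)) \<longlonglongrightarrow> 0"
    proof (rule LIMSEQ_I)
      fix r :: real assume "0 < r"
      then obtain N where N: "\<forall>m\<ge>N. \<forall>n\<ge>N. hnorm P (g m - g n) < r / 2"
        using gc unfolding hcauchy_def by (meson half_gt_zero)
      have "hnorm completion (h - g n) \<le> r / 2" if "n \<ge> N" for n
        using N that by (intro tail[OF rep]) (simp add: less_imp_le)
      then have "norm (hnorm completion (h - g n) - 0) < r" if "n \<ge> N" for n
        using that \<open>0 < r\<close> K.hnorm_nonneg[of "h - g n"] hc P_sub[OF g(1)[of n]]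
        by (fastforce simp: K.carrier_closed)
      then show "\<exists>n0. \<forall>n\<ge>n0. norm (hnorm completion (h - g n) - 0) < r"
        by blast
    qed
    have "hlim completion f h"
    proof (rule K.hlim_if_bounded)
      show "hnorm completion (f n - h) \<le> inverse (real (Suc n)) + hnorm completion (h - g n)" for n
        using K.hnorm_triangle_diff[of "f n" "g n" h] K.hnorm_minus_commute[of h "g n"] g[of n] fc[of n] hc
          P_sub[of "g n"] by simp
      show "(\<lambda>n. inverse (real (Suc n)) + hnorm completion (h - g n)) \<longlonglongrightarrow> 0"
        using tendsto_add[OF LIMSEQ_inverse_real_of_nat g_lim] by simp
    qed (use fc hc in auto)
    then show "\<exists>l. hlim completion f l"
      by blast
  qed
qed

end

text \<open>
  The Moore--Aronszajn theorem. Since the elements are functions on the index set, the Hilbert space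
  lives on the type \<open>'e \<Rightarrow> complex\<close>.
\<close>

theorem reproducing_kernel_hilbert_space:
  fixes \<kappa> :: "'e \<Rightarrow> 'e \<Rightarrow> complex"
  assumes "positive_kernel \<kappa>"
  obtains K where "complex_hilbert_space K" "\<And>p. \<kappa> p \<in> carrier K"
    "\<And>f p. f \<in> carrier K \<Longrightarrow> cinner K f (\<kappa> p) = f p"
proof -
  let ?P = "\<lparr>carrier = cspan (range \<kappa>), cinner = kernel_inner \<kappa>\<rparr>"
  interpret P: kernel_span ?P \<kappa>
    using kernel_inner_space[OF assms] by (simp add: kernel_span_def kernel_span_axioms_def)
  show ?thesis
  proof (rule that[OF P.completion_hilbert])
    show "\<kappa> p \<in> carrier P.completion" for p
      using P.represents_const[OF P.kernel_carrier] by (auto simp: P.completion_carrier)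
  qed (rule P.completion_repr)
qed


section \<open>Bounded transforms on a reproducing kernel Hilbert space\<close>

locale kernel_space = complex_hilbert_space K
  for K :: "('e \<Rightarrow> complex) inner_product_structure" +
  fixes \<kappa> :: "'e \<Rightarrow> 'e \<Rightarrow> complex"
  assumes kernel_carrier: "\<kappa> p \<in> carrier K"
    and repr: "f \<in> carrier K \<Longrightarrow> cinner K f (\<kappa> p) = f p"
begin

lemma kernel_hermitian: "\<kappa> q p = cnj (\<kappa> p q)"
  using cinner_commute[of "\<kappa> p" "\<kappa> q"] by (simp add: kernel_carrier repr)

lemma span_subset: "cspan (range \<kappa>) \<subseteq> carrier K"
  using kernel_carrier subspace_carrier by (intro complex_vector.span_minimal) auto

lemma kernel_span_hdense: "hdense K (cspan (range \<kappa>))"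
proof (rule hdense_if_orthogonal_zero)
  fix y assume y: "y \<in> carrier K" and orth: "\<And>x. x \<in> cspan (range \<kappa>) \<Longrightarrow> cinner K x y = 0"
  show "y = 0"
  proof
    fix p
    have "cinner K (\<kappa> p) y = 0"
      by (intro orth complex_vector.span_base) simp
    then show "y p = 0 p"
      using y repr[OF y, of p] cinner_commute[OF kernel_carrier y, of p] by simp
  qed
qed (auto simp: span_subset)

text \<open>
  Composition with \<open>\<alpha>\<close> moves kernel functions along the adjoint index map \<open>\<alpha>'\<close>. This is why \<open>B\<close>, which is to
  send \<open>\<kappa> p\<close> to \<open>\<kappa> (\<beta> p)\<close>, is composition with \<open>\<beta>'\<close>.
\<close>

lemma shift_kernel:
  assumes "\<And>p q. \<kappa> (\<alpha> p) q = \<kappa> p (\<alpha>' q)"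
  shows "\<kappa> p \<circ> \<alpha>' = \<kappa> (\<alpha> p)" "\<kappa> p \<circ> \<alpha> = \<kappa> (\<alpha>' p)"
proof -
  show "\<kappa> p \<circ> \<alpha>' = \<kappa> (\<alpha> p)"
    by (simp add: fun_eq_iff assms)
  show "\<kappa> p \<circ> \<alpha> = \<kappa> (\<alpha>' p)"
  proof
    fix q
    show "(\<kappa> p \<circ> \<alpha>) q = \<kappa> (\<alpha>' p) q"
      using assms[of q p] kernel_hermitian[of "\<alpha> q" p] kernel_hermitian[of q "\<alpha>' p"]
      by simp
  qed
qed

lemma comp_linear:
  fixes f g :: "'e \<Rightarrow> complex"
  shows "(f + g) \<circ> \<alpha> = (f \<circ> \<alpha>) + (g \<circ> \<alpha>)" "(f - g) \<circ> \<alpha> = (f \<circ> \<alpha>) - (g \<circ> \<alpha>)" "(a *\<^sub>C f) \<circ> \<alpha> = a *\<^sub>C (f \<circ> \<alpha>)"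
  by (simp_all add: fun_eq_iff scaleC_fun_def)

lemma shift_span:
  assumes adj: "\<And>p q. \<kappa> (\<alpha> p) q = \<kappa> p (\<alpha>' q)" and f: "f \<in> cspan (range \<kappa>)"
  shows "f \<circ> \<alpha> \<in> cspan (range \<kappa>)"
  using f
proof (induction rule: complex_vector.span_induct_alt)
  case base
  have "(0 :: 'e \<Rightarrow> complex) \<circ> \<alpha> = 0"
    by (simp add: fun_eq_iff)
  then show ?case
    by (simp only: complex_vector.span_zero)
next
  case (step c x y)
  then obtain p where x: "x = \<kappa> p"
    by auto
  have "c *\<^sub>C \<kappa> (\<alpha>' p) + (y \<circ> \<alpha>) \<in> cspan (range \<kappa>)"
    using step(2) by (intro complex_vector.span_add complex_vector.span_scale complex_vector.span_base[of "\<kappa> _"] rangeI)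
  then show ?case
    by (simp only: comp_linear x shift_kernel(2)[OF adj])
qed

lemma shift_adjoint_span:
  assumes adj: "\<And>p q. \<kappa> (\<alpha> p) q = \<kappa> p (\<alpha>' q)"
    and f: "f \<in> cspan (range \<kappa>)" and g: "g \<in> cspan (range \<kappa>)"
  shows "cinner K (f \<circ> \<alpha>) g = cinner K f (g \<circ> \<alpha>')"
proof -
  have f_car: "f \<in> carrier K" "f \<circ> \<alpha> \<in> carrier K"
    using subsetD[OF span_subset f] subsetD[OF span_subset shift_span[OF adj f]] .
  have "g \<in> carrier K \<and> g \<circ> \<alpha>' \<in> carrier K \<and> cinner K (f \<circ> \<alpha>) g = cinner K f (g \<circ> \<alpha>')"
    using g
  proof (induction rule: complex_vector.span_induct_alt)
    case base
    have "(0 :: 'e \<Rightarrow> complex) \<circ> \<alpha>' = 0"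
      by (simp add: fun_eq_iff)
    then show ?case
      using f_car by (simp only: cinner_zero_right carrier_closed)
  next
    case (step c x y)
    then obtain p where x: "x = \<kappa> p"
      by auto
    have "cinner K (f \<circ> \<alpha>) (\<kappa> p) = cinner K f (\<kappa> (\<alpha> p))"
      using f_car by (simp add: repr)
    then show ?case
      unfolding x comp_linear shift_kernel(1)[OF adj]
      using f_car step(2) by (simp only: cinner_add_right cinner_scaleC_right carrier_closed kernel_carrier simp_thms)
  qed
  then show ?thesis
    by blast
qed

text \<open>
  Convergence in the space implies pointwise convergence, so the limit of \<open>\<sigma> n \<circ> \<alpha>\<close>, which exists by
  contractivity, can only be \<open>f \<circ> \<alpha>\<close>.
\<close>

lemma hlim_shift:
  assumes adj: "\<And>p q. \<kappa> (\<alpha> p) q = \<kappa> p (\<alpha>' q)"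
    and contractive: "\<And>f. f \<in> cspan (range \<kappa>) \<Longrightarrow> hnorm K (f \<circ> \<alpha>) \<le> hnorm K f"
    and \<sigma>: "range \<sigma> \<subseteq> cspan (range \<kappa>)" "hlim K \<sigma> f"
  shows "hlim K (\<lambda>n. \<sigma> n \<circ> \<alpha>) (f \<circ> \<alpha>)"
proof -
  have \<sigma>_span: "\<sigma> n \<in> cspan (range \<kappa>)" for n
    using \<sigma> by auto
  have car: "\<sigma> n \<in> carrier K" "\<sigma> n \<circ> \<alpha> \<in> carrier K" for n
    using \<sigma>_span shift_span[OF adj \<sigma>_span] span_subset by auto
  have "hcauchy K (\<lambda>n. \<sigma> n \<circ> \<alpha>)"
    unfolding hcauchy_def
  proof (intro conjI allI impI)
    fix \<epsilon> :: real assume "0 < \<epsilon>"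
    then obtain N where N: "\<forall>m\<ge>N. \<forall>n\<ge>N. hnorm K (\<sigma> m - \<sigma> n) < \<epsilon>"
      using hlim_imp_hcauchy[OF \<sigma>(2)] unfolding hcauchy_def by blast
    have "hnorm K ((\<sigma> m \<circ> \<alpha>) - (\<sigma> n \<circ> \<alpha>)) \<le> hnorm K (\<sigma> m - \<sigma> n)" for m n
      using contractive[of "\<sigma> m - \<sigma> n"] \<sigma>_span by (simp add: comp_linear complex_vector.span_diff)
    then show "\<exists>N. \<forall>m\<ge>N. \<forall>n\<ge>N. hnorm K ((\<sigma> m \<circ> \<alpha>) - (\<sigma> n \<circ> \<alpha>)) < \<epsilon>"
      using N by (meson le_less_trans)
  qed (use car in auto)
  then obtain g where g: "hlim K (\<lambda>n. \<sigma> n \<circ> \<alpha>) g"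
    by (rule hcauchy_imp_hlim)
  have pointwise: "(\<lambda>n. \<tau> n q) \<longlonglongrightarrow> h q" if "hlim K \<tau> h" for \<tau> h q
    using hlim_cinner[OF that hlim_const[OF kernel_carrier[of q]]] that by (simp add: repr hlimD)
  have "g q = f (\<alpha> q)" for q
    using pointwise[OF g, of q] pointwise[OF \<sigma>(2), of "\<alpha> q"] LIMSEQ_unique by auto
  then have "g = f \<circ> \<alpha>"
    by (simp add: fun_eq_iff)
  with g show ?thesis
    by simp
qed

text \<open>
  Index maps that satisfy the relations of a bounded transform on the kernel induce one on the whole
  space by composition. The algebraic relations hold for every element because evaluation at \<open>q\<close> is
  the inner product with \<open>\<kappa> q\<close>. Boundedness is automatic on the dense span of the kernel functions
  and is what carries the adjoint relations over to the completion.
\<close>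

lemma bounded_transform_shift:
  assumes C: "\<And>p q. \<kappa> (\<gamma> p) q = \<kappa> p (\<gamma> q)"
    and B: "\<And>p q. \<kappa> (\<beta> p) q = \<kappa> p (\<beta>' q)"
    and BC: "\<And>p. \<kappa> (\<beta> (\<gamma> p)) = \<kappa> (\<gamma> (\<beta> p))"
    and B'C: "\<And>p. \<kappa> (\<beta>' (\<gamma> p)) = \<kappa> (\<gamma> (\<beta>' p))"
    and B'B: "\<And>p. \<kappa> (\<beta>' (\<beta> p)) = \<kappa> (\<gamma> p) - \<kappa> (\<gamma> (\<gamma> p))"
    and BB': "\<And>p. \<kappa> (\<beta> (\<beta>' p)) = \<kappa> (\<gamma> p) - \<kappa> (\<gamma> (\<gamma> p))"
  shows "bounded_transform K (\<lambda>f. f \<circ> \<gamma>) (\<lambda>f. f \<circ> \<beta>') (\<lambda>f. f \<circ> \<beta>)"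
proof -
  let ?P = "cspan (range \<kappa>)"
  have B': "\<kappa> (\<beta>' p) q = \<kappa> p (\<beta> q)" for p q
    using shift_kernel(2)[OF B, of p] by (metis comp_apply)
  have rel: "(f \<circ> \<gamma>) \<circ> \<beta>' = (f \<circ> \<beta>') \<circ> \<gamma>" "(f \<circ> \<gamma>) \<circ> \<beta> = (f \<circ> \<beta>) \<circ> \<gamma>"
    "(f \<circ> \<beta>') \<circ> \<beta> = (f \<circ> \<gamma>) - ((f \<circ> \<gamma>) \<circ> \<gamma>)" "(f \<circ> \<beta>) \<circ> \<beta>' = (f \<circ> \<gamma>) - ((f \<circ> \<gamma>) \<circ> \<gamma>)"
    if f: "f \<in> carrier K" for f
  proof -
    have eval: "f q = cinner K f (\<kappa> q)" for q
      using repr[OF f] by simp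
    show "(f \<circ> \<gamma>) \<circ> \<beta>' = (f \<circ> \<beta>') \<circ> \<gamma>" "(f \<circ> \<gamma>) \<circ> \<beta> = (f \<circ> \<beta>) \<circ> \<gamma>"
      by (rule ext, simp, subst (1 2) eval, simp only: BC B'C)+
    show "(f \<circ> \<beta>') \<circ> \<beta> = (f \<circ> \<gamma>) - ((f \<circ> \<gamma>) \<circ> \<gamma>)" "(f \<circ> \<beta>) \<circ> \<beta>' = (f \<circ> \<gamma>) - ((f \<circ> \<gamma>) \<circ> \<gamma>)"
      by (rule ext, simp, subst (1 2 3) eval, simp only: B'B BB' cinner_diff_right kernel_carrier f)+
  qed
  interpret P: complex_inner_product_space "K\<lparr>carrier := ?P\<rparr>"
    using complex_inner_product_space_axioms span_subset
    by (intro complex_inner_product_space_subspace) auto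
  interpret P: bounded_transform "K\<lparr>carrier := ?P\<rparr>" "\<lambda>f. f \<circ> \<gamma>" "\<lambda>f. f \<circ> \<beta>'" "\<lambda>f. f \<circ> \<beta>"
  proof (unfold_locales, simp_all only: subspace_structure)
    fix f assume f: "f \<in> ?P"
    show "f \<circ> \<gamma> \<in> ?P" "f \<circ> \<beta>' \<in> ?P" "f \<circ> \<beta> \<in> ?P"
      using f by (auto intro: shift_span[OF C] shift_span[OF B] shift_span[OF B'])
    show "(f \<circ> \<gamma>) \<circ> \<beta>' = (f \<circ> \<beta>') \<circ> \<gamma>" "(f \<circ> \<gamma>) \<circ> \<beta> = (f \<circ> \<beta>) \<circ> \<gamma>"
      "(f \<circ> \<beta>') \<circ> \<beta> = (f \<circ> \<gamma>) - ((f \<circ> \<gamma>) \<circ> \<gamma>)" "(f \<circ> \<beta>) \<circ> \<beta>' = (f \<circ> \<gamma>) - ((f \<circ> \<gamma>) \<circ> \<gamma>)"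
      using f span_subset by (auto intro: rel)
    fix g assume g: "g \<in> ?P"
    show "cinner K (f \<circ> \<gamma>) g = cinner K f (g \<circ> \<gamma>)"
      by (rule shift_adjoint_span[OF C f g])
    show "cinner K (f \<circ> \<beta>') g = cinner K f (g \<circ> \<beta>)"
      by (rule shift_adjoint_span[OF B' f g])
  qed
  have contr: "hnorm K (f \<circ> \<gamma>) \<le> hnorm K f" "hnorm K (f \<circ> \<beta>') \<le> hnorm K f" "hnorm K (f \<circ> \<beta>) \<le> hnorm K f"
    if "f \<in> ?P" for f
    using P.C_contractive[of f] P.B_contractive[of f] P.B'_contractive[of f] that by simp_all
  show ?thesis
  proof
    fix f assume f: "f \<in> carrier K"
    obtain \<sigma> where \<sigma>: "range \<sigma> \<subseteq> ?P" "hlim K \<sigma> f"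
      using hdense_imp_hlim[OF kernel_span_hdense f] .
    note lim = hlim_shift[OF C contr(1) \<sigma>] hlim_shift[OF B' contr(2) \<sigma>] hlim_shift[OF B contr(3) \<sigma>]
    show "f \<circ> \<gamma> \<in> carrier K" "f \<circ> \<beta>' \<in> carrier K" "f \<circ> \<beta> \<in> carrier K"
      using lim by (auto dest: hlimD(2))
    show "(f \<circ> \<gamma>) \<circ> \<beta>' = (f \<circ> \<beta>') \<circ> \<gamma>" "(f \<circ> \<gamma>) \<circ> \<beta> = (f \<circ> \<beta>) \<circ> \<gamma>"
      "(f \<circ> \<beta>') \<circ> \<beta> = (f \<circ> \<gamma>) - ((f \<circ> \<gamma>) \<circ> \<gamma>)" "(f \<circ> \<beta>) \<circ> \<beta>' = (f \<circ> \<gamma>) - ((f \<circ> \<gamma>) \<circ> \<gamma>)"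
      using f by (auto intro: rel)
    fix g assume g: "g \<in> carrier K"
    obtain \<tau> where \<tau>: "range \<tau> \<subseteq> ?P" "hlim K \<tau> g"
      using hdense_imp_hlim[OF kernel_span_hdense g] .
    have \<sigma>\<tau>: "\<sigma> n \<in> ?P" "\<tau> n \<in> ?P" for n
      using \<sigma> \<tau> by auto
    have "(\<lambda>n. cinner K (\<sigma> n \<circ> \<gamma>) (\<tau> n)) \<longlonglongrightarrow> cinner K f (g \<circ> \<gamma>)"
      using hlim_cinner[OF \<sigma>(2) hlim_shift[OF C contr(1) \<tau>]] shift_adjoint_span[OF C \<sigma>\<tau>] by simp
    then show "cinner K (f \<circ> \<gamma>) g = cinner K f (g \<circ> \<gamma>)"
      using hlim_cinner[OF lim(1) \<tau>(2)] LIMSEQ_unique by blast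
    have "(\<lambda>n. cinner K (\<sigma> n \<circ> \<beta>') (\<tau> n)) \<longlonglongrightarrow> cinner K f (g \<circ> \<beta>)"
      using hlim_cinner[OF \<sigma>(2) hlim_shift[OF B contr(3) \<tau>]] shift_adjoint_span[OF B' \<sigma>\<tau>] by simp
    then show "cinner K (f \<circ> \<beta>') g = cinner K f (g \<circ> \<beta>)"
      using hlim_cinner[OF lim(2) \<tau>(2)] LIMSEQ_unique by blast
  qed
qed

end


section \<open>Removing the kernel of the transform\<close>

text \<open>
  In a limit, \<open>C\<close> may acquire a kernel: the part of the spectral mass that escapes to infinity. On
  that kernel \<open>B\<close> and \<open>B'\<close> vanish as well, because \<open>\<parallel>B g\<parallel>\<^sup>2 \<le> \<langle>g, C g\<rangle>\<close>. Hence its orthogonal complement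
  reduces the triple and contains every vector \<open>C u + B' v\<close>.
\<close>

lemma (in complex_hilbert_space) restrict_to_kernel_complement:
  assumes "bounded_transform H C B B'"
  defines "M \<equiv> {f \<in> carrier H. \<forall>g\<in>carrier H. C g = 0 \<longrightarrow> cinner H f g = 0}"
  shows "complex_hilbert_space (H\<lparr>carrier := M\<rparr>)"
    and "injective_bounded_transform (H\<lparr>carrier := M\<rparr>) C B B'"
    and "\<And>u v. u \<in> carrier H \<Longrightarrow> v \<in> carrier H \<Longrightarrow> C u + B' v \<in> M"
    and "\<And>\<sigma> l. range \<sigma> \<subseteq> M \<Longrightarrow> hlim H \<sigma> l \<Longrightarrow> l \<in> M"
proof -
  interpret bounded_transform H C B B'
    by fact
  have M_sub: "M \<subseteq> carrier H"
    by (auto simp: M_def)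
  have sub: "csubspace M"
    by (rule complex_vector.subspaceI)
      (auto simp: M_def carrier_closed cinner_zero_left cinner_add_left cinner_scaleC_left)
  show closed_M: "l \<in> M" if "range \<sigma> \<subseteq> M" "hlim H \<sigma> l" for \<sigma> l
  proof -
    have "cinner H l g = 0" if g: "g \<in> carrier H" "C g = 0" for g
    proof -
      have "cinner H (\<sigma> n) g = 0" for n
        using \<open>range \<sigma> \<subseteq> M\<close> g by (auto simp: M_def)
      then show ?thesis
        using hlim_cinner[OF \<open>hlim H \<sigma> l\<close> hlim_const[OF g(1)]] by (simp add: LIMSEQ_const_iff)
    qed
    then show ?thesis
      using \<open>hlim H \<sigma> l\<close> by (simp add: M_def hlimD)
  qed
  show "complex_hilbert_space (H\<lparr>carrier := M\<rparr>)"
    by (rule complex_hilbert_space_subspace[OF complex_hilbert_space_axioms sub M_sub closed_M])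
  show "C u + B' v \<in> M" if "u \<in> carrier H" "v \<in> carrier H" for u v
    using that B_zero_if_C_zero
    by (auto simp: M_def closed carrier_closed cinner_add_left C_self_adjoint B'_adjoint cinner_zero_right)
  interpret M: complex_inner_product_space "H\<lparr>carrier := M\<rparr>"
    using complex_inner_product_space_axioms sub M_sub by (rule complex_inner_product_space_subspace)
  show "injective_bounded_transform (H\<lparr>carrier := M\<rparr>) C B B'"
  proof (unfold_locales, simp_all only: subspace_structure)
    fix x assume x: "x \<in> M"
    then have xH: "x \<in> carrier H"
      using M_sub by auto
    show "C x \<in> M" "B x \<in> M" "B' x \<in> M"
      using x B_zero_if_C_zero B'_zero_if_C_zero
      by (auto simp: M_def closed C_self_adjoint B'_adjoint B_adjoint cinner_zero_right)
    show "B (C x) = C (B x)" "B' (C x) = C (B' x)" "B' (B x) = C x - C (C x)" "B (B' x) = C x - C (C x)"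
      using xH by (simp_all add: BC B'C B'B BB')
    show "x = 0" if "C x = 0"
      using x that cinner_eq_zero by (auto simp: M_def)
    fix y assume y: "y \<in> M"
    show "cinner H (C x) y = cinner H x (C y)" "cinner H (B x) y = cinner H x (B' y)"
      using xH y M_sub by (auto simp: C_self_adjoint B_adjoint)
  qed
qed


section \<open>Isometries from equal Gram matrices\<close>

instantiation prod :: (complex_vector, complex_vector) complex_vector
begin

definition scaleC_prod :: "complex \<Rightarrow> 'a \<times> 'b \<Rightarrow> 'a \<times> 'b" where
  "scaleC_prod a x = (a *\<^sub>C fst x, a *\<^sub>C snd x)"

instance
  by standard (simp_all add: scaleC_prod_def prod_eq_iff scaleC_add_right scaleC_add_left scaleC_scaleC scaleC_one)

end

text \<open>
  The graph of the isometry is the closure of the span of the pairs \<open>(a j, b j)\<close>. Working with pairs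
  avoids having to show that a linear relation among the \<open>a j\<close> also holds among the \<open>b j\<close>.
\<close>

lemma isometry_if_gram_eq:
  assumes H: "complex_inner_product_space H" and K: "complex_hilbert_space K"
    and a: "\<And>j. j \<in> J \<Longrightarrow> a j \<in> carrier H" and b: "\<And>j. j \<in> J \<Longrightarrow> b j \<in> carrier K"
    and gram: "\<And>i j. i \<in> J \<Longrightarrow> j \<in> J \<Longrightarrow> cinner H (a i) (a j) = cinner K (b i) (b j)"
    and dense: "hdense H (cspan (a ` J))"
  obtains V where "isometric_embedding H K V" "\<And>j. j \<in> J \<Longrightarrow> V (a j) = b j"
proof -
  interpret H: complex_inner_product_space H by fact
  interpret K: complex_hilbert_space K by fact
  define T where "T = cspan ((\<lambda>j. (a j, b j)) ` J)"
  have T_sub: "csubspace T"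
    unfolding T_def by (rule complex_vector.subspace_span)
  have T_base: "(a j, b j) \<in> T" if "j \<in> J" for j
    using that unfolding T_def by (intro complex_vector.span_base) auto
  have T_gram: "fst t \<in> carrier H \<and> snd t \<in> carrier K \<and> (\<forall>j\<in>J. cinner H (fst t) (a j) = cinner K (snd t) (b j))"
    if "t \<in> T" for t
    using that unfolding T_def
  proof (induction rule: complex_vector.span_induct_alt)
    case base
    show ?case
      by (simp add: H.carrier_closed K.carrier_closed H.cinner_zero_left K.cinner_zero_left a b)
  next
    case (step c x y)
    then show ?case
      using a b gram
      by (auto simp: scaleC_prod_def H.carrier_closed K.carrier_closed H.cinner_add_left K.cinner_add_left
          H.cinner_scaleC_left K.cinner_scaleC_left)
  qed
  then have T_car: "fst t \<in> carrier H" "snd t \<in> carrier K" if "t \<in> T" for t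
    using that by blast+
  have T_inner: "cinner H (fst t) (fst s) = cinner K (snd t) (snd s)" if t: "t \<in> T" and s: "s \<in> T" for t s
  proof -
    have "fst s \<in> carrier H \<and> snd s \<in> carrier K \<and> cinner H (fst t) (fst s) = cinner K (snd t) (snd s)"
      using s unfolding T_def
    proof (induction rule: complex_vector.span_induct_alt)
      case base
      show ?case
        using T_car[OF t] by (simp add: H.carrier_closed K.carrier_closed H.cinner_zero_right K.cinner_zero_right)
    next
      case (step c x y)
      then show ?case
        using T_gram[OF t] a b
        by (auto simp: scaleC_prod_def H.carrier_closed K.carrier_closed H.cinner_add_right K.cinner_add_right
            H.cinner_scaleC_right K.cinner_scaleC_right)
    qed
    then show ?thesis
      by blast
  qed
  have span_fst: "cspan (a ` J) \<subseteq> fst ` T"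
  proof (rule complex_vector.span_minimal)
    show "a ` J \<subseteq> fst ` T"
      using T_base by force
    show "csubspace (fst ` T)"
    proof (rule complex_vector.subspaceI)
      show "0 \<in> fst ` T"
        using complex_vector.subspace_0[OF T_sub] by force
      show "x + y \<in> fst ` T" if "x \<in> fst ` T" "y \<in> fst ` T" for x y
        using that complex_vector.subspace_add[OF T_sub] by (metis (no_types, lifting) fst_add imageE imageI)
      show "c *\<^sub>C x \<in> fst ` T" if "x \<in> fst ` T" for c x
        using that complex_vector.subspace_scale[OF T_sub, of _ c]
        by (force simp: scaleC_prod_def)
    qed
  qed
  define R where "R h k \<longleftrightarrow> (\<exists>t. range t \<subseteq> T \<and> hlim H (\<lambda>n. fst (t n)) h \<and> hlim K (\<lambda>n. snd (t n)) k)" for h k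
  have R_base: "R (fst t) (snd t)" if "t \<in> T" for t
    unfolding R_def using that T_car[OF that]
    by (intro exI[of _ "\<lambda>_. t"]) (auto intro: H.hlim_const K.hlim_const)
  have R_add: "R (h + h') (k + k')" if R: "R h k" "R h' k'" for h k h' k'
  proof -
    obtain t s where "range t \<subseteq> T" "hlim H (\<lambda>n. fst (t n)) h" "hlim K (\<lambda>n. snd (t n)) k"
      "range s \<subseteq> T" "hlim H (\<lambda>n. fst (s n)) h'" "hlim K (\<lambda>n. snd (s n)) k'"
      using R unfolding R_def by blast
    then show ?thesis
      unfolding R_def using H.hlim_add K.hlim_add complex_vector.subspace_add[OF T_sub]
      by (intro exI[of _ "\<lambda>n. t n + s n"]) (simp add: image_subset_iff)
  qed
  have R_scale: "R (c *\<^sub>C h) (c *\<^sub>C k)" if R: "R h k" for c h k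
  proof -
    obtain t where "range t \<subseteq> T" "hlim H (\<lambda>n. fst (t n)) h" "hlim K (\<lambda>n. snd (t n)) k"
      using R unfolding R_def by blast
    then show ?thesis
      unfolding R_def using H.hlim_scaleC[of _ h c] K.hlim_scaleC[of _ k c] complex_vector.subspace_scale[OF T_sub, of _ c]
      by (intro exI[of _ "\<lambda>n. c *\<^sub>C t n"]) (simp add: image_subset_iff, simp add: scaleC_prod_def)
  qed
  have R_inner: "cinner H h h' = cinner K k k'" if R: "R h k" "R h' k'" for h k h' k'
  proof -
    obtain t s where ts: "range t \<subseteq> T" "hlim H (\<lambda>n. fst (t n)) h" "hlim K (\<lambda>n. snd (t n)) k"
      "range s \<subseteq> T" "hlim H (\<lambda>n. fst (s n)) h'" "hlim K (\<lambda>n. snd (s n)) k'"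
      using R unfolding R_def by blast
    then have "cinner H (fst (t n)) (fst (s n)) = cinner K (snd (t n)) (snd (s n))" for n
      by (intro T_inner) auto
    then show ?thesis
      using H.hlim_cinner[OF ts(2,5)] K.hlim_cinner[OF ts(3,6)] LIMSEQ_unique by simp
  qed
  have R_car: "h \<in> carrier H" "k \<in> carrier K" if "R h k" for h k
    using that by (auto simp: R_def hlim_def)
  have R_unique: "k = k'" if "R h k" "R h k'" for h k k'
  proof -
    have "R 0 (k - k')"
      using R_add[OF that(1) R_scale[OF that(2), of "- 1"]] by (simp add: scaleC_one)
    then have "cinner K (k - k') (k - k') = 0"
      using R_inner[of 0 "k - k'" 0 "k - k'"] by (simp add: H.cinner_zero_left H.carrier_closed)
    then show ?thesis
      using K.cinner_eq_zero[of "k - k'"] R_car that by (simp add: K.carrier_closed)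
  qed
  have R_ex: "\<exists>k. R h k" if h: "h \<in> carrier H" for h
  proof -
    obtain \<sigma> where \<sigma>: "range \<sigma> \<subseteq> cspan (a ` J)" "hlim H \<sigma> h"
      using H.hdense_imp_hlim[OF dense h] .
    then have "\<forall>n. \<exists>t\<in>T. fst t = \<sigma> n"
      using span_fst by (auto simp: image_subset_iff) (metis imageE subsetD)
    then obtain t where t: "\<And>n. t n \<in> T" "\<And>n. fst (t n) = \<sigma> n"
      by metis
    have "hcauchy K (\<lambda>n. snd (t n))"
      unfolding hcauchy_def
    proof (intro conjI allI impI)
      fix \<epsilon> :: real assume "0 < \<epsilon>"
      then obtain N where N: "\<forall>m\<ge>N. \<forall>n\<ge>N. hnorm H (\<sigma> m - \<sigma> n) < \<epsilon>"
        using H.hlim_imp_hcauchy[OF \<sigma>(2)] unfolding hcauchy_def by blast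
      have "hnorm K (snd (t m) - snd (t n)) = hnorm H (\<sigma> m - \<sigma> n)" for m n
        using T_inner[of "t m - t n" "t m - t n"] complex_vector.subspace_diff[OF T_sub t(1) t(1), of m n]
        by (simp add: hnorm_def t(2))
      then show "\<exists>N. \<forall>m\<ge>N. \<forall>n\<ge>N. hnorm K (snd (t m) - snd (t n)) < \<epsilon>"
        using N by auto
    qed (use T_car(2)[OF t(1)] in auto)
    then obtain k where "hlim K (\<lambda>n. snd (t n)) k"
      by (rule K.hcauchy_imp_hlim)
    then show ?thesis
      unfolding R_def using t \<sigma> by (intro exI[of _ k] exI[of _ t]) auto
  qed
  define V where "V h = (THE k. R h k)" for h
  have V_eq: "V h = k" if "R h k" for h k
    unfolding V_def using that R_unique by blast
  have RV: "R h (V h)" if "h \<in> carrier H" for h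
    using R_ex[OF that] V_eq by auto
  show ?thesis
  proof (rule that)
    show "isometric_embedding H K V"
      unfolding isometric_embedding_def
      using RV R_car R_add R_scale R_inner V_eq by (auto; metis)
    show "V (a j) = b j" if "j \<in> J" for j
      using V_eq[OF R_base[OF T_base[OF that]]] by simp
  qed
qed


section \<open>Simultaneous limits along a finer filter\<close>

text \<open>
  By Tychonoff's theorem the functions \<open>\<phi> i\<close> have a cluster point for the topology of pointwise
  convergence; the filter \<open>G\<close> is the trace of its neighbourhoods on \<open>F\<close>. Eventual bounds, which may
  depend on \<open>c\<close>, suffice because truncation does not affect limits.
\<close>

lemma finer_filter_with_limits:
  fixes \<phi> :: "'i \<Rightarrow> 'c \<Rightarrow> complex"
  assumes F: "F \<noteq> bot" and bounded: "\<And>c. \<exists>M. \<forall>\<^sub>F i in F. cmod (\<phi> i c) \<le> M"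
  obtains G where "G \<noteq> bot" "G \<le> F" "\<And>c. \<exists>l. ((\<lambda>i. \<phi> i c) \<longlongrightarrow> l) G"
proof -
  obtain M where M: "\<And>c. \<forall>\<^sub>F i in F. cmod (\<phi> i c) \<le> M c"
    using bounded by metis
  \<comment> \<open>Truncation makes the bounds hold for every index, so that all values lie in one compact product.\<close>
  define \<psi> where "\<psi> i c = (if cmod (\<phi> i c) \<le> M c then \<phi> i c else 0)" for i c
  define D where "D = (\<Pi>\<^sub>E c\<in>UNIV. cball (0 :: complex) \<bar>M c\<bar>)"
  have "compactin (product_topology (\<lambda>_. euclidean) UNIV) D"
    unfolding D_def by (subst compactin_PiE) auto
  then have "compact D"
    by (simp add: euclidean_product_topology)
  moreover have "\<psi> i \<in> D" for i
    by (auto simp: D_def \<psi>_def)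
  then have "\<forall>\<^sub>F y in filtermap \<psi> F. y \<in> D"
    by (simp add: eventually_filtermap)
  moreover have "filtermap \<psi> F \<noteq> bot"
    using F by (simp add: filtermap_bot_iff)
  ultimately obtain x where x: "inf (nhds x) (filtermap \<psi> F) \<noteq> bot"
    unfolding compact_filter by blast
  define G where "G = inf F (filtercomap \<psi> (nhds x))"
  have "G \<noteq> bot"
  proof
    assume "G = bot"
    then have "eventually (\<lambda>_. False) G"
      by simp
    then obtain Q R where Q: "eventually Q F" and R: "eventually R (filtercomap \<psi> (nhds x))"
      and QR: "\<And>i. Q i \<Longrightarrow> R i \<Longrightarrow> False"
      unfolding G_def eventually_inf by blast
    obtain S where S: "eventually S (nhds x)" "\<And>i. S (\<psi> i) \<Longrightarrow> R i"
      using R by (auto simp: eventually_filtercomap)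
    have "eventually (\<lambda>y. \<not> S y) (filtermap \<psi> F)"
      unfolding eventually_filtermap using Q by eventually_elim (use S QR in blast)
    then have "eventually (\<lambda>_. False) (inf (nhds x) (filtermap \<psi> F))"
      unfolding eventually_inf using S(1) by blast
    then show False
      using x by (simp add: eventually_False)
  qed
  moreover have "G \<le> F"
    by (simp add: G_def)
  moreover have "\<exists>l. ((\<lambda>i. \<phi> i c) \<longlongrightarrow> l) G" for c
  proof -
    have lim: "filterlim \<psi> (nhds x) G"
      unfolding G_def by (rule filterlim_mono[OF filterlim_filtercomap order_refl]) simp
    have "((\<lambda>i. \<psi> i c) \<longlongrightarrow> x c) G"
    proof (rule topological_tendstoI)
      fix U :: "complex set" assume "open U" "x c \<in> U"
      then have "open ((\<lambda>y. y c) -` U)"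
        by (intro open_vimage continuous_on_product_coordinates)
      then have "\<forall>\<^sub>F y in nhds x. y c \<in> U"
        using \<open>x c \<in> U\<close> unfolding eventually_nhds by (intro exI[of _ "(\<lambda>y. y c) -` U"]) auto
      then show "\<forall>\<^sub>F i in G. \<psi> i c \<in> U"
        using lim unfolding filterlim_iff by fast
    qed
    moreover have "\<forall>\<^sub>F i in G. \<psi> i c = \<phi> i c"
      using filter_leD[OF \<open>G \<le> F\<close> M[of c]] by eventually_elim (simp add: \<psi>_def)
    ultimately have "((\<lambda>i. \<phi> i c) \<longlongrightarrow> x c) G"
      by (rule Lim_transform_eventually)
    then show ?thesis ..
  qed
  ultimately show ?thesis
    by (rule that)
qed


section \<open>Subnormality through bounded transforms\<close>

lemma isometric_embeddingD:
  assumes "isometric_embedding H K V"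
  shows "x \<in> carrier H \<Longrightarrow> V x \<in> carrier K"
    and "x \<in> carrier H \<Longrightarrow> y \<in> carrier H \<Longrightarrow> V (x + y) = V x + V y"
    and "x \<in> carrier H \<Longrightarrow> V (a *\<^sub>C x) = a *\<^sub>C V x"
    and "x \<in> carrier H \<Longrightarrow> y \<in> carrier H \<Longrightarrow> cinner K (V x) (V y) = cinner H x y"
  using assms by (auto simp: isometric_embedding_def)

lemma isometric_embedding_hnorm:
  assumes "isometric_embedding H K V" "x \<in> carrier H"
  shows "hnorm K (V x) = hnorm H x"
  using isometric_embeddingD(4)[OF assms(1,2,2)] by (simp add: hnorm_def)

lemma isometric_embedding_diff:
  assumes "complex_inner_product_space H" "isometric_embedding H K V" "x \<in> carrier H" "y \<in> carrier H"
  shows "V (x - y) = V x - V y"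
proof -
  interpret complex_inner_product_space H by fact
  have "V (x - y + y) = V (x - y) + V y"
    using assms by (intro isometric_embeddingD(2)[OF assms(2)] carrier_closed)
  then show ?thesis
    by simp
qed

lemma subnormal_imp_bounded_transform:
  fixes H :: "('a :: complex_vector) inner_product_structure"
  assumes "subnormal_in TYPE('k :: complex_vector) H S"
  shows "\<exists>(K :: 'k inner_product_structure) V C B B'.
    injective_bounded_transform K C B B' \<and> isometric_embedding H K V \<and>
    (\<forall>h\<in>dom S. C (V (the (S h))) = B (V h))"
proof -
  obtain K :: "'k inner_product_structure" and V N where
    K: "complex_hilbert_space K" "isometric_embedding H K V" "normal_operator K N"
    "\<forall>h\<in>dom S. N (V h) = Some (V (the (S h)))"
    using assms by (auto simp: subnormal_in_def)
  interpret complex_hilbert_space K by fact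
  obtain C B B' where "injective_bounded_transform K C B B'" "\<And>u v. N u = Some v \<Longrightarrow> C v = B u"
    using normal_operator_bounded_transform[OF K(3)] by metis
  with K show ?thesis
    by blast
qed

context complex_inner_product_space
begin

lemma core_hdense:
  assumes "densely_defined H S" "linear_operator H S" "is_core H S E"
  shows "hdense H E"
  unfolding hdense_def
proof (intro conjI ballI allI impI)
  show "E \<subseteq> carrier H"
    using assms by (auto simp: is_core_def linear_operator_def)
  fix x and \<epsilon> :: real assume x: "x \<in> carrier H" and "0 < \<epsilon>"
  have "hdense H (dom S)"
    using assms densely_defined_iff_hdense by (simp add: linear_operator_def)
  then obtain y where y: "y \<in> dom S" "hnorm H (x - y) < \<epsilon> / 2"
    using x \<open>0 < \<epsilon>\<close> unfolding hdense_def by (meson half_gt_zero)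
  then obtain z where "S y = Some z"
    by auto
  then have "(y, z) \<in> prod_topology (htopology H) (htopology H) closure_of Map.graph (S |` E)"
    using assms(3) by (auto simp: is_core_def Map.graph_def)
  then obtain a b where ab: "(a, b) \<in> Map.graph (S |` E)" "a \<in> carrier H" "hnorm H (y - a) < \<epsilon> / 2" "y \<in> carrier H"
    unfolding prod_closure_of_iff using \<open>0 < \<epsilon>\<close> half_gt_zero by blast
  then have "a \<in> E"
    by (auto simp: Map.graph_def restrict_map_def split: if_splits)
  moreover have "hnorm H (x - a) < \<epsilon>"
    using hnorm_triangle_diff[OF x ab(4,2)] y ab by simp
  ultimately show "\<exists>y\<in>E. hnorm H (x - y) < \<epsilon>"
    by blast
qed

text \<open>An isometry maps approximations in the graph norm to such approximations, and \<open>N\<close> is closed.\<close>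

lemma extension_from_core:
  assumes core: "is_core H S E"
    and K: "complex_inner_product_space K" "isometric_embedding H K V"
    and N: "closed_operator K N" "Map.graph N \<subseteq> carrier K \<times> carrier K"
    and ext: "\<And>h. h \<in> E \<Longrightarrow> N (V h) = Some (V (the (S h)))"
    and h: "h \<in> dom S"
  shows "N (V h) = Some (V (the (S h)))"
proof -
  interpret K: complex_inner_product_space K by fact
  note V = isometric_embeddingD[OF K(2)]
  obtain y where y: "S h = Some y"
    using h by auto
  then have hy: "(h, y) \<in> prod_topology (htopology H) (htopology H) closure_of Map.graph (S |` E)"
    using core by (auto simp: is_core_def Map.graph_def)
  then have car: "h \<in> carrier H" "y \<in> carrier H"
    unfolding prod_closure_of_iff by auto
  have "\<exists>(a, b)\<in>Map.graph N. hnorm K (V h - a) < \<epsilon> \<and> hnorm K (V y - b) < \<epsilon>" if "\<epsilon> > 0" for \<epsilon>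
  proof -
    obtain a b where ab: "(a, b) \<in> Map.graph (S |` E)" "a \<in> carrier H" "b \<in> carrier H"
      "hnorm H (h - a) < \<epsilon>" "hnorm H (y - b) < \<epsilon>"
      using hy \<open>\<epsilon> > 0\<close> unfolding prod_closure_of_iff by blast
    have "N (V a) = Some (V b)"
      using ab(1) ext[of a] by (auto simp: Map.graph_def restrict_map_def split: if_splits)
    moreover have "hnorm K (V h - V a) = hnorm H (h - a)" "hnorm K (V y - V b) = hnorm H (y - b)"
      using isometric_embedding_hnorm[OF K(2)] isometric_embedding_diff[OF _ K(2)]
        complex_inner_product_space_axioms ab car by (metis carrier_closed(3))+
    ultimately show ?thesis
      using ab by (intro bexI[of _ "(V a, V b)"]) (auto simp: Map.graph_def)
  qed
  then have "N (V h) = Some (V y)"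
    using N car V(1) K.closed_operator_iff[OF N(2)] by blast
  with y show ?thesis
    by simp
qed

lemma op_power_Suc_apply:
  assumes "x \<in> dom_infinity H A"
  shows "A (the (op_power H A n x)) = Some (the (op_power H A (Suc n) x))"
proof -
  have "x \<in> dom (op_power H A (Suc n))"
    using assms by (auto simp: dom_infinity_def simp del: op_power.simps)
  then obtain z where "op_power H A (Suc n) x = Some z"
    by blast
  then show ?thesis
    by (auto simp: map_comp_Some_iff)
qed

lemma op_power_carrier:
  assumes "linear_operator H A" "x \<in> carrier H" "x \<in> dom_infinity H A"
  shows "the (op_power H A n x) \<in> carrier H"
proof (cases n)
  case 0
  then show ?thesis
    using assms by simp
next
  case (Suc m)
  then show ?thesis
    using op_power_Suc_apply[OF assms(3), of m] linear_operatorD(2)[OF assms(1)] by metis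
qed

end


section \<open>The limit kernel\<close>

text \<open>
  Words are free: the commutation relations are not built into them but hold in the limit kernel as they
  hold at every \<open>\<omega>\<close>. There are only countably many pairs of a power \<open>n\<close> and a word, so that a natural
  number encodes both, and the limit space fits into the functions on pairs of a vector and a natural
  number.
\<close>

datatype letter = Letter_C | Letter_B | Letter_B'

instance letter :: countable
  by countable_datatype

primrec letter_op :: "('k \<Rightarrow> 'k) \<Rightarrow> ('k \<Rightarrow> 'k) \<Rightarrow> ('k \<Rightarrow> 'k) \<Rightarrow> letter \<Rightarrow> 'k \<Rightarrow> 'k" where
  "letter_op C B B' Letter_C = C"
| "letter_op C B B' Letter_B = B"
| "letter_op C B B' Letter_B' = B'"

primrec word_op :: "('k \<Rightarrow> 'k) \<Rightarrow> ('k \<Rightarrow> 'k) \<Rightarrow> ('k \<Rightarrow> 'k) \<Rightarrow> letter list \<Rightarrow> 'k \<Rightarrow> 'k" where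
  "word_op C B B' [] x = x"
| "word_op C B B' (l # w) x = letter_op C B B' l (word_op C B B' w x)"

context bounded_transform
begin

lemma letter_op_carrier: "x \<in> carrier K \<Longrightarrow> letter_op C B B' l x \<in> carrier K"
  by (cases l) (simp_all add: closed)

lemma letter_op_contractive: "x \<in> carrier K \<Longrightarrow> hnorm K (letter_op C B B' l x) \<le> hnorm K x"
  by (cases l) (simp_all add: C_contractive B_contractive B'_contractive)

lemma letter_op_zero: "letter_op C B B' l 0 = 0"
  by (cases l) (simp_all add: C_zero B_zero B'_zero)

lemma word_op_carrier: "x \<in> carrier K \<Longrightarrow> word_op C B B' w x \<in> carrier K"
  by (induction w) (simp_all add: letter_op_carrier)

lemma word_op_contractive: "x \<in> carrier K \<Longrightarrow> hnorm K (word_op C B B' w x) \<le> hnorm K x"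
proof (induction w)
  case (Cons l w)
  then show ?case
    using letter_op_contractive[OF word_op_carrier, of x l w] by simp
qed simp

end

definition index :: "'a \<Rightarrow> nat \<Rightarrow> letter list \<Rightarrow> 'a \<times> nat" where
  "index x n w = (x, to_nat (n, w))"

definition shift :: "letter \<Rightarrow> 'a \<times> nat \<Rightarrow> 'a \<times> nat" where
  "shift l e = (case from_nat (snd e) of (n, w) \<Rightarrow> index (fst e) n (l # w))"

lemma shift_index: "shift l (index x n w) = index x n (l # w)"
  by (simp add: shift_def index_def)

text \<open>
  Positivity, linear relations between the vectors and adjoint relations between the operators are
  statements about the Gram matrices of the vectors \<open>f e \<omega>\<close>, and so they pass to the limit \<open>\<kappa>\<close>. The index
  maps \<open>\<gamma>\<close>, \<open>\<beta>\<close>, \<open>\<beta>'\<close> model the three operators uniformly in \<open>\<omega>\<close>.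
\<close>

locale limit_kernel =
  fixes \<Omega> :: "'i set" and G :: "'i filter"
    and K :: "'i \<Rightarrow> ('k :: complex_vector) inner_product_structure"
    and C B B' :: "'i \<Rightarrow> 'k \<Rightarrow> 'k"
    and f :: "'e \<Rightarrow> 'i \<Rightarrow> 'k" and \<gamma> \<beta> \<beta>' :: "'e \<Rightarrow> 'e"
    and \<kappa> :: "'e \<Rightarrow> 'e \<Rightarrow> complex"
  assumes G: "G \<noteq> bot" "\<forall>\<^sub>F \<omega> in G. \<omega> \<in> \<Omega>"
    and transform: "\<omega> \<in> \<Omega> \<Longrightarrow> bounded_transform (K \<omega>) (C \<omega>) (B \<omega>) (B' \<omega>)"
    and f_carrier: "\<omega> \<in> \<Omega> \<Longrightarrow> f e \<omega> \<in> carrier (K \<omega>)"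
    and f_shift: "\<omega> \<in> \<Omega> \<Longrightarrow> f (\<gamma> e) \<omega> = C \<omega> (f e \<omega>)" "\<omega> \<in> \<Omega> \<Longrightarrow> f (\<beta> e) \<omega> = B \<omega> (f e \<omega>)"
      "\<omega> \<in> \<Omega> \<Longrightarrow> f (\<beta>' e) \<omega> = B' \<omega> (f e \<omega>)"
    and kernel_lim: "((\<lambda>\<omega>. cinner (K \<omega>) (f p \<omega>) (f q \<omega>)) \<longlongrightarrow> \<kappa> p q) G"
begin

lemma kernel_eqI:
  assumes "\<And>\<omega>. \<omega> \<in> \<Omega> \<Longrightarrow> cinner (K \<omega>) (f p \<omega>) (f q \<omega>) = \<psi> \<omega>" "(\<psi> \<longlongrightarrow> l) G"
  shows "\<kappa> p q = l"
proof -
  have "\<forall>\<^sub>F \<omega> in G. \<psi> \<omega> = cinner (K \<omega>) (f p \<omega>) (f q \<omega>)"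
    using G(2) by eventually_elim (simp add: assms(1))
  then have "((\<lambda>\<omega>. cinner (K \<omega>) (f p \<omega>) (f q \<omega>)) \<longlongrightarrow> l) G"
    by (rule Lim_transform_eventually[OF assms(2)])
  then show ?thesis
    using kernel_lim tendsto_unique[OF G(1)] by blast
qed

lemma positive_kernel: "positive_kernel \<kappa>"
  unfolding positive_kernel_def
proof (intro conjI allI impI)
  fix p q
  show "\<kappa> q p = cnj (\<kappa> p q)"
  proof (rule kernel_eqI)
    show "cinner (K \<omega>) (f q \<omega>) (f p \<omega>) = cnj (cinner (K \<omega>) (f p \<omega>) (f q \<omega>))" if "\<omega> \<in> \<Omega>" for \<omega>
      using complex_inner_product_space.cinner_commute[OF bounded_transform.axioms(1)[OF transform]] that f_carrier
      by blast
    show "((\<lambda>\<omega>. cnj (cinner (K \<omega>) (f p \<omega>) (f q \<omega>))) \<longlongrightarrow> cnj (\<kappa> p q)) G"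
      by (intro tendsto_cnj kernel_lim)
  qed
next
  fix A :: "'e set" and c
  assume "finite A"
  have "((\<lambda>\<omega>. Re (\<Sum>p\<in>A. \<Sum>q\<in>A. c p * cnj (c q) * cinner (K \<omega>) (f p \<omega>) (f q \<omega>))) \<longlongrightarrow>
      Re (\<Sum>p\<in>A. \<Sum>q\<in>A. c p * cnj (c q) * \<kappa> p q)) G"
    by (intro tendsto_intros kernel_lim)
  moreover have "0 \<le> Re (\<Sum>p\<in>A. \<Sum>q\<in>A. c p * cnj (c q) * cinner (K \<omega>) (f p \<omega>) (f q \<omega>))" if "\<omega> \<in> \<Omega>" for \<omega>
  proof -
    interpret bounded_transform "K \<omega>" "C \<omega>" "B \<omega>" "B' \<omega>"
      using that by (rule transform)
    let ?s = "\<Sum>p\<in>A. c p *\<^sub>C f p \<omega>"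
    have car: "f p \<omega> \<in> carrier (K \<omega>)" for p
      using that by (rule f_carrier)
    have "cinner (K \<omega>) ?s ?s = (\<Sum>p\<in>A. \<Sum>q\<in>A. c p * cnj (c q) * cinner (K \<omega>) (f p \<omega>) (f q \<omega>))"
      using car by (simp add: cinner_sum_left cinner_sum_right sum_carrier carrier_closed cinner_scaleC_left
          cinner_scaleC_right sum_distrib_left)
        (subst sum.swap, simp add: mult_ac)
    then show ?thesis
      using cinner_ge_zero[of ?s] car by (simp add: sum_carrier carrier_closed)
  qed
  then have "\<forall>\<^sub>F \<omega> in G. 0 \<le> Re (\<Sum>p\<in>A. \<Sum>q\<in>A. c p * cnj (c q) * cinner (K \<omega>) (f p \<omega>) (f q \<omega>))"
    using G(2) by (auto elim: eventually_mono)
  ultimately show "0 \<le> Re (\<Sum>p\<in>A. \<Sum>q\<in>A. c p * cnj (c q) * \<kappa> p q)"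
    by (rule tendsto_lowerbound[OF _ _ G(1)])
qed

lemma kernel_cong:
  assumes "\<And>\<omega>. \<omega> \<in> \<Omega> \<Longrightarrow> f p \<omega> = f p' \<omega>"
  shows "\<kappa> p = \<kappa> p'"
proof
  fix q
  show "\<kappa> p q = \<kappa> p' q"
    using assms by (intro kernel_eqI[OF _ kernel_lim]) auto
qed

lemma kernel_add:
  assumes "\<And>\<omega>. \<omega> \<in> \<Omega> \<Longrightarrow> f p \<omega> = f p' \<omega> + f p'' \<omega>"
  shows "\<kappa> p = \<kappa> p' + \<kappa> p''"
proof
  fix q
  have "\<kappa> p q = \<kappa> p' q + \<kappa> p'' q"
  proof (rule kernel_eqI[OF _ tendsto_add[OF kernel_lim kernel_lim]])
    fix \<omega> assume \<omega>: "\<omega> \<in> \<Omega>"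
    then show "cinner (K \<omega>) (f p \<omega>) (f q \<omega>) = cinner (K \<omega>) (f p' \<omega>) (f q \<omega>) + cinner (K \<omega>) (f p'' \<omega>) (f q \<omega>)"
      using complex_inner_product_space.cinner_add_left[OF bounded_transform.axioms(1)[OF transform[OF \<omega>]]]
      by (simp add: assms f_carrier)
  qed
  then show "\<kappa> p q = (\<kappa> p' + \<kappa> p'') q"
    by simp
qed

lemma kernel_adjoint: "\<kappa> (\<gamma> p) q = \<kappa> p (\<gamma> q)" "\<kappa> (\<beta> p) q = \<kappa> p (\<beta>' q)"
  using bounded_transform.C_self_adjoint[OF transform] bounded_transform.B_adjoint[OF transform]
  by (auto intro!: kernel_eqI[OF _ kernel_lim] simp: f_shift f_carrier)

lemma bounded_transform_limit:
  assumes "kernel_space L \<kappa>"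
  shows "bounded_transform L (\<lambda>h. h \<circ> \<gamma>) (\<lambda>h. h \<circ> \<beta>') (\<lambda>h. h \<circ> \<beta>)"
proof -
  interpret kernel_space L \<kappa> by fact
  note T = bounded_transform.BC[OF transform] bounded_transform.B'C[OF transform]
    bounded_transform.B'B[OF transform] bounded_transform.BB'[OF transform]
  have "\<kappa> (\<gamma> p) = \<kappa> (\<beta>' (\<beta> p)) + \<kappa> (\<gamma> (\<gamma> p))" "\<kappa> (\<gamma> p) = \<kappa> (\<beta> (\<beta>' p)) + \<kappa> (\<gamma> (\<gamma> p))" for p
    using T(3,4) by (auto intro!: kernel_add simp: f_shift f_carrier)
  then have "\<kappa> (\<beta>' (\<beta> p)) = \<kappa> (\<gamma> p) - \<kappa> (\<gamma> (\<gamma> p))" "\<kappa> (\<beta> (\<beta>' p)) = \<kappa> (\<gamma> p) - \<kappa> (\<gamma> (\<gamma> p))" for p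
    by (metis add_diff_cancel_right')+
  moreover have "\<kappa> (\<beta> (\<gamma> p)) = \<kappa> (\<gamma> (\<beta> p))" "\<kappa> (\<beta>' (\<gamma> p)) = \<kappa> (\<gamma> (\<beta>' p))" for p
    using T(1,2) by (auto intro!: kernel_cong simp: f_shift f_carrier)
  ultimately show ?thesis
    by (intro bounded_transform_shift kernel_adjoint)
qed

end

theorem theorem3p1p2:
  fixes H :: "('a :: complex_vector) inner_product_structure"
    and \<Omega> :: "'i set"
    and le :: "'i \<Rightarrow> 'i \<Rightarrow> bool"
    and S\<omega> :: "'i \<Rightarrow> 'a operator"
    and S :: "'a operator"
    and X :: "'a set"
  assumes hilbert: "complex_hilbert_space H"
    and directed: "directed_set \<Omega> le"
    and subnormal: "\<And>\<omega>. \<omega> \<in> \<Omega> \<Longrightarrow> subnormal_in TYPE('k :: complex_vector) H (S\<omega> \<omega>)"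
    and S_linear: "linear_operator H S"
    and S_dense: "densely_defined H S"
    and X_subset: "X \<subseteq> carrier H"
    and i: "X \<subseteq> dom_infinity H S \<inter> (\<Inter>\<omega>\<in>\<Omega>. dom_infinity H (S\<omega> \<omega>))"
    and ii: "is_core H S (cspan (\<Union>n. (\<lambda>x. the (op_power H S n x)) ` X))"
    and iii: "\<And>x y m n. x \<in> X \<Longrightarrow> y \<in> X \<Longrightarrow>
      ((\<lambda>\<omega>. cinner H (the (op_power H (S\<omega> \<omega>) m x)) (the (op_power H (S\<omega> \<omega>) n y)))
        \<longlongrightarrow> cinner H (the (op_power H S m x)) (the (op_power H S n y))) (net_filter \<Omega> le)"
  shows "subnormal_in TYPE('a \<times> nat \<Rightarrow> complex) H S"
proof -
  interpret complex_hilbert_space H by fact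
  obtain K :: "'i \<Rightarrow> 'k inner_product_structure" and V C B B' where
    T: "\<And>\<omega>. \<omega> \<in> \<Omega> \<Longrightarrow> injective_bounded_transform (K \<omega>) (C \<omega>) (B \<omega>) (B' \<omega>)"
    and V: "\<And>\<omega>. \<omega> \<in> \<Omega> \<Longrightarrow> isometric_embedding H (K \<omega>) (V \<omega>)"
    and CB: "\<And>\<omega> h. \<omega> \<in> \<Omega> \<Longrightarrow> h \<in> dom (S\<omega> \<omega>) \<Longrightarrow> C \<omega> (V \<omega> (the (S\<omega> \<omega> h))) = B \<omega> (V \<omega> h)"
    using subnormal_imp_bounded_transform[OF subnormal] by metis
  note T' = T[THEN injective_bounded_transform.axioms(1)]
  have S\<omega>_linear: "linear_operator H (S\<omega> \<omega>)" if "\<omega> \<in> \<Omega>" for \<omega>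
    using subnormal[OF that] by (simp add: subnormal_in_def)
  define s where "s \<omega> n x = the (op_power H (S\<omega> \<omega>) n x)" for \<omega> n x
  define a where "a = (\<lambda>(x, n). the (op_power H S n x))"
  have s_car: "s \<omega> n x \<in> carrier H" if "\<omega> \<in> \<Omega>" "x \<in> X" for \<omega> n x
    unfolding s_def using that i X_subset S\<omega>_linear by (intro op_power_carrier) auto
  have s_Suc: "S\<omega> \<omega> (s \<omega> n x) = Some (s \<omega> (Suc n) x)" if "\<omega> \<in> \<Omega>" "x \<in> X" for \<omega> n x
    unfolding s_def using that i by (intro op_power_Suc_apply) auto
  have a_car: "a (x, n) \<in> carrier H" if "x \<in> X" for x n
    unfolding a_def using that i X_subset S_linear by (auto intro!: op_power_carrier)
  have a_Suc: "S (a (x, n)) = Some (a (x, Suc n))" if "x \<in> X" for x n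
    using that i op_power_Suc_apply[of x S n] by (auto simp: a_def)

  \<comment> \<open>For \<open>x\<close> outside \<open>X\<close> the vector is zero, which every word maps to zero.\<close>
  define f where "f e \<omega> = (case from_nat (snd e) of (n, w) \<Rightarrow>
      if fst e \<in> X then word_op (C \<omega>) (B \<omega>) (B' \<omega>) w (V \<omega> (s \<omega> n (fst e))) else 0)" for e :: "'a \<times> nat" and \<omega>
  have f_index: "f (index x n w) \<omega> = word_op (C \<omega>) (B \<omega>) (B' \<omega>) w (V \<omega> (s \<omega> n x))" if "x \<in> X" for x n w \<omega>
    using that by (simp add: f_def index_def)
  have f_shift: "f (shift l e) \<omega> = letter_op (C \<omega>) (B \<omega>) (B' \<omega>) l (f e \<omega>)" if "\<omega> \<in> \<Omega>" for l e \<omega>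
    using bounded_transform.letter_op_zero[OF T'[OF that]]
    by (cases "from_nat (snd e) :: nat \<times> letter list") (simp add: f_def shift_def index_def)
  have f_car: "f e \<omega> \<in> carrier (K \<omega>)" if "\<omega> \<in> \<Omega>" for e \<omega>
  proof -
    interpret K: bounded_transform "K \<omega>" "C \<omega>" "B \<omega>" "B' \<omega>"
      using that by (rule T')
    show ?thesis
      using isometric_embeddingD(1)[OF V s_car] that
      by (cases "from_nat (snd e) :: nat \<times> letter list") (auto simp: f_def K.carrier_closed K.word_op_carrier)
  qed

  let ?F = "net_filter \<Omega> le"
  note eventually_F = eventually_net_filter[OF directed]
  have \<Omega>: "\<Omega> \<noteq> {}" "\<forall>\<omega>\<in>\<Omega>. le \<omega> \<omega>"
    using directed unfolding directed_set_def by blast+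
  have "\<not> (\<forall>\<^sub>F \<omega> in ?F. False)"
    unfolding eventually_F using \<Omega>(2) by blast
  moreover have "\<forall>\<^sub>F \<omega> in ?F. \<omega> \<in> \<Omega>"
    unfolding eventually_F using \<Omega>(1) by blast
  ultimately have F: "?F \<noteq> bot" "\<forall>\<^sub>F \<omega> in ?F. \<omega> \<in> \<Omega>"
    by (simp_all add: eventually_False)
  have bounded_f: "\<exists>M. \<forall>\<^sub>F \<omega> in ?F. \<omega> \<in> \<Omega> \<and> hnorm (K \<omega>) (f e \<omega>) \<le> M" for e
  proof (cases "fst e \<in> X")
    case True
    obtain n :: nat and w :: "letter list" where nw: "from_nat (snd e) = (n, w)"
      by (rule prod.exhaust)
    have "((\<lambda>\<omega>. hnorm H (s \<omega> n (fst e))) \<longlongrightarrow> hnorm H (a (fst e, n))) ?F"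
      using iii[OF True True, of n n] unfolding hnorm_def s_def a_def by (auto intro!: tendsto_intros)
    then have "\<forall>\<^sub>F \<omega> in ?F. hnorm H (s \<omega> n (fst e)) < hnorm H (a (fst e, n)) + 1"
      by (rule order_tendstoD) simp
    with F(2) have "\<forall>\<^sub>F \<omega> in ?F. \<omega> \<in> \<Omega> \<and> hnorm (K \<omega>) (f e \<omega>) \<le> hnorm H (a (fst e, n)) + 1"
    proof eventually_elim
      case (elim \<omega>)
      interpret K: bounded_transform "K \<omega>" "C \<omega>" "B \<omega>" "B' \<omega>"
        using elim(1) by (rule T')
      have "hnorm (K \<omega>) (f e \<omega>) \<le> hnorm (K \<omega>) (V \<omega> (s \<omega> n (fst e)))"
        using True nw isometric_embeddingD(1)[OF V s_car] elim(1) by (simp add: f_def K.word_op_contractive)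
      also have "\<dots> = hnorm H (s \<omega> n (fst e))"
        using elim(1) True by (intro isometric_embedding_hnorm[OF V] s_car)
      finally show ?case
        using elim by simp
    qed
    then show ?thesis
      by blast
  next
    case False
    then have "f e \<omega> = 0" for \<omega>
      by (simp add: f_def split: prod.split)
    moreover have "hnorm (K \<omega>) 0 = 0" if "\<omega> \<in> \<Omega>" for \<omega>
      using complex_inner_product_space.hnorm_zero[OF bounded_transform.axioms(1)[OF T'[OF that]]] .
    ultimately show ?thesis
      using F(2) by (intro exI[of _ 0]) (auto elim: eventually_mono)
  qed
  have "\<exists>M. \<forall>\<^sub>F \<omega> in ?F. cmod (cinner (K \<omega>) (f (fst pq) \<omega>) (f (snd pq) \<omega>)) \<le> M" for pq
  proof -
    obtain M where M: "\<forall>\<^sub>F \<omega> in ?F. \<omega> \<in> \<Omega> \<and> hnorm (K \<omega>) (f (fst pq) \<omega>) \<le> M"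
      using bounded_f by blast
    obtain M' where M': "\<forall>\<^sub>F \<omega> in ?F. \<omega> \<in> \<Omega> \<and> hnorm (K \<omega>) (f (snd pq) \<omega>) \<le> M'"
      using bounded_f by blast
    from M M' have "\<forall>\<^sub>F \<omega> in ?F. cmod (cinner (K \<omega>) (f (fst pq) \<omega>) (f (snd pq) \<omega>)) \<le> M * M'"
    proof eventually_elim
      case (elim \<omega>)
      then interpret K: bounded_transform "K \<omega>" "C \<omega>" "B \<omega>" "B' \<omega>"
        by (intro T') blast
      have "hnorm (K \<omega>) (f (fst pq) \<omega>) * hnorm (K \<omega>) (f (snd pq) \<omega>) \<le> M * M'"
        using elim K.hnorm_nonneg[OF f_car, of "fst pq"] K.hnorm_nonneg[OF f_car, of "snd pq"]
        by (intro mult_mono) auto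
      then show ?case
        using K.Cauchy_Schwarz[OF f_car f_car] elim by (meson order_trans)
    qed
    then show ?thesis
      by blast
  qed
  then have "\<exists>G. G \<noteq> bot \<and> G \<le> ?F \<and>
      (\<forall>pq. \<exists>l. ((\<lambda>\<omega>. cinner (K \<omega>) (f (fst pq) \<omega>) (f (snd pq) \<omega>)) \<longlongrightarrow> l) G)"
    by (rule finer_filter_with_limits[OF F(1), of "\<lambda>\<omega> pq. cinner (K \<omega>) (f (fst pq) \<omega>) (f (snd pq) \<omega>)"]) blast
  then obtain G where G: "G \<noteq> bot" "G \<le> ?F"
    and "\<forall>pq. \<exists>l. ((\<lambda>\<omega>. cinner (K \<omega>) (f (fst pq) \<omega>) (f (snd pq) \<omega>)) \<longlongrightarrow> l) G"
    by blast
  then obtain \<kappa>' where \<kappa>': "\<And>pq. ((\<lambda>\<omega>. cinner (K \<omega>) (f (fst pq) \<omega>) (f (snd pq) \<omega>)) \<longlongrightarrow> \<kappa>' pq) G"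
    by metis
  define \<kappa> where "\<kappa> p q = \<kappa>' (p, q)" for p q
  interpret limit: limit_kernel \<Omega> G K C B B' f "shift Letter_C" "shift Letter_B" "shift Letter_B'" \<kappa>
  proof (rule limit_kernel.intro)
    show "\<forall>\<^sub>F \<omega> in G. \<omega> \<in> \<Omega>"
      using F(2) G(2) by (rule filter_leD[rotated])
    show "((\<lambda>\<omega>. cinner (K \<omega>) (f p \<omega>) (f q \<omega>)) \<longlongrightarrow> \<kappa> p q) G" for p q
      using \<kappa>'[of "(p, q)"] by (simp add: \<kappa>_def)
  qed (simp_all add: G(1) T' f_car f_shift)

  obtain L where L: "complex_hilbert_space L" "\<And>p. \<kappa> p \<in> carrier L"
    "\<And>h p. h \<in> carrier L \<Longrightarrow> cinner L h (\<kappa> p) = h p"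
    using reproducing_kernel_hilbert_space[OF limit.positive_kernel] by blast
  then interpret L: kernel_space L \<kappa>
    by (simp add: kernel_space_def kernel_space_axioms_def)
  \<comment> \<open>Composition acts on kernel functions through the adjoint letter, hence \<open>B\<^sub>0\<close> uses \<open>Letter_B'\<close>.\<close>
  define C\<^sub>0 B\<^sub>0 B\<^sub>0' :: "('a \<times> nat \<Rightarrow> complex) \<Rightarrow> 'a \<times> nat \<Rightarrow> complex" where
    "C\<^sub>0 = (\<lambda>h. h \<circ> shift Letter_C)" and "B\<^sub>0 = (\<lambda>h. h \<circ> shift Letter_B')" and "B\<^sub>0' = (\<lambda>h. h \<circ> shift Letter_B)"
  have transform: "bounded_transform L C\<^sub>0 B\<^sub>0 B\<^sub>0'"
    unfolding C\<^sub>0_def B\<^sub>0_def B\<^sub>0'_def by (rule limit.bounded_transform_limit) unfold_locales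
  have op_kernel: "C\<^sub>0 (\<kappa> p) = \<kappa> (shift Letter_C p)" "B\<^sub>0 (\<kappa> p) = \<kappa> (shift Letter_B p)"
    "B\<^sub>0' (\<kappa> p) = \<kappa> (shift Letter_B' p)" for p
    unfolding C\<^sub>0_def B\<^sub>0_def B\<^sub>0'_def
    using L.shift_kernel[of "shift Letter_C" "shift Letter_C"] L.shift_kernel[of "shift Letter_B" "shift Letter_B'"]
      limit.kernel_adjoint by auto

  \<comment> \<open>The limits of the vectors \<open>V \<omega> (s \<omega> n x)\<close>: the empty word.\<close>
  define b where "b = (\<lambda>(x, n). \<kappa> (index x n []))"
  have relation: "C \<omega> (V \<omega> (s \<omega> (Suc n) x)) = B \<omega> (V \<omega> (s \<omega> n x))" if "\<omega> \<in> \<Omega>" "x \<in> X" for \<omega> n x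
    using CB[OF that(1), of "s \<omega> n x"] s_Suc[OF that, of n] by auto
  have b_relation: "C\<^sub>0 (b (x, Suc n)) = B\<^sub>0 (b (x, n))" if "x \<in> X" for x n
    using that by (auto simp: b_def op_kernel shift_index f_index relation intro!: limit.kernel_cong)
  have b_decomposition: "b (x, n) = C\<^sub>0 (b (x, n)) + B\<^sub>0' (b (x, Suc n))" if "x \<in> X" for x n
    unfolding b_def prod.case op_kernel shift_index
  proof (rule limit.kernel_add)
    fix \<omega> assume \<omega>: "\<omega> \<in> \<Omega>"
    have "V \<omega> (s \<omega> n x) \<in> carrier (K \<omega>)" "V \<omega> (s \<omega> (Suc n) x) \<in> carrier (K \<omega>)"
      using \<omega> that by (auto intro!: isometric_embeddingD(1)[OF V] s_car)
    then show "f (index x n []) \<omega> = f (index x n [Letter_C]) \<omega> + f (index x (Suc n) [Letter_B']) \<omega>"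
      using injective_bounded_transform.graph_decomposition[OF T[OF \<omega>]] relation[OF \<omega> that]
      by (simp add: f_index that)
  qed

  \<comment> \<open>\<open>b_decomposition\<close> says that no part of \<open>b (x, n)\<close> escapes to infinity; it needs control of the next
      power, which convergence for all \<open>m\<close> and \<open>n\<close> provides.\<close>
  define M where "M = {h \<in> carrier L. \<forall>g\<in>carrier L. C\<^sub>0 g = 0 \<longrightarrow> cinner L h g = 0}"
  define L' where "L' = L\<lparr>carrier := M\<rparr>"
  have L': "complex_hilbert_space L'" and transform': "injective_bounded_transform L' C\<^sub>0 B\<^sub>0 B\<^sub>0'"
    unfolding L'_def M_def by (rule L.restrict_to_kernel_complement[OF transform])+
  interpret L': injective_bounded_transform L' C\<^sub>0 B\<^sub>0 B\<^sub>0'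
    by fact
  have b_carrier: "b (x, n) \<in> carrier L'" if "x \<in> X" for x n
  proof -
    have "C\<^sub>0 (b (x, n)) + B\<^sub>0' (b (x, Suc n)) \<in> M"
      unfolding M_def
      by (rule L.restrict_to_kernel_complement(3)[OF transform]) (simp_all add: b_def L.kernel_carrier)
    then show ?thesis
      using b_decomposition[OF that] by (simp add: L'_def)
  qed
  have gram: "cinner H (a (x, m)) (a (y, n)) = cinner L' (b (x, m)) (b (y, n))" if "x \<in> X" "y \<in> X" for x m y n
  proof -
    have "cinner L' (b (x, m)) (b (y, n)) = \<kappa> (index x m []) (index y n [])"
      by (simp add: L'_def b_def L.repr L.kernel_carrier)
    also have "\<dots> = cinner H (a (x, m)) (a (y, n))"
    proof (rule limit.kernel_eqI)
      show "((\<lambda>\<omega>. cinner H (s \<omega> m x) (s \<omega> n y)) \<longlongrightarrow> cinner H (a (x, m)) (a (y, n))) G"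
        using iii[OF that, of m n] G(2) unfolding s_def a_def by (auto intro: tendsto_mono)
      show "cinner (K \<omega>) (f (index x m []) \<omega>) (f (index y n []) \<omega>) = cinner H (s \<omega> m x) (s \<omega> n y)"
        if "\<omega> \<in> \<Omega>" for \<omega>
        using that \<open>x \<in> X\<close> \<open>y \<in> X\<close> by (simp add: f_index isometric_embeddingD(4)[OF V] s_car)
    qed
    finally show ?thesis
      by simp
  qed
  let ?J = "X \<times> (UNIV :: nat set)"
  have core: "is_core H S (cspan (a ` ?J))"
  proof -
    have "(\<Union>n. (\<lambda>x. the (op_power H S n x)) ` X) = a ` ?J"
      by (auto simp: a_def)
    with ii show ?thesis
      by simp
  qed
  obtain W where W: "isometric_embedding H L' W" "\<And>j. j \<in> ?J \<Longrightarrow> W (a j) = b j"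
  proof (rule isometry_if_gram_eq[of H L' ?J a b])
    show "hdense H (cspan (a ` ?J))"
      by (rule core_hdense[OF S_dense S_linear core])
  qed (use a_car b_carrier gram L' complex_inner_product_space_axioms in auto)
  note W' = isometric_embeddingD[OF W(1)]
  note S_lin = linear_operatorD[OF S_linear]
  have on_core: "h \<in> dom S \<and> C\<^sub>0 (W (the (S h))) = B\<^sub>0 (W h)" if "h \<in> cspan (a ` ?J)" for h
    using that
  proof (induction rule: complex_vector.span_induct_alt)
    case base
    have "W 0 = 0"
      using W'(3)[of 0 0] carrier_closed(1) by simp
    then show ?case
      using S_lin(6) by (simp only: L'.C_zero L'.B_zero domI option.sel simp_thms)
  next
    case (step c h k)
    then obtain x n where h: "x \<in> X" "h = a (x, n)"
      by auto
    obtain k' where k: "S k = Some k'" "C\<^sub>0 (W k') = B\<^sub>0 (W k)"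
      using step by auto
    have S_sum: "S (c *\<^sub>C h + k) = Some (c *\<^sub>C a (x, Suc n) + k')"
      using h a_Suc k by (intro S_lin(3,4)) auto
    have car: "h \<in> carrier H" "a (x, Suc n) \<in> carrier H" "k \<in> carrier H" "k' \<in> carrier H"
      using h k a_car S_lin(1,2) by auto
    have "C\<^sub>0 (W (a (x, Suc n))) = B\<^sub>0 (W h)"
      using h W(2) b_relation by simp
    then have "C\<^sub>0 (W (c *\<^sub>C a (x, Suc n) + k')) = B\<^sub>0 (W (c *\<^sub>C h + k))"
      using car k(2) by (simp add: W' carrier_closed L'.C_linear L'.B_linear L'.carrier_closed)
    with S_sum show ?case
      by auto
  qed
  have "L'.normal_op (W h) = Some (W (the (S h)))" if "h \<in> dom S" for h
  proof (rule extension_from_core[OF core _ W(1) L'.closed_normal_op _ _ that])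
    show "L'.normal_op (W h) = Some (W (the (S h)))" if "h \<in> cspan (a ` ?J)" for h
      using on_core[OF that] S_lin(1,2) W'(1) by (auto simp: L'.normal_op_iff)
    show "Map.graph L'.normal_op \<subseteq> carrier L' \<times> carrier L'"
      by (auto simp: Map.graph_def L'.normal_op_iff)
  qed unfold_locales
  moreover have "normal_operator L' L'.normal_op"
    by (rule complex_hilbert_space.normal_operator_normal_op[OF L' transform'])
  ultimately show ?thesis
    unfolding subnormal_in_def using S_linear S_dense L' W(1) by blast
qed

end
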